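(* Let $M$ be a $C^{2,1}$ manifold endowed with a $C^{1,1}$ Riemannian metric $g$ and corresponding locally Lipschitz Levi-Civita connection. Let $p\in M$ and let $\epsilon>0$. Let $x^\mu\colon U\to\mathbb{R}^n$ be a chart in a neighborhood of $p$ such that $g_{\alpha\beta}(p)=\delta_{\alpha\beta}$ and $\Gamma^\mu_{\alpha\beta}(p)=0$. Let $C\subset U$ be a coordinate ball around $p$ (which is convex normal for sufficiently small radius). For sufficiently small radius, for every $q,q_1,q_2\in C$, interpreting the minus sign and scalar product through the Euclidean structure induced by the coordinate system on $C$, $$\big|[dD^2_q(q_2)-dD^2_q(q_1)](q_2-q_1)-2(q_2-q_1)^2\big|\le\epsilon(q_2-q_1)^2,$$ and for every $q\in C$, every arc-length parametrized geodesic $x\colon J\to C$ and every $a,b\in J$, $a<b$, $$\big|\nabla_{\dot x(b)}D^2_q(x(b))-\nabla_{\dot x(a)}D^2_q(x(a))-2D(x(a),x(b))\big|\le\epsilon D(x(a),x(b)).$$ In particular, $D^2_q\colon C\to[0,+\infty)$ is strongly convex with parameter $\lambda=2-\epsilon$ with respect to both the Euclidean structure of $C$: for every $q,q_1,q_2\in C$, $\alpha\in[0,1]$, $$D(q,(1-\alpha)q_1+\alpha q_2)^2\le(1-\alpha)D(q,q_1)^2+\alpha D(q,q_2)^2-\Big(1-\frac{\epsilon}{2}\Big)\alpha(1-\alpha)\|q_2-q_1\|^2,$$ and the Riemannian structure of $C$: for every $q\in C$, geodesic $x\colon J\to C$, $a,b\in J$, $\alpha\in[0,1]$, $$D(q,x((1-\alpha)a+\alpha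 b))^2\le(1-\alpha)D(q,x(a))^2+\alpha D(q,x(b))^2-\Big(1-\frac{\epsilon}{2}\Big)\alpha(1-\alpha)D(x(a),x(b))^2.$$ Thus for any sufficiently small $r$ the open balls $D_p^{-1}([0,r))$ are contained in $C$ and are (strictly) convex normal neighborhoods.
   Context: $C^{k,1}$ means $C^{k,1}_{loc}$. $M$ is an $n$-dimensional paracompact connected $C^{2,1}$ manifold; charts are $C^{2,1}$. $\Gamma^\mu_{\alpha\beta}$ are the Christoffel symbols of the Levi-Civita connection. Geodesics are the non-stationary solutions of $\ddot x^\mu=-\Gamma^\mu_{\alpha\beta}(x)\dot x^\alpha\dot x^\beta$; $\gamma_v$ is the unique solution with initial velocity $v$, $\Omega_q\subset T_qM$ is the set of $v\in T_qM$ for which $\gamma_v$ is defined at least on $[0,1]$, and $\exp_qv:=\gamma_v(1)$. An open neighborhood $N$ of $q$ is normal if there is an open star-shaped ($v\in N_q$, $s\in[0,1]$ imply $sv\in N_q$) set $N_q\subset\Omega_q$ such that $\exp_q\colon N_q\to N$ is a homeomorphism, locally Lipschitz with locally Lipschitz inverse. An open set $C$ is convex normal if it is a normal neighborhood of each of its points; it is strictly convex normal if moreover any two points of $\bar C$ are connected by a unique geodesic contained in $C$ but for the endpoints. On a convex normal set $C$, for $q,r\in C$, $D^2_q(r):=g(\exp_q^{-1}(r),\exp_q^{-1}(r))$, where $\exp_q^{-1}\colon C\to N_q$, and $D_q(r)=D(q,r):=\sqrt{D^2_q(r)}$ (the Riemannian distance between $q$ and $r$ in $(C,g|_C)$). $\nabla_{\dot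 x}D^2_q$ denotes the derivative $dD^2_q(\dot x)$. A coordinate ball around $p$ of radius $\delta$ is the set of points whose Euclidean coordinate distance from $p$ is less than $\delta$; $\|\cdot\|$ is the Euclidean coordinate norm and $(q_2-q_1)^2=\|q_2-q_1\|^2$. *)

theory Defs
  imports "HOL-Analysis.Analysis"
begin

definition loc_lipschitz_on :: "'a::metric_space set \<Rightarrow> ('a \<Rightarrow> 'b::metric_space) \<Rightarrow> bool" where
  "loc_lipschitz_on S f \<longleftrightarrow> (\<forall>x\<in>S. \<exists>u>0. \<exists>L. L-lipschitz_on (cball x u \<inter> S) f)"

text \<open>Functions of class $C^{k,1}$ in the local sense. Only meaningful for open \<open>S\<close>; local Lipschitz continuity is required of the
  derivatives of order \<open>k\<close>.\<close>

primrec Ck1_on :: "nat \<Rightarrow> 'a::real_normed_vector set \<Rightarrow> ('a \<Rightarrow> 'b::real_normed_vector) \<Rightarrow> bool" where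
  "Ck1_on 0 S f \<longleftrightarrow> loc_lipschitz_on S f"
| "Ck1_on (Suc k) S f \<longleftrightarrow>
     (\<forall>x\<in>S. f differentiable (at x)) \<and>
     (\<forall>v. Ck1_on k S (\<lambda>x. frechet_derivative f (at x) v))"

text \<open>The manifold is the whole type \<open>'a\<close> with its topology. A chart is a pair of an open
  domain and a coordinate map; the values of the map outside the domain are irrelevant.\<close>

type_synonym ('a, 'n) chart = "'a set \<times> ('a \<Rightarrow> real^'n)"

definition cinv :: "('a, 'n::finite) chart \<Rightarrow> real^'n \<Rightarrow> 'a" where
  "cinv c = inv_into (fst c) (snd c)"

definition is_chart :: "('a::topological_space, 'n::finite) chart \<Rightarrow> bool" where
  "is_chart c \<longleftrightarrow> open (fst c) \<and> open (snd c ` fst c) \<and>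
     homeomorphism (fst c) (snd c ` fst c) (snd c) (cinv c)"

definition transition :: "('a, 'n::finite) chart \<Rightarrow> ('a, 'n) chart \<Rightarrow> real^'n \<Rightarrow> real^'n" where
  "transition c c' = (\<lambda>z. snd c' (cinv c z))"

definition C21_compatible :: "('a, 'n::finite) chart \<Rightarrow> ('a, 'n) chart \<Rightarrow> bool" where
  "C21_compatible c c' \<longleftrightarrow>
     Ck1_on 2 (snd c ` (fst c \<inter> fst c')) (transition c c') \<and>
     Ck1_on 2 (snd c' ` (fst c \<inter> fst c')) (transition c' c)"

text \<open>The atlas is maximal, so its members are all the charts of the manifold.\<close>

definition C21_structure :: "('a::topological_space, 'n::finite) chart set \<Rightarrow> bool" where
  "C21_structure A \<longleftrightarrow>
     (\<forall>c\<in>A. is_chart c) \<and>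
     \<Union> (fst ` A) = UNIV \<and>
     (\<forall>c\<in>A. \<forall>c'\<in>A. C21_compatible c c') \<and>
     (\<forall>c. is_chart c \<and> (\<forall>c'\<in>A. C21_compatible c c') \<longrightarrow> c \<in> A)"

definition paracompact_space :: "'a topology \<Rightarrow> bool" where
  "paracompact_space X \<longleftrightarrow>
     (\<forall>\<U>. (\<forall>U\<in>\<U>. openin X U) \<and> \<Union>\<U> = topspace X \<longrightarrow>
       (\<exists>\<V>. (\<forall>V\<in>\<V>. openin X V \<and> (\<exists>U\<in>\<U>. V \<subseteq> U)) \<and> \<Union>\<V> = topspace X \<and>
            locally_finite_in X \<V>))"

definition C21_manifold :: "('a::t2_space, 'n::finite) chart set \<Rightarrow> bool" where
  "C21_manifold A \<longleftrightarrow> C21_structure A \<and> connected (UNIV :: 'a set) \<and>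
     paracompact_space (euclidean :: 'a topology)"

text \<open>\<open>g c q $ \<alpha> $ \<beta>\<close> is the component \<open>g\<^sub>\<alpha>\<^sub>\<beta>\<close> at the point \<open>q\<close> in the chart \<open>c\<close>.
  Throughout, a tangent vector at \<open>q\<close> is given by its components in a chart at \<open>q\<close>.\<close>

type_synonym ('a, 'n) metric = "('a, 'n) chart \<Rightarrow> 'a \<Rightarrow> real^'n^'n"

definition C11_riemannian_metric ::
    "('a::topological_space, 'n::finite) chart set \<Rightarrow> ('a, 'n) metric \<Rightarrow> bool" where
  "C11_riemannian_metric A g \<longleftrightarrow>
     (\<forall>c\<in>A. \<forall>q\<in>fst c. transpose (g c q) = g c q \<and> (\<forall>v. v \<noteq> 0 \<longrightarrow> v \<bullet> (g c q *v v) > 0)) \<and>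
     (\<forall>c\<in>A. \<forall>\<alpha> \<beta>. Ck1_on 1 (snd c ` fst c) (\<lambda>z. g c (cinv c z) $ \<alpha> $ \<beta>)) \<and>
     (\<forall>c\<in>A. \<forall>c'\<in>A. \<forall>q\<in>fst c \<inter> fst c'.
        let J = matrix (frechet_derivative (transition c c') (at (snd c q)))
        in g c q = transpose J ** g c' q ** J)"

definition dmetric :: "('a, 'n::finite) metric \<Rightarrow> ('a, 'n) chart \<Rightarrow> 'a \<Rightarrow> 'n \<Rightarrow> 'n \<Rightarrow> 'n \<Rightarrow> real" where
  "dmetric g c q \<nu> \<alpha> \<beta> =
     frechet_derivative (\<lambda>z. g c (cinv c z) $ \<alpha> $ \<beta>) (at (snd c q)) (axis \<nu> 1)"

definition christoffel ::
    "('a, 'n::finite) metric \<Rightarrow> ('a, 'n) chart \<Rightarrow> 'a \<Rightarrow> 'n \<Rightarrow> 'n \<Rightarrow> 'n \<Rightarrow> real" where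
  "christoffel g c q \<mu> \<alpha> \<beta> =
     (\<Sum>\<nu>\<in>UNIV. (1/2) * matrix_inv (g c q) $ \<mu> $ \<nu> *
        (dmetric g c q \<alpha> \<nu> \<beta> + dmetric g c q \<beta> \<nu> \<alpha> - dmetric g c q \<nu> \<alpha> \<beta>))"

definition velocity :: "('a, 'n::finite) chart \<Rightarrow> real set \<Rightarrow> (real \<Rightarrow> 'a) \<Rightarrow> real \<Rightarrow> real^'n" where
  "velocity c J \<gamma> t = vector_derivative (\<lambda>s. snd c (\<gamma> s)) (at t within J)"

text \<open>Solutions of the geodesic equation on a nondegenerate interval, possibly containing
  endpoints (where derivatives are one-sided); only the values on \<open>J\<close> matter.\<close>

definition geodesic_solution ::
    "('a::topological_space, 'n::finite) chart set \<Rightarrow> ('a, 'n) metric \<Rightarrow> real set \<Rightarrow> (real \<Rightarrow> 'a) \<Rightarrow> bool" where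
  "geodesic_solution A g J \<gamma> \<longleftrightarrow>
     is_interval J \<and> interior J \<noteq> {} \<and> continuous_on J \<gamma> \<and>
     (\<forall>c\<in>A. \<forall>t\<in>J. \<gamma> t \<in> fst c \<longrightarrow>
        ((\<lambda>s. snd c (\<gamma> s)) has_vector_derivative velocity c J \<gamma> t) (at t within J) \<and>
        (velocity c J \<gamma> has_vector_derivative
           (\<chi> \<mu>. - (\<Sum>\<alpha>\<in>UNIV. \<Sum>\<beta>\<in>UNIV. christoffel g c (\<gamma> t) \<mu> \<alpha> \<beta> *
                      velocity c J \<gamma> t $ \<alpha> * velocity c J \<gamma> t $ \<beta>))) (at t within J))"

definition is_geodesic ::
    "('a::topological_space, 'n::finite) chart set \<Rightarrow> ('a, 'n) metric \<Rightarrow> real set \<Rightarrow> (real \<Rightarrow> 'a) \<Rightarrow> bool" where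
  "is_geodesic A g J \<gamma> \<longleftrightarrow> geodesic_solution A g J \<gamma> \<and> \<not> \<gamma> constant_on J"

definition arc_length_parametrized ::
    "('a::topological_space, 'n::finite) chart set \<Rightarrow> ('a, 'n) metric \<Rightarrow> real set \<Rightarrow> (real \<Rightarrow> 'a) \<Rightarrow> bool" where
  "arc_length_parametrized A g J \<gamma> \<longleftrightarrow>
     (\<forall>c\<in>A. \<forall>t\<in>J. \<gamma> t \<in> fst c \<longrightarrow>
        velocity c J \<gamma> t \<bullet> (g c (\<gamma> t) *v velocity c J \<gamma> t) = 1)"

text \<open>\<open>\<gamma>\<close> is the solution with initial velocity \<open>v \<in> T\<^sub>qM\<close> (components in the chart \<open>c\<close>),
  restricted to \<open>[0,1]\<close>. For \<open>v = 0\<close> it is constant.\<close>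

definition geodesic_from ::
    "('a::topological_space, 'n::finite) chart set \<Rightarrow> ('a, 'n) metric \<Rightarrow> ('a, 'n) chart \<Rightarrow>
     'a \<Rightarrow> real^'n \<Rightarrow> (real \<Rightarrow> 'a) \<Rightarrow> bool" where
  "geodesic_from A g c q v \<gamma> \<longleftrightarrow>
     geodesic_solution A g {0..1} \<gamma> \<and> \<gamma> 0 = q \<and> velocity c {0..1} \<gamma> 0 = v"

definition exp_dom ::
    "('a::topological_space, 'n::finite) chart set \<Rightarrow> ('a, 'n) metric \<Rightarrow> ('a, 'n) chart \<Rightarrow>
     'a \<Rightarrow> (real^'n) set" where
  "exp_dom A g c q = {v. \<exists>\<gamma>. geodesic_from A g c q v \<gamma>}"

definition exp_map ::
    "('a::topological_space, 'n::finite) chart set \<Rightarrow> ('a, 'n) metric \<Rightarrow> ('a, 'n) chart \<Rightarrow>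
     'a \<Rightarrow> real^'n \<Rightarrow> 'a" where
  "exp_map A g c q v = (THE m. \<exists>\<gamma>. geodesic_from A g c q v \<gamma> \<and> \<gamma> 1 = m)"

text \<open>\<open>S\<close> is the star-shaped set \<open>N\<^sub>q \<subseteq> T\<^sub>qM\<close>, in components with respect to \<open>c\<close>.
  Local Lipschitz continuity of maps from or to the manifold is understood in charts.\<close>

definition normal_domain ::
    "('a::topological_space, 'n::finite) chart set \<Rightarrow> ('a, 'n) metric \<Rightarrow> ('a, 'n) chart \<Rightarrow>
     'a \<Rightarrow> 'a set \<Rightarrow> (real^'n) set \<Rightarrow> bool" where
  "normal_domain A g c q N S \<longleftrightarrow>
     open S \<and> (\<forall>v\<in>S. \<forall>s\<in>{0..1}. s *\<^sub>R v \<in> S) \<and> S \<subseteq> exp_dom A g c q \<and>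
     (\<exists>h. homeomorphism S N (exp_map A g c q) h \<and>
        (\<forall>c'\<in>A.
           loc_lipschitz_on {v\<in>S. exp_map A g c q v \<in> fst c'} (\<lambda>v. snd c' (exp_map A g c q v)) \<and>
           loc_lipschitz_on (snd c' ` (N \<inter> fst c')) (\<lambda>z. h (cinv c' z))))"

text \<open>The choice of the chart \<open>c\<close> at \<open>q\<close> is immaterial, since a change of chart acts on
  \<open>T\<^sub>qM\<close> by a linear isomorphism.\<close>

definition normal_nbhd ::
    "('a::topological_space, 'n::finite) chart set \<Rightarrow> ('a, 'n) metric \<Rightarrow> 'a \<Rightarrow> 'a set \<Rightarrow> bool" where
  "normal_nbhd A g q N \<longleftrightarrow> open N \<and> q \<in> N \<and>
     (\<exists>c\<in>A. q \<in> fst c \<and> (\<exists>S. normal_domain A g c q N S))"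

definition convex_normal ::
    "('a::topological_space, 'n::finite) chart set \<Rightarrow> ('a, 'n) metric \<Rightarrow> 'a set \<Rightarrow> bool" where
  "convex_normal A g C \<longleftrightarrow> open C \<and> (\<forall>q\<in>C. normal_nbhd A g q C)"

text \<open>Uniqueness of the connecting geodesic is up to affine reparametrization, i.e. on \<open>[0,1]\<close>.
  The two points are distinct because geodesics are non-stationary.\<close>

definition strictly_convex_normal ::
    "('a::topological_space, 'n::finite) chart set \<Rightarrow> ('a, 'n) metric \<Rightarrow> 'a set \<Rightarrow> bool" where
  "strictly_convex_normal A g C \<longleftrightarrow> convex_normal A g C \<and>
     (\<forall>q\<in>closure C. \<forall>r\<in>closure C. q \<noteq> r \<longrightarrow>
        (let P = (\<lambda>\<gamma>. is_geodesic A g {0..1} \<gamma> \<and> \<gamma> 0 = q \<and> \<gamma> 1 = r \<and> \<gamma> ` {0<..<1} \<subseteq> C)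
         in (\<exists>\<gamma>. P \<gamma>) \<and> (\<forall>\<gamma> \<gamma>'. P \<gamma> \<and> P \<gamma>' \<longrightarrow> (\<forall>t\<in>{0..1}. \<gamma> t = \<gamma>' t))))"

text \<open>The set \<open>N\<^sub>q\<close> is determined by \<open>q\<close> and \<open>N\<close>: for \<open>v\<close> in one such set, the \<open>s \<in> [0,1]\<close> with
  \<open>s v\<close> in another one form a nonempty open and closed subset, by lifting \<open>exp\<^sub>q (s v)\<close>.\<close>

definition exp_inv ::
    "('a::topological_space, 'n::finite) chart set \<Rightarrow> ('a, 'n) metric \<Rightarrow> ('a, 'n) chart \<Rightarrow>
     'a \<Rightarrow> 'a set \<Rightarrow> 'a \<Rightarrow> real^'n" where
  "exp_inv A g c q N = inv_into (SOME S. normal_domain A g c q N S) (exp_map A g c q)"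

text \<open>\<open>D\<^sup>2\<^sub>q(r)\<close> and \<open>D(q,r)\<close> on a convex normal set \<open>C\<close>; as a scalar, independent of the
  chart \<open>c\<close> at \<open>q\<close> used to represent \<open>T\<^sub>qM\<close>.\<close>

definition sqdist_on ::
    "('a::topological_space, 'n::finite) chart set \<Rightarrow> ('a, 'n) metric \<Rightarrow> ('a, 'n) chart \<Rightarrow>
     'a set \<Rightarrow> 'a \<Rightarrow> 'a \<Rightarrow> real" where
  "sqdist_on A g c C q r = (let v = exp_inv A g c q C r in v \<bullet> (g c q *v v))"

definition dist_on ::
    "('a::topological_space, 'n::finite) chart set \<Rightarrow> ('a, 'n) metric \<Rightarrow> ('a, 'n) chart \<Rightarrow>
     'a set \<Rightarrow> 'a \<Rightarrow> 'a \<Rightarrow> real" where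
  "dist_on A g c C q r = sqrt (sqdist_on A g c C q r)"

definition coord_ball :: "('a, 'n::finite) chart \<Rightarrow> 'a \<Rightarrow> real \<Rightarrow> 'a set" where
  "coord_ball c p \<delta> = {m \<in> fst c. dist (snd c m) (snd c p) < \<delta>}"

definition differentiable_in :: "('a, 'n::finite) chart \<Rightarrow> ('a \<Rightarrow> real) \<Rightarrow> 'a \<Rightarrow> bool" where
  "differentiable_in c f m \<longleftrightarrow> (\<lambda>z. f (cinv c z)) differentiable (at (snd c m))"

definition differential :: "('a, 'n::finite) chart \<Rightarrow> ('a \<Rightarrow> real) \<Rightarrow> 'a \<Rightarrow> real^'n \<Rightarrow> real" where
  "differential c f m = frechet_derivative (\<lambda>z. f (cinv c z)) (at (snd c m))"

end

theory Submission
  imports Defs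
begin

text \<open>
  In coordinates with \<open>g = \<delta>\<close> and \<open>\<Gamma> = 0\<close> at \<open>p\<close>, a \<open>C\<^sup>1\<^sup>,\<^sup>1\<close> metric has Lipschitz first derivatives that vanish
  at \<open>p\<close>. On a small ball geodesics therefore have small acceleration, which moreover depends on position
  and velocity with a small Lipschitz constant. Everything follows from this by elementary estimates along
  curves, carried out for an abstract nearly flat metric on a ball of \<open>\<real>\<^sup>n\<close> (locale \<open>small_metric\<close>).

  Existence of a geodesic between any two points is a fixed point problem for its acceleration
  (\<open>geodesic_boundary_value_problem\<close>). The geodesic stays in every concentric ball that contains its end points
  because the squared distance to the centre is convex along it (\<open>geod_center_distance\<close>). The difference of two
  geodesics with a common starting point is almost straight (\<open>geod_difference\<close>). So initial and final velocity of
  the geodesic from \<open>q\<close> to \<open>r\<close> differ from \<open>r - q\<close> by maps with small Lipschitz constant in \<open>r\<close>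
  (\<open>velocity_difference\<close>); in particular the geodesic is unique, and the initial velocity is a bi-Lipschitz
  function of \<open>r\<close>.

  The squared distance is the energy of this geodesic. Its first variation shows, with a quadratic error
  bound, that it is differentiable at \<open>r\<close> with differential \<open>2 g(w, _)\<close> for the final velocity \<open>w\<close>
  (\<open>energy_first_variation\<close>). As \<open>w\<close> is almost \<open>r - q\<close> with a small Lipschitz error and \<open>g\<close> is almost Euclidean,
  the increments of the differential are as claimed (\<open>differential_estimate_straight\<close>,
  \<open>differential_estimate_geodesic\<close>), and a differential with such increments belongs to a strongly convex function
  (\<open>strongly_convex_of_derivative\<close>).

  Two points connect this to the manifold. First, a geodesic is required to satisfy its equation in all
  charts. In Euler-Lagrange form the equation involves only the metric and its first derivatives, and
  its invariance follows by differentiating the transformation law of the metric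
  (\<open>geodesic_accel_transform\<close>). Second, the exponential map of the manifold is inverted on the ball by the
  initial velocity: competing solutions agree as long as they stay in the ball, hence always
  (\<open>geodesic_from_unique\<close>); the star-shaped domain is open by invariance of domain
  (\<open>normal_domain_geod_convex\<close>); and it is unique (\<open>normal_domain_unique\<close>), so that the squared distance of
  every geodesically convex set is the energy (\<open>sqdist_on_eq_energy\<close>).

  Finally, small balls of the Riemannian distance are sublevel sets of a function that is strongly convex
  along geodesics. They are therefore geodesically convex, and a geodesic between two points of the closure has
  its interior strictly inside (\<open>energy_sublevel_strictly_convex\<close>).
\<close>

section \<open>Mean values, products and convexity along curves\<close>

text \<open>Every integration of an estimate along a curve goes through this form of the mean value theorem.
The constant velocity \<open>w\<close> is either zero or the velocity at some chosen time, so that the lemma also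
measures the deviation from a straight line.\<close>

lemma vector_mean_value:
  fixes f :: "real \<Rightarrow> 'b::real_normed_vector"
  assumes S: "convex S"
    and f: "\<And>t. t \<in> S \<Longrightarrow> (f has_vector_derivative f' t) (at t within S)"
    and bd: "\<And>t. t \<in> S \<Longrightarrow> norm (f' t - w) \<le> b"
    and ab: "a \<in> S" "d \<in> S"
  shows "norm (f d - f a - (d - a) *\<^sub>R w) \<le> b * \<bar>d - a\<bar>"
proof -
  define g where "g t = f t - t *\<^sub>R w" for t
  have "norm (g d - g a) \<le> b * norm (d - a)"
  proof (rule differentiable_bound[OF S _ _ ab(2,1)])
    fix t assume t: "t \<in> S"
    show "(g has_derivative (\<lambda>h. h *\<^sub>R (f' t - w))) (at t within S)"
      unfolding g_def using f[OF t] unfolding has_vector_derivative_def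
      by (auto intro!: derivative_eq_intros simp: scaleR_diff_right)
    show "onorm (\<lambda>h. h *\<^sub>R (f' t - w)) \<le> b"
      by (rule onorm_le) (use bd[OF t] in \<open>simp add: mult.commute[of b] mult_left_mono\<close>)
  qed
  then show ?thesis by (simp add: g_def algebra_simps)
qed

lemma bilinear_basis_expansion:
  fixes f :: "'e::euclidean_space \<Rightarrow> 'e \<Rightarrow> real"
  assumes "bilinear f"
  shows "f v w = (\<Sum>i\<in>Basis. \<Sum>j\<in>Basis. (v \<bullet> i) * (w \<bullet> j) * f i j)"
proof -
  have "f v w = f (\<Sum>i\<in>Basis. (v \<bullet> i) *\<^sub>R i) (\<Sum>j\<in>Basis. (w \<bullet> j) *\<^sub>R j)"
    by (simp add: euclidean_representation)
  also have "\<dots> = (\<Sum>(i,j)\<in>Basis\<times>Basis. f ((v \<bullet> i) *\<^sub>R i) ((w \<bullet> j) *\<^sub>R j))"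
    by (rule bilinear_sum[OF assms])
  also have "\<dots> = (\<Sum>i\<in>Basis. \<Sum>j\<in>Basis. f ((v \<bullet> i) *\<^sub>R i) ((w \<bullet> j) *\<^sub>R j))"
    by (rule sum.cartesian_product[symmetric])
  finally show ?thesis
    by (simp add: bilinear_lmul[OF assms] bilinear_rmul[OF assms] mult.assoc mult.left_commute)
qed

text \<open>Expanding both arguments in a basis reduces the claim to the product rule for real functions.\<close>

lemma bilinear_field_derivative_along_curve:
  fixes B :: "'z::real_normed_vector \<Rightarrow> 'e::euclidean_space \<Rightarrow> 'e \<Rightarrow> real"
  assumes B: "\<And>z. bilinear (B z)" and P: "\<And>u. bilinear (P u)"
    and dB: "\<And>v w. ((\<lambda>z. B z v w) has_derivative (\<lambda>u. P u v w)) (at (X t))"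
    and X: "(X has_vector_derivative X') (at t within S)"
    and V: "(V has_vector_derivative V') (at t within S)"
    and Y: "(Y has_vector_derivative Y') (at t within S)"
  shows "((\<lambda>t. B (X t) (V t) (Y t)) has_vector_derivative
     P X' (V t) (Y t) + B (X t) V' (Y t) + B (X t) (V t) Y') (at t within S)"
proof -
  have 1: "((\<lambda>s. B (X s) i j) has_vector_derivative P X' i j) (at t within S)" for i j
    using vector_derivative_diff_chain_within[OF X has_derivative_at_withinI[OF dB[of i j]]]
    by (simp add: o_def)
  have inn: "((\<lambda>s. Z s \<bullet> i) has_vector_derivative Z' \<bullet> i) (at t within S)"
    if "(Z has_vector_derivative Z') (at t within S)" for Z Z' and i :: 'e
    using bounded_linear.has_vector_derivative[OF bounded_linear_inner_left that] .
  have 2: "((\<lambda>s. (V s \<bullet> i) * (Y s \<bullet> j) * B (X s) i j) has_vector_derivative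
     (V t \<bullet> i) * (Y t \<bullet> j) * P X' i j + (V' \<bullet> i) * (Y t \<bullet> j) * B (X t) i j
     + (V t \<bullet> i) * (Y' \<bullet> j) * B (X t) i j) (at t within S)" for i j
    using has_vector_derivative_mult[OF has_vector_derivative_mult[OF inn[OF V, of i] inn[OF Y, of j]] 1[of i j]]
    by (simp add: algebra_simps)
  have "((\<lambda>s. \<Sum>i\<in>Basis. \<Sum>j\<in>Basis. (V s \<bullet> i) * (Y s \<bullet> j) * B (X s) i j) has_vector_derivative
     (\<Sum>i\<in>Basis. \<Sum>j\<in>Basis. (V t \<bullet> i) * (Y t \<bullet> j) * P X' i j + (V' \<bullet> i) * (Y t \<bullet> j) * B (X t) i j
     + (V t \<bullet> i) * (Y' \<bullet> j) * B (X t) i j)) (at t within S)"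
    by (intro has_vector_derivative_sum 2)
  then show ?thesis
    by (simp add: bilinear_basis_expansion[OF B, symmetric] bilinear_basis_expansion[OF P, symmetric] sum.distrib)
qed

lemma monotone_derivative_of_nonneg_second:
  fixes f :: "real \<Rightarrow> real"
  assumes f: "\<And>t. t \<in> {a..b} \<Longrightarrow> (f has_vector_derivative f' t) (at t within {a..b})"
    and nonneg: "\<And>t. t \<in> {a..b} \<Longrightarrow> 0 \<le> f' t"
    and st: "a \<le> s" "s \<le> t" "t \<le> b"
  shows "f s \<le> f t"
proof (cases "s = t")
  case False
  then have lt: "s < t" using st by simp
  have d: "(f has_derivative (\<lambda>h. h *\<^sub>R f' x)) (at x within {s..t})" if "x \<in> {s..t}" for x
    using f[of x] that st unfolding has_vector_derivative_def
    by (meson atLeastAtMost_iff atLeastatMost_subset_iff has_derivative_subset order_trans)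
  obtain x where "x \<in> {s<..<t}" "f t - f s = (t - s) *\<^sub>R f' x"
    using mvt_simple[OF lt, of f "\<lambda>x h. h *\<^sub>R f' x"] d by (metis atLeastAtMost_iff)
  moreover from this(1) have "0 \<le> (t - s) * f' x" using nonneg[of x] lt st by (intro mult_nonneg_nonneg) auto
  ultimately show ?thesis by simp
qed simp

text \<open>After subtracting \<open>l/2 * t\<^sup>2\<close> the derivative is nondecreasing, and the mean value theorem on both sides
of \<open>\<alpha>\<close> compares the slopes.\<close>

lemma strongly_convex_of_derivative:
  fixes f :: "real \<Rightarrow> real"
  assumes f: "\<And>t. t \<in> {0..1} \<Longrightarrow> (f has_vector_derivative f' t) (at t within {0..1})"
    and mono: "\<And>s t. 0 \<le> s \<Longrightarrow> s < t \<Longrightarrow> t \<le> 1 \<Longrightarrow> l * (t - s) \<le> f' t - f' s"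
    and al: "\<alpha> \<in> {0..1}"
  shows "f \<alpha> \<le> (1 - \<alpha>) * f 0 + \<alpha> * f 1 - l / 2 * \<alpha> * (1 - \<alpha>)"
proof (cases "\<alpha> = 0 \<or> \<alpha> = 1")
  case False
  then have al': "0 < \<alpha>" "\<alpha> < 1" using al by auto
  define k where "k = l / 2"
  then have l: "l = 2 * k" by simp
  define h where "h t = f t - k * t\<^sup>2" for t
  have h: "(h has_derivative (\<lambda>y. y * (f' x - l * x))) (at x within S)" if "x \<in> {0..1}" "S \<subseteq> {0..1}" for x S
  proof -
    have "(f has_derivative (\<lambda>y. y *\<^sub>R f' x)) (at x within S)"
      using f[OF that(1)] that(2) unfolding has_vector_derivative_def by (rule has_derivative_subset)
    then show ?thesis unfolding h_def
      by (auto intro!: derivative_eq_intros simp: l algebra_simps)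
  qed
  have "\<exists>x\<in>{0<..<\<alpha>}. h \<alpha> - h 0 = (\<alpha> - 0) * (f' x - l * x)"
    by (rule mvt_simple[OF al'(1)]) (use al' in \<open>auto intro!: h\<close>)
  then obtain u where u: "0 < u" "u < \<alpha>" "h \<alpha> - h 0 = \<alpha> * (f' u - l * u)" by auto
  have "\<exists>x\<in>{\<alpha><..<1}. h 1 - h \<alpha> = (1 - \<alpha>) * (f' x - l * x)"
    by (rule mvt_simple[OF al'(2)]) (use al' in \<open>auto intro!: h\<close>)
  then obtain v where v: "\<alpha> < v" "v < 1" "h 1 - h \<alpha> = (1 - \<alpha>) * (f' v - l * v)" by auto
  have "f' u - l * u \<le> f' v - l * v" using mono[of u v] u v by (simp add: algebra_simps)
  then have "(\<alpha> * (1 - \<alpha>)) * (f' u - l * u) \<le> (\<alpha> * (1 - \<alpha>)) * (f' v - l * v)"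
    using al' by (intro mult_left_mono) auto
  then have "(1 - \<alpha>) * (h \<alpha> - h 0) \<le> \<alpha> * (h 1 - h \<alpha>)"
    unfolding u(3) v(3) by (simp add: mult.assoc mult.left_commute)
  then show ?thesis by (simp add: h_def k_def[symmetric] power2_eq_square algebra_simps)
qed auto

section \<open>A nearly flat metric on a ball\<close>

text \<open>A Riemannian metric on a ball of \<open>\<real>\<^sup>n\<close>, seen only through the data that enter the estimates.
\<open>B z\<close> is the scalar product at \<open>z\<close>, \<open>P z u v w\<close> the derivative of \<open>B z v w\<close> in the direction \<open>u\<close>, and
\<open>N z v\<close> the acceleration of a geodesic passing through \<open>z\<close> with velocity \<open>v\<close>. The acceleration is
specified by the Euler-Lagrange equation of the energy, so neither the Christoffel symbols nor the
inverse of the metric have to be estimated.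

At the centre the metric is Euclidean and its first derivatives vanish. As these are Lipschitz with
constant \<open>K\<close>, on the ball they are of size \<open>K * \<delta>\<close>, which is bounded by the small number \<open>\<kappa>\<close>.
Geodesics are studied in the ball \<open>C\<close> of radius \<open>\<delta>\<close>; the curves in the fixed point argument that
produces them are only known to stay in the ball \<open>W\<close> of twice the radius.\<close>

locale small_metric =
  fixes c :: "'e::euclidean_space" and \<delta> K \<kappa> :: real
    and B :: "'e \<Rightarrow> 'e \<Rightarrow> 'e \<Rightarrow> real" and P :: "'e \<Rightarrow> 'e \<Rightarrow> 'e \<Rightarrow> 'e \<Rightarrow> real"
    and N :: "'e \<Rightarrow> 'e \<Rightarrow> 'e"
  assumes delta: "0 < \<delta>" "\<delta> \<le> 1" and K: "0 \<le> K" "K * \<delta> \<le> \<kappa>" and kappa: "\<kappa> \<le> 1 / 100000"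
    and bilinB: "\<And>z. bilinear (B z)" and bilinP: "\<And>z u. bilinear (P z u)"
    and symB: "\<And>z v w. z \<in> ball c (2*\<delta>) \<Longrightarrow> B z v w = B z w v"
    and B_center: "\<And>v w. B c v w = v \<bullet> w"
    and derivB: "\<And>z v w. z \<in> ball c (2*\<delta>) \<Longrightarrow> ((\<lambda>z. B z v w) has_derivative (\<lambda>u. P z u v w)) (at z)"
    and P_lipschitz: "\<And>z z' u v w. z \<in> ball c (2*\<delta>) \<Longrightarrow> z' \<in> ball c (2*\<delta>) \<Longrightarrow>
       \<bar>P z u v w - P z' u v w\<bar> \<le> K * norm (z - z') * (norm u * norm v * norm w)"
    and P_center: "\<And>u v w. P c u v w = 0"
    and euler_lagrange: "\<And>z u v. z \<in> ball c (2*\<delta>) \<Longrightarrow> B z u (N z v) = P z u v v / 2 - P z v u v"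
begin

abbreviation "W \<equiv> ball c (2*\<delta>)"
abbreviation "C \<equiv> ball c \<delta>"

lemma C_sub: "z \<in> C \<Longrightarrow> z \<in> W" using delta by simp
lemma c_in: "c \<in> W" "c \<in> C" using delta by auto
lemma kappa_nonneg: "0 \<le> \<kappa>" using K delta by (meson mult_nonneg_nonneg less_imp_le order_trans)

lemmas B_simps = bilinear_ladd[OF bilinB] bilinear_radd[OF bilinB] bilinear_lsub[OF bilinB] bilinear_rsub[OF bilinB]
  bilinear_lmul[OF bilinB] bilinear_rmul[OF bilinB]
lemmas P_simps = bilinear_ladd[OF bilinP] bilinear_radd[OF bilinP] bilinear_lsub[OF bilinP] bilinear_rsub[OF bilinP]
  bilinear_lmul[OF bilinP] bilinear_rmul[OF bilinP]

lemma P_linear: "z \<in> W \<Longrightarrow> linear (\<lambda>u. P z u v w)"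
  using derivB has_derivative_linear by blast

lemma symP: assumes z: "z \<in> W" shows "P z u v w = P z u w v"
proof -
  have "((\<lambda>z. B z v w) has_derivative (\<lambda>u. P z u w v)) (at z)"
    by (rule has_derivative_transform_within_open[OF derivB[OF z] open_ball z]) (simp add: symB)
  from has_derivative_unique[OF this derivB[OF z]] show ?thesis by metis
qed

lemma P_bound: assumes z: "z \<in> W" shows "\<bar>P z u v w\<bar> \<le> K * norm (z - c) * (norm u * norm v * norm w)"
  using P_lipschitz[OF z c_in(1)] by (simp add: P_center)

lemma P_small: assumes z: "z \<in> W" shows "\<bar>P z u v w\<bar> \<le> 2 * \<kappa> * (norm u * norm v * norm w)"
proof -
  have "K * norm (z - c) \<le> K * (2 * \<delta>)"
    using z K(1) by (intro mult_left_mono) (auto simp: dist_norm norm_minus_commute)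
  also have "\<dots> \<le> 2 * \<kappa>" using K by simp
  finally have "K * norm (z - c) * (norm u * norm v * norm w) \<le> 2 * \<kappa> * (norm u * norm v * norm w)"
    by (rule mult_right_mono) simp
  with P_bound[OF z] show ?thesis by (rule order_trans)
qed

lemma B_lipschitz: assumes z: "z \<in> W" "z' \<in> W"
  shows "\<bar>B z v w - B z' v w\<bar> \<le> 2 * \<kappa> * norm (z - z') * (norm v * norm w)"
proof -
  have "norm (B z v w - B z' v w) \<le> (2 * \<kappa> * (norm v * norm w)) * norm (z - z')"
  proof (rule differentiable_bound[OF convex_ball _ _ z])
    fix y assume y: "y \<in> W"
    show "((\<lambda>z. B z v w) has_derivative (\<lambda>u. P y u v w)) (at y within W)"
      using derivB[OF y] by (rule has_derivative_at_withinI)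
    show "onorm (\<lambda>u. P y u v w) \<le> 2 * \<kappa> * (norm v * norm w)"
      by (rule onorm_le) (use P_small[OF y, of _ v w] in \<open>simp add: ac_simps\<close>)
  qed
  then show ?thesis by (simp add: ac_simps)
qed

lemma B_near: assumes z: "z \<in> W" shows "\<bar>B z v w - v \<bullet> w\<bar> \<le> 4 * \<kappa> * (norm v * norm w)"
proof -
  have "norm (z - c) \<le> 2" using z delta by (auto simp: dist_norm norm_minus_commute)
  then have "2 * \<kappa> * norm (z - c) * (norm v * norm w) \<le> 2 * \<kappa> * 2 * (norm v * norm w)"
    using kappa_nonneg by (intro mult_right_mono mult_left_mono) auto
  with B_lipschitz[OF z c_in(1), of v w] show ?thesis unfolding B_center by linarith
qed

lemma B_bound: assumes z: "z \<in> W" shows "\<bar>B z v w\<bar> \<le> 2 * (norm v * norm w)"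
proof -
  have "4 * \<kappa> * (norm v * norm w) \<le> 1 * (norm v * norm w)"
    using kappa by (intro mult_right_mono) auto
  with B_near[OF z, of v w] Cauchy_Schwarz_ineq2[of v w] show ?thesis by linarith
qed

lemma B_coercive: assumes z: "z \<in> W" shows "(norm v)\<^sup>2 / 2 \<le> B z v v"
proof -
  have "4 * \<kappa> * (norm v)\<^sup>2 \<le> 1/2 * (norm v)\<^sup>2"
    using kappa by (intro mult_right_mono) auto
  with B_near[OF z, of v v] show ?thesis by (simp add: power2_norm_eq_inner power2_eq_square[symmetric])
qed

lemma B_pos: assumes z: "z \<in> W" and "v \<noteq> 0" shows "0 < B z v v"
  using B_coercive[OF z, of v] assms(2) by (smt (verit) zero_less_power zero_less_norm_iff half_gt_zero)

lemma N_unique: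
  assumes z: "z \<in> W" and a: "\<And>u. B z u a = P z u v v / 2 - P z v u v"
  shows "a = N z v"
proof (rule ccontr)
  assume "a \<noteq> N z v"
  then have "0 < B z (a - N z v) (a - N z v)" using B_pos[OF z] by simp
  then show False using a[of "a - N z v"] euler_lagrange[OF z, of "a - N z v" v] by (simp only: B_simps)
qed

text \<open>This is what makes affine reparametrizations of geodesics geodesics.\<close>

lemma N_homogeneous: assumes z: "z \<in> W" shows "N z (s *\<^sub>R v) = s\<^sup>2 *\<^sub>R N z v"
proof (rule N_unique[OF z, symmetric])
  fix u
  have "P z (s *\<^sub>R v) u v = s * P z v u v"
    using linear_cmul[OF P_linear[OF z, of u v], of s v] by simp
  then show "B z u (s\<^sup>2 *\<^sub>R N z v) = P z u (s *\<^sub>R v) (s *\<^sub>R v) / 2 - P z (s *\<^sub>R v) u (s *\<^sub>R v)"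
    by (simp add: euler_lagrange[OF z] B_simps P_simps power2_eq_square algebra_simps)
qed

text \<open>Bounds on the acceleration are obtained by testing the Euler-Lagrange equation with the vector to be estimated.\<close>

lemma norm_le_of_B:
  assumes z: "z \<in> W" and "0 \<le> e" and "B z b b \<le> e * norm b"
  shows "norm b \<le> 2 * e"
proof (cases "b = 0")
  case False
  have "(norm b / 2) * norm b \<le> e * norm b"
    using B_coercive[OF z, of b] assms(3) by (simp add: power2_eq_square)
  then have "norm b / 2 \<le> e" by (rule mult_right_le_imp_le) (use False in simp)
  then show ?thesis by simp
qed (use assms in simp)

lemma N_bound: assumes z: "z \<in> W" shows "norm (N z v) \<le> 3 * K * norm (z - c) * (norm v)\<^sup>2"
proof -
  have "B z (N z v) (N z v) \<le> (3/2 * K * norm (z - c) * (norm v)\<^sup>2) * norm (N z v)"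
    using euler_lagrange[OF z, of "N z v" v] P_bound[OF z, of "N z v" v v] P_bound[OF z, of v "N z v" v]
    by (simp add: power2_eq_square ac_simps abs_le_iff)
  from norm_le_of_B[OF z _ this] K(1) show ?thesis by simp
qed

text \<open>The difference of two Euler-Lagrange equations is tested with the difference \<open>b\<close> of the accelerations.
Changes of position are controlled by the Lipschitz constant of \<open>P\<close>, changes of velocity by the size of \<open>P\<close>.\<close>

lemma N_lipschitz:
  assumes z: "z \<in> W" "z' \<in> W"
  shows "norm (N z v - N z' v') \<le> 9 * K * (norm (z - z') * ((norm v)\<^sup>2 + (norm v')\<^sup>2)
     + norm (z' - c) * (norm v + norm v') * norm (v - v'))"
proof -
  define b where "b = N z v - N z' v'"
  let ?d = "norm (z - z')" let ?r = "norm (z' - c)" let ?n = "norm (v - v')"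
  let ?R = "K * ?d * (norm v)\<^sup>2 + K * ?r * (norm v + norm v') * ?n"
  have 1: "\<bar>P z b v v - P z' b v' v'\<bar> \<le> ?R * norm b"
  proof -
    have "P z b v v - P z' b v' v' = (P z b v v - P z' b v v) + P z' b (v - v') v + P z' b v' (v - v')"
      by (simp add: P_simps)
    then have "\<bar>P z b v v - P z' b v' v'\<bar> \<le> \<bar>P z b v v - P z' b v v\<bar> + \<bar>P z' b (v - v') v\<bar> + \<bar>P z' b v' (v - v')\<bar>"
      by linarith
    also have "\<dots> \<le> K * ?d * (norm b * norm v * norm v) + K * ?r * (norm b * ?n * norm v) + K * ?r * (norm b * norm v' * ?n)"
      by (intro add_mono P_lipschitz[OF z] P_bound[OF z(2)])
    finally show ?thesis by (simp add: algebra_simps power2_eq_square)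
  qed
  have 2: "\<bar>P z v b v - P z' v' b v'\<bar> \<le> ?R * norm b"
  proof -
    have "P z v b v - P z' v' b v' = (P z v b v - P z' v b v) + P z' (v - v') b v + P z' v' b (v - v')"
      using linear_diff[OF P_linear[OF z(2)]] by (simp add: P_simps)
    then have "\<bar>P z v b v - P z' v' b v'\<bar> \<le> \<bar>P z v b v - P z' v b v\<bar> + \<bar>P z' (v - v') b v\<bar> + \<bar>P z' v' b (v - v')\<bar>"
      by linarith
    also have "\<dots> \<le> K * ?d * (norm v * norm b * norm v) + K * ?r * (?n * norm b * norm v) + K * ?r * (norm v' * norm b * ?n)"
      by (intro add_mono P_lipschitz[OF z] P_bound[OF z(2)])
    finally show ?thesis by (simp add: algebra_simps power2_eq_square)
  qed
  have 3: "\<bar>B z' b (N z' v') - B z b (N z' v')\<bar> \<le> (3 * K * ?d * (norm v')\<^sup>2) * norm b"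
  proof -
    have "?r \<le> 2" using z(2) delta by (auto simp: dist_norm norm_minus_commute)
    then have "3 * K * ?r * (norm v')\<^sup>2 \<le> 3 * K * 2 * (norm v')\<^sup>2"
      using K(1) by (intro mult_right_mono mult_left_mono) auto
    with N_bound[OF z(2), of v'] have "norm (N z' v') \<le> 6 * K * (norm v')\<^sup>2" by simp
    then have "2 * \<kappa> * ?d * (norm b * norm (N z' v')) \<le> 2 * \<kappa> * ?d * (norm b * (6 * K * (norm v')\<^sup>2))"
      using kappa_nonneg by (intro mult_left_mono) auto
    also have "\<dots> = 12 * \<kappa> * (K * ?d * (norm v')\<^sup>2 * norm b)" by simp
    also have "\<dots> \<le> 3 * (K * ?d * (norm v')\<^sup>2 * norm b)"
      using kappa K(1) by (intro mult_right_mono) auto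
    finally show ?thesis using B_lipschitz[OF z(2,1), of b "N z' v'"] by (simp add: norm_minus_commute)
  qed
  have "B z b b = (P z b v v - P z' b v' v') / 2 - (P z v b v - P z' v' b v') + (B z' b (N z' v') - B z b (N z' v'))"
    using euler_lagrange[OF z(1), of b v] euler_lagrange[OF z(2), of b v'] 
    by (subst (2) b_def) (simp add: B_simps diff_divide_distrib)
  moreover have "x \<le> t / 2 + t + w" if "x = p / 2 - q + r" "p \<le> t" "- q \<le> t" "r \<le> w" for x p q r t w :: real
    using that by linarith
  ultimately have "B z b b \<le> (?R * norm b) / 2 + ?R * norm b + (3 * K * ?d * (norm v')\<^sup>2) * norm b"
    using abs_le_D1[OF 1] abs_le_D2[OF 2] abs_le_D1[OF 3] by blast
  also have "\<dots> \<le> ?R * norm b + ?R * norm b + (3 * K * ?d * (norm v')\<^sup>2) * norm b"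
    using K(1) by simp
  also have "\<dots> = (2 * ?R + 3 * K * ?d * (norm v')\<^sup>2) * norm b" by (simp add: algebra_simps)
  finally have "norm b \<le> 2 * (2 * ?R + 3 * K * ?d * (norm v')\<^sup>2)"
    by (rule norm_le_of_B[OF z(1), rotated]) (use K(1) in simp)
  also have "\<dots> = 4 * (K * ?d * (norm v)\<^sup>2) + 4 * (K * ?r * (norm v + norm v') * ?n) + 6 * (K * ?d * (norm v')\<^sup>2)" by simp
  also have "\<dots> \<le> 9 * (K * ?d * (norm v)\<^sup>2) + 9 * (K * ?r * (norm v + norm v') * ?n) + 9 * (K * ?d * (norm v')\<^sup>2)"
    using K(1) by (intro add_mono mult_right_mono) auto
  also have "\<dots> = 9 * K * (?d * ((norm v)\<^sup>2 + (norm v')\<^sup>2) + ?r * (norm v + norm v') * ?n)"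
    by (simp add: algebra_simps)
  finally show ?thesis unfolding b_def .
qed

section \<open>Geodesics of the nearly flat metric\<close>

definition geod :: "real set \<Rightarrow> (real \<Rightarrow> 'e) \<Rightarrow> (real \<Rightarrow> 'e) \<Rightarrow> bool" where
  "geod S X V \<longleftrightarrow> (\<forall>t\<in>S. (X has_vector_derivative V t) (at t within S) \<and>
     (V has_vector_derivative N (X t) (V t)) (at t within S))"

lemma geodD:
  assumes "geod S X V" "t \<in> S"
  shows "(X has_vector_derivative V t) (at t within S)" "(V has_vector_derivative N (X t) (V t)) (at t within S)"
  using assms unfolding geod_def by auto

lemma geod_affine:
  assumes g: "geod S X V" and XW: "X ` S \<subseteq> W" and sub: "(\<lambda>t. a + t * b) ` T \<subseteq> S"
  shows "geod T (\<lambda>t. X (a + t * b)) (\<lambda>t. b *\<^sub>R V (a + t * b))"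
  unfolding geod_def
proof (intro ballI conjI)
  fix t assume t: "t \<in> T"
  let ?f = "\<lambda>t. a + t * b"
  have f: "(?f has_vector_derivative b) (at t within T)"
    by (auto intro!: derivative_eq_intros)
  have ft: "?f t \<in> S" using t sub by auto
  note d = geodD[OF g ft, THEN has_vector_derivative_within_subset, OF sub]
  show "((\<lambda>t. X (?f t)) has_vector_derivative b *\<^sub>R V (?f t)) (at t within T)"
    using vector_diff_chain_within[OF f d(1)] by (simp add: o_def)
  have "((\<lambda>t. V (?f t)) has_vector_derivative b *\<^sub>R N (X (?f t)) (V (?f t))) (at t within T)"
    using vector_diff_chain_within[OF f d(2)] by (simp add: o_def)
  from bounded_linear.has_vector_derivative[OF bounded_linear_scaleR_right this, of b]
  have "((\<lambda>t. b *\<^sub>R V (?f t)) has_vector_derivative b\<^sup>2 *\<^sub>R N (X (?f t)) (V (?f t))) (at t within T)"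
    by (simp add: power2_eq_square)
  moreover have "X (?f t) \<in> W" using ft XW by auto
  ultimately show "((\<lambda>t. b *\<^sub>R V (?f t)) has_vector_derivative N (X (?f t)) (b *\<^sub>R V (?f t))) (at t within T)"
    by (simp add: N_homogeneous)
qed

lemma geod_const: "z \<in> W \<Longrightarrow> geod S (\<lambda>_. z) (\<lambda>_. 0)"
  using N_homogeneous[of z 0 0] by (auto simp: geod_def)

lemma geod_continuous:
  assumes "geod S X V" shows "continuous_on S X" "continuous_on S V"
  using geodD[OF assms] by (auto simp: continuous_on_eq_continuous_within intro!: has_vector_derivative_continuous)

lemma N_bound_C: assumes "z \<in> C" shows "norm (N z v) \<le> 3 * \<kappa> * (norm v)\<^sup>2"
proof -
  have "K * norm (z - c) \<le> K * \<delta>"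
    using assms K(1) by (intro mult_left_mono) (auto simp: dist_norm norm_minus_commute)
  then have "K * norm (z - c) * (norm v)\<^sup>2 \<le> \<kappa> * (norm v)\<^sup>2" using K by (intro mult_right_mono) auto
  then show ?thesis using N_bound[OF C_sub[OF assms], of v] by simp
qed

text \<open>If the speed were large somewhere, then moving on from there for a short time along an
  almost straight line would leave the ball.\<close>

lemma geod_velocity_bound:
  assumes g: "geod {0..1} X V" and XC: "X ` {0..1} \<subseteq> C" and t: "t \<in> {0..1}"
  shows "norm (V t) \<le> 8 * \<delta>"
proof -
  have "continuous_on {0..1} (\<lambda>t. norm (V t))" by (intro continuous_intros geod_continuous[OF g])
  then obtain t0 where t0: "t0 \<in> {0..1}" "\<And>s. s \<in> {0..1} \<Longrightarrow> norm (V s) \<le> norm (V t0)"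
    using continuous_attains_sup[of "{0..1::real}" "\<lambda>t. norm (V t)"] by auto
  define M where "M = norm (V t0)"
  have "M \<le> 8 * \<delta>"
  proof (rule ccontr)
    assume "\<not> M \<le> 8 * \<delta>"
    then have M: "8 * \<delta> < M" by simp
    with delta have Mpos: "0 < M" by linarith
    \<comment> \<open>In time \<open>\<tau>\<close> a straight motion of speed \<open>M\<close> covers twice the diameter of the ball.\<close>
    define \<tau> where "\<tau> = 4 * \<delta> / M"
    have tau: "0 < \<tau>" "\<tau> < 1/2" "\<tau> * M = 4 * \<delta>"
      using M Mpos delta by (auto simp: \<tau>_def field_simps)
    \<comment> \<open>One of the two time directions stays in the unit interval, as \<open>\<tau> < 1/2\<close>.\<close>
    define t1 where "t1 = (if t0 \<le> 1/2 then t0 + \<tau> else t0 - \<tau>)"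
    have t1: "t1 \<in> {0..1}" "\<bar>t1 - t0\<bar> = \<tau>" using tau t0(1) by (auto simp: t1_def)
    define I where "I = {min t0 t1..max t0 t1}"
    have I: "I \<subseteq> {0..1}" "t0 \<in> I" "t1 \<in> I" "convex I" using t0(1) t1(1) by (auto simp: I_def)
    have Iw: "\<bar>s - t0\<bar> \<le> \<tau>" if "s \<in> I" for s
      using that t1(2) unfolding I_def by (auto simp: min_def max_def split: if_splits)
    have VI: "norm (V s - V t0) \<le> 3 * \<kappa> * M\<^sup>2 * \<tau>" if s: "s \<in> I" for s
    proof -
      have "norm (V s - V t0 - (s - t0) *\<^sub>R 0) \<le> 3 * \<kappa> * M\<^sup>2 * \<bar>s - t0\<bar>"
      proof (rule vector_mean_value[OF I(4) _ _ I(2) s])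
        fix t assume t: "t \<in> I"
        then have t01: "t \<in> {0..1}" using I by auto
        show "(V has_vector_derivative N (X t) (V t)) (at t within I)"
          using geodD(2)[OF g t01] I(1) has_vector_derivative_within_subset by blast
        have "norm (N (X t) (V t)) \<le> 3 * \<kappa> * (norm (V t))\<^sup>2" using XC t01 by (intro N_bound_C) blast
        also have "\<dots> \<le> 3 * \<kappa> * M\<^sup>2"
          using t0(2)[OF t01] kappa_nonneg by (auto simp: M_def intro!: mult_left_mono power_mono)
        finally show "norm (N (X t) (V t) - 0) \<le> 3 * \<kappa> * M\<^sup>2" by simp
      qed
      also have "\<dots> \<le> 3 * \<kappa> * M\<^sup>2 * \<tau>" using Iw[OF s] kappa_nonneg by (intro mult_left_mono) auto
      finally show ?thesis by simp
    qed
    have "norm (X t1 - X t0 - (t1 - t0) *\<^sub>R V t0) \<le> 3 * \<kappa> * M\<^sup>2 * \<tau> * \<bar>t1 - t0\<bar>"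
    proof (rule vector_mean_value[OF I(4) _ VI I(2) I(3)])
      fix t assume "t \<in> I"
      with I(1) show "(X has_vector_derivative V t) (at t within I)"
        using geodD(1)[OF g, of t] has_vector_derivative_within_subset by blast
    qed
    also have "\<dots> = 3 * \<kappa> * (\<tau> * M)\<^sup>2" unfolding t1(2) by (simp add: power2_eq_square)
    also have "\<dots> = 48 * \<kappa> * \<delta>\<^sup>2" unfolding tau(3) by (simp add: power2_eq_square)
    also have "\<dots> \<le> 1 * \<delta>\<^sup>2" using kappa by (intro mult_right_mono) auto
    also have "\<dots> \<le> \<delta>" using delta by (simp add: power2_eq_square mult_left_le)
    finally have 1: "norm (X t1 - X t0 - (t1 - t0) *\<^sub>R V t0) \<le> \<delta>" .
    have "norm ((t1 - t0) *\<^sub>R V t0) = 4 * \<delta>" using t1(2) tau(3) by (simp add: M_def)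
    with 1 have "4 * \<delta> \<le> norm (X t1 - X t0) + \<delta>"
      by (smt (verit, best) norm_triangle_ineq3 norm_minus_commute)
    moreover have "norm (X t1 - X t0) < 2 * \<delta>"
      using XC t0(1) t1(1) dist_triangle_less_add[of "X t1" c \<delta> "X t0" \<delta>]
      by (auto simp: dist_norm norm_minus_commute image_subset_iff)
    ultimately show False using delta by linarith
  qed
  then show ?thesis using t0(2)[OF t] by (simp add: M_def)
qed

text \<open>The difference of two geodesics with a common starting point is almost straight,
  because the acceleration depends on position and velocity with a small Lipschitz constant.\<close>

lemma geod_difference:
  assumes g: "geod {0..1} X V" "geod {0..1} Y U" and XC: "X ` {0..1} \<subseteq> C" "Y ` {0..1} \<subseteq> C"
    and start: "X 0 = Y 0"
  obtains m where "0 \<le> m" "\<And>t. t \<in> {0..1} \<Longrightarrow> norm (V t - U t) \<le> m"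
    "\<And>t. t \<in> {0..1} \<Longrightarrow> norm (X t - Y t) \<le> m"
    "\<And>s t. s \<in> {0..1} \<Longrightarrow> t \<in> {0..1} \<Longrightarrow> norm ((V t - U t) - (V s - U s)) \<le> 1300 * \<kappa> * m"
    "\<And>t. t \<in> {0..1} \<Longrightarrow> norm (X 1 - Y 1 - (V t - U t)) \<le> 1300 * \<kappa> * m"
    "\<exists>t\<in>{0..1}. m = norm (V t - U t)"
proof -
  let ?D = "\<lambda>t. V t - U t"
  have "continuous_on {0..1} (\<lambda>t. norm (?D t))"
    by (intro continuous_intros geod_continuous[OF g(1)] geod_continuous[OF g(2)])
  then obtain t0 where t0: "t0 \<in> {0..1}" "\<And>s. s \<in> {0..1} \<Longrightarrow> norm (?D s) \<le> norm (?D t0)"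
    using continuous_attains_sup[of "{0..1::real}" "\<lambda>t. norm (?D t)"] by auto
  define m where "m = norm (?D t0)"
  have m0: "0 \<le> m" by (simp add: m_def)
  have 2: "norm (?D t) \<le> m" if "t \<in> {0..1}" for t using t0(2)[OF that] by (simp add: m_def)
  have dX: "((\<lambda>t. X t - Y t) has_vector_derivative ?D t) (at t within {0..1})" if "t \<in> {0..1}" for t
    by (intro has_vector_derivative_diff geodD(1)[OF g(1) that] geodD(1)[OF g(2) that])
  have 3: "norm (X t - Y t) \<le> m" if t: "t \<in> {0..1}" for t
  proof -
    have "norm ((X t - Y t) - (X 0 - Y 0) - (t - 0) *\<^sub>R 0) \<le> m * \<bar>t - 0\<bar>"
      by (rule vector_mean_value[of "{0..1}" _ ?D]) (use t 2 dX in auto)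
    also have "\<dots> \<le> m" using t m0 by (simp add: mult_left_le)
    finally show ?thesis by (simp add: start)
  qed
  have acc: "norm (N (X t) (V t) - N (Y t) (U t)) \<le> 1300 * \<kappa> * m" if t: "t \<in> {0..1}" for t
  proof -
    have inC: "X t \<in> C" "Y t \<in> C" using XC t by blast+
    have V8: "norm (V t) \<le> 8 * \<delta>" "norm (U t) \<le> 8 * \<delta>"
      using geod_velocity_bound[OF g(1) XC(1) t] geod_velocity_bound[OF g(2) XC(2) t] .
    have d2: "\<delta>\<^sup>2 \<le> \<delta>" using delta by (simp add: power2_eq_square mult_left_le)
    have sq: "(norm (V t))\<^sup>2 + (norm (U t))\<^sup>2 \<le> 128 * \<delta>"
      using power_mono[OF V8(1), of 2] power_mono[OF V8(2), of 2] d2 by (simp add: power_mult_distrib)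
    have yc: "norm (Y t - c) \<le> 1" using inC(2) delta by (auto simp: dist_norm norm_minus_commute)
    have "norm (X t - Y t) * ((norm (V t))\<^sup>2 + (norm (U t))\<^sup>2) \<le> m * (128 * \<delta>)"
      by (intro mult_mono 3 t sq m0) auto
    moreover have "norm (Y t - c) * (norm (V t) + norm (U t)) * norm (?D t) \<le> (1 * (16 * \<delta>)) * m"
      using yc V8 delta by (intro mult_mono 2 t) auto
    ultimately have "9 * K * (norm (X t - Y t) * ((norm (V t))\<^sup>2 + (norm (U t))\<^sup>2)
       + norm (Y t - c) * (norm (V t) + norm (U t)) * norm (?D t)) \<le> 9 * K * (m * (128 * \<delta>) + 1 * (16 * \<delta>) * m)"
      using K(1) by (intro mult_left_mono add_mono) auto
    also have "\<dots> = (K * \<delta>) * (1296 * m)" by (simp add: algebra_simps)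
    also have "\<dots> \<le> \<kappa> * (1300 * m)" using K(2) m0 kappa_nonneg by (intro mult_mono) auto
    finally show ?thesis using N_lipschitz[OF C_sub[OF inC(1)] C_sub[OF inC(2)], of "V t" "U t"] by (simp add: ac_simps)
  qed
  have dV: "(?D has_vector_derivative N (X t) (V t) - N (Y t) (U t)) (at t within {0..1})" if "t \<in> {0..1}" for t
    by (intro has_vector_derivative_diff geodD(2)[OF g(1) that] geodD(2)[OF g(2) that])
  have 4: "norm (?D t - ?D s) \<le> 1300 * \<kappa> * m" if st: "s \<in> {0..1}" "t \<in> {0..1}" for s t
  proof -
    have "norm (?D t - ?D s - (t - s) *\<^sub>R 0) \<le> 1300 * \<kappa> * m * \<bar>t - s\<bar>"
      by (rule vector_mean_value[of "{0..1}" _ "\<lambda>t. N (X t) (V t) - N (Y t) (U t)"]) (use st dV acc in auto)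
    also have "\<dots> \<le> 1300 * \<kappa> * m * 1" using st m0 kappa_nonneg by (intro mult_left_mono) auto
    finally show ?thesis by simp
  qed
  have 5: "norm (X 1 - Y 1 - ?D t) \<le> 1300 * \<kappa> * m" if t: "t \<in> {0..1}" for t
  proof -
    have "norm ((X 1 - Y 1) - (X 0 - Y 0) - (1 - 0) *\<^sub>R ?D t) \<le> 1300 * \<kappa> * m * \<bar>1 - 0\<bar>"
      by (rule vector_mean_value[of "{0..1}" _ ?D]) (use t dX 4 in auto)
    then show ?thesis by (simp add: start)
  qed
  show thesis by (rule that[OF m0 2 3 4 5]) (use t0(1) m_def in auto)
qed

end

section \<open>Geodesics with prescribed end points\<close>

definition primitive :: "(real \<Rightarrow> 'e::euclidean_space) \<Rightarrow> real \<Rightarrow> 'e" where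
  "primitive f t = integral {0..t} f"

lemma primitive_0 [simp]: "primitive f 0 = 0"
  by (simp add: primitive_def)

lemma primitive_derivative:
  "continuous_on {0..1} f \<Longrightarrow> t \<in> {0..1} \<Longrightarrow> (primitive f has_vector_derivative f t) (at t within {0..1})"
  unfolding primitive_def by (rule integral_has_vector_derivative)

lemma primitive_continuous: "continuous_on {0..1} f \<Longrightarrow> continuous_on {0..1} (primitive f)"
  by (metis continuous_on_eq_continuous_within has_vector_derivative_continuous primitive_derivative)

lemma primitive_diff_bound:
  assumes "continuous_on {0..1} f" "continuous_on {0..1} g"
    and bd: "\<And>t. t \<in> {0..1} \<Longrightarrow> norm (f t - g t) \<le> M" and t: "t \<in> {0..1}"
  shows "norm (primitive f t - primitive g t) \<le> M"
proof -
  have "norm ((primitive f t - primitive g t) - (primitive f 0 - primitive g 0) - (t - 0) *\<^sub>R 0) \<le> M * \<bar>t - 0\<bar>"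
    by (rule vector_mean_value[of "{0..1}" _ "\<lambda>t. f t - g t"])
       (use t bd in \<open>auto intro!: has_vector_derivative_diff primitive_derivative assms\<close>)
  also have "\<dots> \<le> M * 1"
    using t order_trans[OF norm_ge_zero bd[OF t]] by (intro mult_left_mono) auto
  finally show ?thesis by simp
qed

context small_metric begin

lemma N_continuous_on:
  fixes X V :: "'t::topological_space \<Rightarrow> 'e"
  assumes X: "continuous_on S X" "X ` S \<subseteq> W" and V: "continuous_on S V"
  shows "continuous_on S (\<lambda>t. N (X t) (V t))"
  unfolding continuous_on_def
proof
  fix s assume s: "s \<in> S"
  have tX: "(X \<longlongrightarrow> X s) (at s within S)" and tV: "(V \<longlongrightarrow> V s) (at s within S)"
    using X(1) V s by (auto simp: continuous_on_def)
  let ?b = "\<lambda>t. 9 * K * (norm (X t - X s) * ((norm (V t))\<^sup>2 + (norm (V s))\<^sup>2)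
     + norm (X s - c) * (norm (V t) + norm (V s)) * norm (V t - V s))"
  have "(?b \<longlongrightarrow> 9 * K * (norm (X s - X s) * ((norm (V s))\<^sup>2 + (norm (V s))\<^sup>2)
     + norm (X s - c) * (norm (V s) + norm (V s)) * norm (V s - V s))) (at s within S)"
    by (intro tendsto_intros tX tV)
  then have b0: "(?b \<longlongrightarrow> 0) (at s within S)" by simp
  have "\<forall>\<^sub>F t in at s within S. norm (N (X t) (V t) - N (X s) (V s)) \<le> ?b t"
    using X(2) s by (intro eventually_at_topological[THEN iffD2] exI[of _ UNIV]) (auto intro!: N_lipschitz simp del: mem_ball)
  from Lim_null_comparison[OF this b0]
  show "((\<lambda>t. N (X t) (V t)) \<longlongrightarrow> N (X s) (V s)) (at s within S)"
    by (simp add: LIM_zero_iff)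
qed

text \<open>A geodesic with prescribed end points is a fixed point for its acceleration: prescribing
  the acceleration determines the curve, and the geodesic equation gives the acceleration back.\<close>

lemma geodesic_boundary_value_problem:
  assumes q: "q \<in> C" and r: "r \<in> C"
  obtains X V where "geod {0..1} X V" "X ` {0..1} \<subseteq> W" "X 0 = q" "X 1 = r"
proof -
  \<comment> \<open>Bounded continuous functions live on all of \<open>\<real>\<close>; only their values on the unit interval matter.\<close>
  define cl :: "real \<Rightarrow> real" where "cl t = max 0 (min 1 t)" for t
  have cl: "cl t \<in> {0..1}" "t \<in> {0..1} \<Longrightarrow> cl t = t" for t by (auto simp: cl_def)
  have cl_cont: "continuous_on UNIV cl" unfolding cl_def by (intro continuous_intros)
  \<comment> \<open>The curve with acceleration \<open>f\<close> and end points \<open>q\<close> and \<open>r\<close>, and its velocity.\<close>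
  define V where "V f t = r - q - primitive (primitive f) 1 + primitive f t" for f :: "real \<Rightarrow> 'e" and t
  define X where "X f t = q + t *\<^sub>R (r - q - primitive (primitive f) 1) + primitive (primitive f) t"
    for f :: "real \<Rightarrow> 'e" and t
  define T where "T f = Bcontfun (\<lambda>t. N (X f (cl t)) (V f (cl t)))" for f :: "real \<Rightarrow>\<^sub>C 'e"
  let ?S = "cball (0 :: real \<Rightarrow>\<^sub>C 'e) (\<delta>/2)"
  have rq: "norm (r - q) < 2 * \<delta>"
    using q r dist_triangle_less_add[of r c \<delta> q \<delta>] by (auto simp: dist_norm norm_minus_commute)
  have contp: "continuous_on {0..1} (primitive (apply_bcontfun f))" for f
    by (intro primitive_continuous continuous_on_apply_bcontfun)
  have contpp: "continuous_on {0..1} (primitive (primitive (apply_bcontfun f)))" for f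
    by (intro primitive_continuous contp)
  have contX: "continuous_on {0..1} (X f)" and contV: "continuous_on {0..1} (V f)" for f :: "real \<Rightarrow>\<^sub>C 'e"
    unfolding X_def V_def by (intro continuous_intros contp contpp)+
  have p_diff: "norm (primitive f t - primitive g t) \<le> dist f g"
    and pp_diff: "norm (primitive (primitive f) t - primitive (primitive g) t) \<le> dist f g"
    if t: "t \<in> {0..1}" for f g :: "real \<Rightarrow>\<^sub>C 'e" and t
  proof -
    have 1: "norm (primitive f t - primitive g t) \<le> dist f g" if "t \<in> {0..1}" for t
      by (rule primitive_diff_bound) (use that dist_bounded[of f _ g] in \<open>auto simp: dist_norm\<close>)
    show "norm (primitive f t - primitive g t) \<le> dist f g" using 1[OF t] .
    show "norm (primitive (primitive f) t - primitive (primitive g) t) \<le> dist f g"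
      by (rule primitive_diff_bound) (use t 1 contp in auto)
  qed
  have X_diff: "norm (X f t - X g t) \<le> 2 * dist f g" and V_diff: "norm (V f t - V g t) \<le> 2 * dist f g"
    if t: "t \<in> {0..1}" for f g :: "real \<Rightarrow>\<^sub>C 'e" and t
  proof -
    let ?a = "primitive (primitive f) 1 - primitive (primitive g) 1"
    have a: "norm ?a \<le> dist f g" by (rule pp_diff) simp
    have "norm (t *\<^sub>R ?a) \<le> 1 * norm ?a" using t by (simp add: mult_left_le_one_le)
    with a have ta: "norm (t *\<^sub>R ?a) \<le> dist f g" by simp
    have "X f t - X g t = (primitive (primitive f) t - primitive (primitive g) t) - t *\<^sub>R ?a"
      by (simp add: X_def algebra_simps)
    then show "norm (X f t - X g t) \<le> 2 * dist f g"
      using pp_diff[OF t, of f g] ta norm_triangle_ineq4[of "primitive (primitive f) t - primitive (primitive g) t" "t *\<^sub>R ?a"]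
      by simp
    have "V f t - V g t = (primitive f t - primitive g t) - ?a" by (simp add: V_def algebra_simps)
    then show "norm (V f t - V g t) \<le> 2 * dist f g"
      using p_diff[OF t, of f g] a norm_triangle_ineq4[of "primitive f t - primitive g t" ?a] by simp
  qed
  have pz: "primitive (apply_bcontfun 0) = (\<lambda>t. 0 :: 'e)" "primitive (\<lambda>t. 0 :: 'e) = (\<lambda>t. 0)"
    by (simp_all add: primitive_def[abs_def])
  have XW: "X f t \<in> W" and V3: "norm (V f t) \<le> 3 * \<delta>" if f: "f \<in> ?S" and t: "t \<in> {0..1}" for f :: "real \<Rightarrow>\<^sub>C 'e" and t
  proof -
    let ?o = "apply_bcontfun (0 :: real \<Rightarrow>\<^sub>C 'e)"
    have df: "dist f 0 \<le> \<delta>/2" using f by (simp add: dist_commute)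
    have X0: "X ?o t = (1 - t) *\<^sub>R q + t *\<^sub>R r" and V0: "V ?o t = r - q"
      unfolding X_def V_def pz by (auto simp: algebra_simps)
    have "X ?o t \<in> C" unfolding X0 using q r t by (intro convexD[OF convex_ball]) auto
    then show "X f t \<in> W" using X_diff[OF t, of f 0] df dist_triangle_lt[of c "X ?o t" "X f t" "2*\<delta>"]
      by (auto simp: dist_norm norm_minus_commute)
    show "norm (V f t) \<le> 3 * \<delta>" using V_diff[OF t, of f 0] df rq norm_triangle_sub[of "V f t" "V ?o t"]
      unfolding V0 by simp
  qed
  have T: "apply_bcontfun (T f) = (\<lambda>t. N (X f (cl t)) (V f (cl t)))" and Tnorm: "T f \<in> ?S" if f: "f \<in> ?S" for f
  proof -
    have bd: "norm (N (X f (cl t)) (V f (cl t))) \<le> \<delta>/2" for t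
    proof -
      have "norm (X f (cl t) - c) \<le> 2 * \<delta>" using XW[OF f cl(1)[of t]] by (simp add: dist_norm norm_minus_commute)
      then have "3 * K * norm (X f (cl t) - c) * (norm (V f (cl t)))\<^sup>2 \<le> 3 * K * (2 * \<delta>) * (3 * \<delta>)\<^sup>2"
        using V3[OF f cl(1)[of t]] K(1) delta by (intro mult_mono power_mono) auto
      also have "\<dots> = (K * \<delta>) * (54 * \<delta> * \<delta>)" by (simp add: power2_eq_square)
      also have "\<dots> \<le> (1/100000) * (54 * 1 * \<delta>)"
        using K(2) kappa delta by (intro mult_mono) auto
      also have "\<dots> \<le> \<delta>/2" using delta by simp
      finally show ?thesis using N_bound[OF XW[OF f cl(1)[of t]], of "V f (cl t)"] by simp
    qed
    have "continuous_on {0..1} (\<lambda>t. N (X f t) (V f t))"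
      using XW[OF f] by (intro N_continuous_on contX contV) auto
    then have "continuous_on UNIV (\<lambda>t. N (X f (cl t)) (V f (cl t)))"
      using continuous_on_compose2[OF _ cl_cont] cl(1) by blast
    then have "(\<lambda>t. N (X f (cl t)) (V f (cl t))) \<in> bcontfun" using bd by (rule bcontfun_normI)
    then show T: "apply_bcontfun (T f) = (\<lambda>t. N (X f (cl t)) (V f (cl t)))"
      unfolding T_def by (rule Bcontfun_inverse)
    show "T f \<in> ?S" using norm_bound[of "T f" "\<delta>/2"] bd by (simp add: T)
  qed
  have contr: "dist (T f) (T g) \<le> 1/2 * dist f g" if f: "f \<in> ?S" and g: "g \<in> ?S" for f g
  proof (rule dist_bound)
    fix t
    let ?t = "cl t"
    let ?D = "dist f g"
    note W = XW[OF f cl(1)[of t]] XW[OF g cl(1)[of t]] and V = V3[OF f cl(1)[of t]] V3[OF g cl(1)[of t]]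
    have d2: "\<delta>\<^sup>2 \<le> \<delta>" using delta by (simp add: power2_eq_square mult_left_le)
    have sq: "(norm (V f ?t))\<^sup>2 + (norm (V g ?t))\<^sup>2 \<le> 18 * \<delta>"
      using power_mono[OF V(1), of 2] power_mono[OF V(2), of 2] d2 by (simp add: power_mult_distrib)
    have nc: "norm (X g ?t - c) \<le> 2" using W(2) delta by (auto simp: dist_norm norm_minus_commute)
    have 1: "norm (X f ?t - X g ?t) * ((norm (V f ?t))\<^sup>2 + (norm (V g ?t))\<^sup>2) \<le> (2 * ?D) * (18 * \<delta>)"
      by (intro mult_mono X_diff cl sq) auto
    have 2: "norm (X g ?t - c) * (norm (V f ?t) + norm (V g ?t)) * norm (V f ?t - V g ?t) \<le> (2 * (6 * \<delta>)) * (2 * ?D)"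
      using V delta nc by (intro mult_mono V_diff cl) auto
    have "9 * K * (norm (X f ?t - X g ?t) * ((norm (V f ?t))\<^sup>2 + (norm (V g ?t))\<^sup>2)
       + norm (X g ?t - c) * (norm (V f ?t) + norm (V g ?t)) * norm (V f ?t - V g ?t))
       \<le> 9 * K * ((2 * ?D) * (18 * \<delta>) + (2 * (6 * \<delta>)) * (2 * ?D))"
      using 1 2 K(1) by (intro mult_left_mono add_mono) auto
    also have "\<dots> = (K * \<delta>) * (540 * ?D)" by (simp add: algebra_simps)
    also have "\<dots> \<le> (1/100000) * (540 * ?D)" using K(2) kappa by (intro mult_right_mono) auto
    also have "\<dots> \<le> 1/2 * ?D" by simp
    finally show "dist (T f t) (T g t) \<le> 1/2 * ?D"
      using N_lipschitz[OF W, of "V f ?t" "V g ?t"] unfolding T[OF f] T[OF g] dist_norm by linarith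
  qed
  have "\<exists>!f\<in>?S. T f = f"
    by (rule Banach_fix[of ?S "1/2"]) (use contr Tnorm delta in \<open>auto simp: complete_eq_closed\<close>)
  then obtain f where f: "f \<in> ?S" "T f = f" by blast
  have ft: "f t = N (X f t) (V f t)" if "t \<in> {0..1}" for t
    using fun_cong[OF T[OF f(1)], of t] f(2) cl(2)[OF that] by simp
  show thesis
  proof (rule that)
    show "geod {0..1} (X f) (V f)"
      unfolding geod_def
    proof (intro ballI conjI)
      fix t :: real assume t: "t \<in> {0..1}"
      have p: "(primitive f has_vector_derivative f t) (at t within {0..1})"
        by (rule primitive_derivative) (use t in auto)
      have pp: "(primitive (primitive f) has_vector_derivative primitive f t) (at t within {0..1})"
        by (rule primitive_derivative) (use t contp in auto)
      show "(X f has_vector_derivative V f t) (at t within {0..1})"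
        unfolding X_def[abs_def] V_def by (auto intro!: derivative_eq_intros pp)
      show "(V f has_vector_derivative N (X f t) (V f t)) (at t within {0..1})"
        unfolding ft[OF t, symmetric] unfolding V_def[abs_def] by (auto intro!: derivative_eq_intros p)
    qed
    show "X f ` {0..1} \<subseteq> W" using XW[OF f(1)] by auto
    show "X f 0 = q" "X f 1 = r" by (simp_all add: X_def)
  qed
qed

text \<open>Since the acceleration is small compared with the squared velocity, the squared distance
  to the centre is convex along a geodesic.\<close>

lemma geod_center_distance:
  assumes g: "geod {0..1} X V" and XW: "X ` {0..1} \<subseteq> W" and t: "t \<in> {0..1}"
  shows "norm (X t - c) \<le> max (norm (X 0 - c)) (norm (X 1 - c))"
proof -
  define F where "F t = (X t - c) \<bullet> (X t - c)" for t
  define F' where "F' t = 2 * ((X t - c) \<bullet> V t)" for t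
  have dF: "(F has_vector_derivative F' t) (at t within {0..1})" if "t \<in> {0..1}" for t
    unfolding F_def F'_def using geodD(1)[OF g that] unfolding has_vector_derivative_def
    by (auto intro!: derivative_eq_intros simp: inner_commute algebra_simps)
  have dF': "(F' has_vector_derivative 2 * (V t \<bullet> V t + (X t - c) \<bullet> N (X t) (V t))) (at t within {0..1})"
    if "t \<in> {0..1}" for t
    unfolding F'_def using geodD[OF g that] unfolding has_vector_derivative_def
    by (auto intro!: derivative_eq_intros simp: inner_commute algebra_simps)
  have pos: "0 \<le> 2 * (V t \<bullet> V t + (X t - c) \<bullet> N (X t) (V t))" if t: "t \<in> {0..1}" for t
  proof -
    have XtW: "X t \<in> W" using XW t by blast
    let ?n = "norm (X t - c)"
    have n: "?n \<le> 2 * \<delta>" "?n \<le> 2" using XtW delta by (auto simp: dist_norm norm_minus_commute)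
    have "norm (X t - c) * norm (N (X t) (V t)) \<le> ?n * (3 * K * ?n * (norm (V t))\<^sup>2)"
      by (intro mult_left_mono N_bound[OF XtW]) auto
    also have "\<dots> = (3 * K * (?n * ?n)) * (norm (V t))\<^sup>2" by simp
    also have "\<dots> \<le> (3 * K * (2 * \<delta> * 2)) * (norm (V t))\<^sup>2"
      using n K delta by (intro mult_right_mono mult_left_mono mult_mono) auto
    also have "\<dots> \<le> 1 * (norm (V t))\<^sup>2" using K kappa by (intro mult_right_mono) auto
    finally show ?thesis using Cauchy_Schwarz_ineq2[of "X t - c" "N (X t) (V t)"]
      by (simp add: power2_norm_eq_inner)
  qed
  have "F t \<le> (1 - t) * F 0 + t * F 1 - 0 / 2 * t * (1 - t)"
  proof (rule strongly_convex_of_derivative[OF dF _ t])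
    fix s t :: real assume "0 \<le> s" "s < t" "t \<le> 1"
    then show "0 * (t - s) \<le> F' t - F' s"
      using monotone_derivative_of_nonneg_second[of 0 1 F', OF dF' pos] by simp
  qed
  also have "\<dots> \<le> (1 - t) * max (F 0) (F 1) + t * max (F 0) (F 1)"
    using t by (simp add: add_mono mult_left_mono)
  also have "\<dots> = max (F 0) (F 1)" by (simp add: algebra_simps)
  finally have "(norm (X t - c))\<^sup>2 \<le> max ((norm (X 0 - c))\<^sup>2) ((norm (X 1 - c))\<^sup>2)"
    by (simp add: F_def power2_norm_eq_inner)
  then show ?thesis by (auto simp: le_max_iff_disj dest: power2_le_imp_le)
qed

section \<open>Geodesic segments and their energy\<close>

definition connects :: "'e \<Rightarrow> 'e \<Rightarrow> (real \<Rightarrow> 'e) \<Rightarrow> (real \<Rightarrow> 'e) \<Rightarrow> bool" where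
  "connects q r X V \<longleftrightarrow> geod {0..1} X V \<and> X ` {0..1} \<subseteq> C \<and> X 0 = q \<and> X 1 = r"

lemma connectsD:
  assumes "connects q r X V"
  shows "geod {0..1} X V" "X ` {0..1} \<subseteq> C" "X 0 = q" "X 1 = r" "q \<in> C" "r \<in> C"
    "\<And>t. t \<in> {0..1} \<Longrightarrow> X t \<in> C"
proof -
  note d = assms[unfolded connects_def]
  show "geod {0..1} X V" "X ` {0..1} \<subseteq> C" "X 0 = q" "X 1 = r" using d by blast+
  have X: "X t \<in> C" if "t \<in> {0..1}" for t using d that by blast
  show "q \<in> C" "r \<in> C" using X[of 0] X[of 1] d by simp_all
  show "\<And>t. t \<in> {0..1} \<Longrightarrow> X t \<in> C" by (rule X)
qed

lemma connects_exists:
  assumes "q \<in> C" "r \<in> C" shows "\<exists>X V. connects q r X V"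
proof -
  obtain X V where X: "geod {0..1} X V" "X ` {0..1} \<subseteq> W" "X 0 = q" "X 1 = r"
    by (rule geodesic_boundary_value_problem[OF assms])
  have "X t \<in> C" if "t \<in> {0..1}" for t
    using geod_center_distance[OF X(1,2) that] assms X(3,4) by (auto simp: dist_norm norm_minus_commute)
  then show ?thesis using X unfolding connects_def by blast
qed

text \<open>A geodesic segment is determined, in a Lipschitz way, by its starting point together with either its
end point or its initial velocity; and the difference of two such segments is almost straight.\<close>

lemma connects_difference:
  assumes 1: "connects q r X V" and 2: "connects q r' Y U" and t: "t \<in> {0..1}"
  shows "norm (V t - U t - (r - r')) \<le> 3000 * \<kappa> * norm (r - r')"
    "norm (V t - U t) \<le> 2 * norm (r - r')" "norm (X t - Y t) \<le> 2 * norm (r - r')"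
    "norm (r - r') \<le> 2 * norm (V 0 - U 0)"
proof -
  note d1 = connectsD[OF 1] and d2 = connectsD[OF 2]
  obtain m where m: "0 \<le> m" "\<And>t. t \<in> {0..1} \<Longrightarrow> norm (V t - U t) \<le> m"
    "\<And>t. t \<in> {0..1} \<Longrightarrow> norm (X t - Y t) \<le> m"
    "\<And>s t. s \<in> {0..1} \<Longrightarrow> t \<in> {0..1} \<Longrightarrow> norm ((V t - U t) - (V s - U s)) \<le> 1300 * \<kappa> * m"
    "\<And>t. t \<in> {0..1} \<Longrightarrow> norm (X 1 - Y 1 - (V t - U t)) \<le> 1300 * \<kappa> * m"
    "\<exists>t\<in>{0..1}. m = norm (V t - U t)"
    using geod_difference[OF d1(1) d2(1) d1(2) d2(2)] d1(3) d2(3) by metis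
  obtain t0 where t0: "t0 \<in> {0..1}" "m = norm (V t0 - U t0)" using m(6) by blast
  have mk: "1300 * \<kappa> * m \<le> 1/50 * m" using kappa m(1) by (intro mult_right_mono) auto
  have "m \<le> norm (r - r') + 1300 * \<kappa> * m"
    using m(5)[OF t0(1)] norm_triangle_sub[of "V t0 - U t0" "r - r'"] unfolding d1(4) d2(4) t0(2)[symmetric]
    by (simp add: norm_minus_commute)
  with mk have mr: "m \<le> 2 * norm (r - r')" using norm_ge_zero[of "r - r'"] by linarith
  have "1300 * \<kappa> * m \<le> 1300 * \<kappa> * (2 * norm (r - r'))" using mr kappa_nonneg by (intro mult_left_mono) auto
  also have "\<dots> \<le> 3000 * \<kappa> * norm (r - r')" using kappa_nonneg by (simp add: mult_right_mono)
  finally show "norm (V t - U t - (r - r')) \<le> 3000 * \<kappa> * norm (r - r')"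
    using m(5)[OF t] unfolding d1(4) d2(4) by (simp add: norm_minus_commute)
  show "norm (V t - U t) \<le> 2 * norm (r - r')" using m(2)[OF t] mr by simp
  show "norm (X t - Y t) \<le> 2 * norm (r - r')" using m(3)[OF t] mr by simp
  have "m \<le> norm (V 0 - U 0) + 1300 * \<kappa> * m"
    using m(4)[of 0 t0] t0 norm_triangle_sub[of "V t0 - U t0" "V 0 - U 0"] by simp
  with mk have mV: "m \<le> 3/2 * norm (V 0 - U 0)" using norm_ge_zero[of "V 0 - U 0"] by linarith
  have "norm (r - r') \<le> norm (V 0 - U 0) + 1300 * \<kappa> * m"
    using m(5)[of 0] norm_triangle_sub[of "r - r'" "V 0 - U 0"] unfolding d1(4) d2(4) by simp
  with mk mV show "norm (r - r') \<le> 2 * norm (V 0 - U 0)" using norm_ge_zero[of "V 0 - U 0"] by linarith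
qed

lemma connects_unique:
  assumes "connects q r X V" "connects q r Y U" "t \<in> {0..1}"
  shows "X t = Y t" "V t = U t"
  using connects_difference[OF assms] by auto

lemma connects_unique_initial_velocity:
  assumes "connects q r X V" "connects q r' Y U" "V 0 = U 0"
  shows "r = r'"
  using connects_difference(4)[OF assms(1,2), of 0] assms(3) by simp

lemma geod_segment:
  assumes g: "geod S X V" and XC: "X ` S \<subseteq> C" and S: "convex S" "a \<in> S" "b \<in> S"
  shows "connects (X a) (X b) (\<lambda>t. X (a + t * (b - a))) (\<lambda>t. (b - a) *\<^sub>R V (a + t * (b - a)))"
proof -
  have sub: "(\<lambda>t. a + t * (b - a)) ` {0..1} \<subseteq> S"
  proof
    fix y assume "y \<in> (\<lambda>t. a + t * (b - a)) ` {0..1}"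
    then obtain t where t: "t \<in> {0..1}" "y = (1 - t) *\<^sub>R a + t *\<^sub>R b" by (auto simp: algebra_simps)
    then show "y \<in> S" using convexD[OF S, of "1 - t" t] by simp
  qed
  have "X ` S \<subseteq> W" using XC C_sub by blast
  from geod_affine[OF g this sub] XC sub show ?thesis unfolding connects_def by auto
qed

text \<open>The derivative of the squared speed vanishes by the Euler-Lagrange equation tested with the velocity.\<close>

lemma geod_energy_constant:
  assumes g: "geod S X V" and XC: "X ` S \<subseteq> C" and S: "convex S" "a \<in> S" "b \<in> S"
  shows "B (X a) (V a) (V a) = B (X b) (V b) (V b)"
proof -
  have "norm (B (X b) (V b) (V b) - B (X a) (V a) (V a) - (b - a) *\<^sub>R 0) \<le> 0 * \<bar>b - a\<bar>"
  proof (rule vector_mean_value[OF S(1) _ _ S(2,3)])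
    fix t assume t: "t \<in> S"
    have Xt: "X t \<in> W" using XC t C_sub by blast
    note d = geodD[OF g t]
    show "((\<lambda>t. B (X t) (V t) (V t)) has_vector_derivative
       P (X t) (V t) (V t) (V t) + B (X t) (N (X t) (V t)) (V t) + B (X t) (V t) (N (X t) (V t))) (at t within S)"
      by (rule bilinear_field_derivative_along_curve[OF bilinB bilinP derivB[OF Xt] d(1) d(2) d(2)])
    show "norm (P (X t) (V t) (V t) (V t) + B (X t) (N (X t) (V t)) (V t) + B (X t) (V t) (N (X t) (V t)) - 0) \<le> 0"
      using euler_lagrange[OF Xt, of "V t" "V t"] symB[OF Xt, of "V t" "N (X t) (V t)"] by simp
  qed
  then show ?thesis by simp
qed

text \<open>For points of \<open>C\<close> a segment exists and is unique, so that both descriptions are proper.\<close>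

definition init_velocity :: "'e \<Rightarrow> 'e \<Rightarrow> 'e" where
  "init_velocity q r = (THE v. \<exists>X V. connects q r X V \<and> V 0 = v)"

definition final_velocity :: "'e \<Rightarrow> 'e \<Rightarrow> 'e" where
  "final_velocity q r = (THE v. \<exists>X V. connects q r X V \<and> V 1 = v)"

text \<open>The squared speed of the segment at its starting point, hence at all times; on the manifold this becomes
  the squared Riemannian distance.\<close>

definition energy :: "'e \<Rightarrow> 'e \<Rightarrow> real" where
  "energy q r = B q (init_velocity q r) (init_velocity q r)"

lemma velocity_eq:
  assumes "connects q r X V"
  shows "init_velocity q r = V 0" "final_velocity q r = V 1"
proof -
  have u: "U 0 = V 0" "U 1 = V 1" if "connects q r Y U" for Y U
    using connects_unique(2)[OF that assms] by auto
  show "init_velocity q r = V 0" unfolding init_velocity_def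
    by (rule the_equality) (use assms u in blast)+
  show "final_velocity q r = V 1" unfolding final_velocity_def
    by (rule the_equality) (use assms u in blast)+
qed

lemma velocity_difference:
  assumes "q \<in> C" "r \<in> C" "r' \<in> C"
  shows "norm (init_velocity q r - init_velocity q r' - (r - r')) \<le> 3000 * \<kappa> * norm (r - r')"
    "norm (final_velocity q r - final_velocity q r' - (r - r')) \<le> 3000 * \<kappa> * norm (r - r')"
    "norm (init_velocity q r - init_velocity q r') \<le> 2 * norm (r - r')"
    "norm (r - r') \<le> 2 * norm (init_velocity q r - init_velocity q r')"
proof -
  obtain X V Y U where c: "connects q r X V" "connects q r' Y U" using connects_exists assms by metis
  note d0 = connects_difference[OF c, of 0] and d1 = connects_difference[OF c, of 1]
  show "norm (init_velocity q r - init_velocity q r' - (r - r')) \<le> 3000 * \<kappa> * norm (r - r')"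
    "norm (final_velocity q r - final_velocity q r' - (r - r')) \<le> 3000 * \<kappa> * norm (r - r')"
    "norm (init_velocity q r - init_velocity q r') \<le> 2 * norm (r - r')"
    "norm (r - r') \<le> 2 * norm (init_velocity q r - init_velocity q r')"
    using d0 d1 by (simp_all add: velocity_eq[OF c(1)] velocity_eq[OF c(2)])
qed

lemma connects_const: "q \<in> C \<Longrightarrow> connects q q (\<lambda>_. q) (\<lambda>_. 0)"
  using geod_const[OF C_sub] by (auto simp: connects_def)

lemma velocity_self: "q \<in> C \<Longrightarrow> init_velocity q q = 0"
  using velocity_eq(1)[OF connects_const] by simp

text \<open>A stationary curve is a geodesic, and any other segment is compared with it.\<close>

lemma connects_near_straight:
  assumes "connects q r X V" "t \<in> {0..1}"
  shows "norm (V t - (r - q)) \<le> 3000 * \<kappa> * norm (r - q)"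
  using connects_difference(1)[OF assms(1) connects_const assms(2)] connectsD(5)[OF assms(1)] by simp

lemma final_velocity_bound:
  assumes "q \<in> C" "r \<in> C" shows "norm (final_velocity q r) \<le> 8 * \<delta>"
proof -
  obtain X V where c: "connects q r X V" using connects_exists assms by metis
  show ?thesis using geod_velocity_bound[OF connectsD(1,2)[OF c], of 1] by (simp add: velocity_eq[OF c])
qed

lemma energy_connects:
  assumes c: "connects q r X V" and t: "t \<in> {0..1}"
  shows "B (X t) (V t) (V t) = energy q r"
  using geod_energy_constant[OF connectsD(1,2)[OF c], of 0 t] t
  by (simp add: energy_def velocity_eq[OF c] connectsD(3)[OF c])

lemma energy_along_geod:
  assumes "geod S X V" "X ` S \<subseteq> C" "convex S" "a \<in> S" "b \<in> S"
  shows "energy (X a) (X b) = (b - a)\<^sup>2 * B (X a) (V a) (V a)"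
  using energy_connects[OF geod_segment[OF assms], of 0] by (simp add: B_simps power2_eq_square)

lemma energy_segment:
  assumes c: "connects q r X V" and st: "s \<in> {0..1}" "t \<in> {0..1}"
  shows "energy (X s) (X t) = (t - s)\<^sup>2 * energy q r"
  using energy_along_geod[OF connectsD(1,2)[OF c] _ st] energy_connects[OF c st(1)] by simp

lemma energy_lower_bound:
  assumes "q \<in> C" "r \<in> C" shows "(norm (r - q))\<^sup>2 \<le> 8 * energy q r"
proof -
  have "norm (r - q) \<le> 2 * norm (init_velocity q r)"
    using velocity_difference(4)[OF assms(1,2,1)] by (simp add: velocity_self[OF assms(1)])
  then have "(norm (r - q))\<^sup>2 \<le> (2 * norm (init_velocity q r))\<^sup>2" by (rule power_mono) simp
  then show ?thesis using B_coercive[OF C_sub[OF assms(1)], of "init_velocity q r"]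
    by (simp add: energy_def power_mult_distrib)
qed

lemma energy_nonneg: "q \<in> C \<Longrightarrow> r \<in> C \<Longrightarrow> 0 \<le> energy q r"
  using energy_lower_bound[of q r] zero_le_power2[of "norm (r - q)"] by linarith

lemma B_taylor:
  assumes z: "z \<in> W" "z' \<in> W"
  shows "\<bar>B z' v v - B z v v - P z (z' - z) v v\<bar> \<le> K * (norm (z' - z))\<^sup>2 * (norm v)\<^sup>2"
proof -
  let ?S = "closed_segment z z'"
  have SW: "?S \<subseteq> W" using z by (simp add: closed_segment_subset)
  have "norm (B z' v v - B z v v - P z (z' - z) v v) \<le> norm (z' - z) * (K * norm (z' - z) * (norm v)\<^sup>2)"
  proof (rule differentiable_bound_linearization[where f = "\<lambda>z. B z v v" and f' = "\<lambda>z u. P z u v v" and S = ?S])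
    show "z + t *\<^sub>R (z' - z) \<in> ?S" if "t \<in> {0..1}" for t
      unfolding in_segment using that by (intro exI[of _ t]) (simp add: algebra_simps)
    show "((\<lambda>z. B z v v) has_derivative (\<lambda>u. P y u v v)) (at y within ?S)" if "y \<in> ?S" for y
      by (rule has_derivative_at_withinI[OF derivB]) (use that SW in blast)
    show "z \<in> ?S" by simp
    fix y assume y: "y \<in> ?S"
    have "onorm (\<lambda>u. P y u v v - P z u v v) \<le> K * norm (z' - z) * (norm v)\<^sup>2"
    proof (rule onorm_le)
      fix u :: 'e
      have "norm (y - z) \<le> norm (z' - z)" using segment_bound(1)[OF y] .
      then have "K * norm (y - z) * (norm u * norm v * norm v) \<le> K * norm (z' - z) * (norm u * norm v * norm v)"
        using K(1) by (intro mult_right_mono mult_left_mono) auto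
      then show "norm (P y u v v - P z u v v) \<le> K * norm (z' - z) * (norm v)\<^sup>2 * norm u"
        using P_lipschitz[OF subsetD[OF SW y] z(1), of u v v] by (simp add: power2_eq_square ac_simps)
    qed
    then show "onorm ((\<lambda>u. P y u v v) - (\<lambda>u. P z u v v)) \<le> K * norm (z' - z) * (norm v)\<^sup>2"
      by (simp only: fun_diff_def)
  qed
  then show ?thesis by (simp add: power2_eq_square ac_simps)
qed

text \<open>With \<open>y = Y - X\<close> for the geodesics \<open>X\<close>, \<open>Y\<close> from \<open>q\<close> to \<open>r\<close>, \<open>r'\<close>, the Euler-Lagrange equation
  says that the derivative of \<open>2 * B X X' y\<close> is the first order part of the difference of the two energy
  densities. These densities are constant in time, so one mean value estimate over the unit interval
  compares the energy difference with the boundary term at \<open>r\<close>. The remainder is quadratic in \<open>y\<close> and \<open>y'\<close>,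
  hence in \<open>r' - r\<close>. This argument takes the place of the Gauss lemma, whose usual proof would
  differentiate the merely Lipschitz exponential map.\<close>

lemma energy_first_variation:
  assumes q: "q \<in> C" and r: "r \<in> C" and r': "r' \<in> C"
  shows "\<bar>energy q r' - energy q r - 2 * B r (final_velocity q r) (r' - r)\<bar>
     \<le> (256 * K + 128 * \<kappa> + 8) * (norm (r' - r))\<^sup>2"
proof -
  obtain X V Y U where c: "connects q r X V" "connects q r' Y U" using connects_exists q r r' by metis
  note g = connectsD(1)[OF c(1)] connectsD(1)[OF c(2)]
  let ?n = "norm (r' - r)"
  define \<phi> where "\<phi> t = t * (energy q r' - energy q r) - 2 * B (X t) (V t) (Y t - X t)" for t
  define \<phi>' where "\<phi>' t = (energy q r' - energy q r)
     - 2 * (P (X t) (V t) (V t) (Y t - X t) + B (X t) (N (X t) (V t)) (Y t - X t) + B (X t) (V t) (U t - V t))" for t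
  have "norm (\<phi> 1 - \<phi> 0 - (1 - 0) *\<^sub>R 0) \<le> (256 * K + 128 * \<kappa> + 8) * ?n\<^sup>2 * \<bar>1 - 0\<bar>"
  proof (rule vector_mean_value[of "{0..1}" \<phi> \<phi>'])
    fix t :: real assume t: "t \<in> {0..1}"
    have Xt: "X t \<in> W" "Y t \<in> W" using connectsD(7)[OF c(1) t] connectsD(7)[OF c(2) t] C_sub by auto
    note dX = geodD[OF g(1) t] and dY = geodD[OF g(2) t]
    show "(\<phi> has_vector_derivative \<phi>' t) (at t within {0..1})"
      unfolding \<phi>_def \<phi>'_def
      using bilinear_field_derivative_along_curve[OF bilinB bilinP derivB[OF Xt(1)] dX(1) dX(2) has_vector_derivative_diff[OF dY(1) dX(1)]]
      by (auto intro!: derivative_eq_intros has_vector_derivative_diff has_vector_derivative_mult_right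
            simp: has_real_derivative_iff_has_vector_derivative[symmetric])
    let ?y = "Y t - X t" and ?u = "U t - V t"
    have y: "norm ?y \<le> 2 * ?n" "norm ?u \<le> 2 * ?n"
      using connects_difference(2,3)[OF c t] by (simp_all add: norm_minus_commute)
    have V: "norm (V t) \<le> 8"
      using geod_velocity_bound[OF connectsD(1,2)[OF c(1)] t] delta by simp
    have "B (Y t) (U t) (U t) = B (Y t) (V t + ?u) (V t + ?u)" by simp
    also have "\<dots> = B (Y t) (V t) (V t) + 2 * B (Y t) (V t) ?u + B (Y t) ?u ?u"
      unfolding bilinear_ladd[OF bilinB] bilinear_radd[OF bilinB] using symB[OF Xt(2), of ?u "V t"] by simp
    finally have eY: "energy q r' = B (Y t) (V t) (V t) + 2 * B (Y t) (V t) ?u + B (Y t) ?u ?u"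
      using energy_connects[OF c(2) t] by simp
    have el: "B (X t) (N (X t) (V t)) ?y = P (X t) ?y (V t) (V t) / 2 - P (X t) (V t) (V t) ?y"
      using euler_lagrange[OF Xt(1), of ?y "V t"] symB[OF Xt(1), of ?y] symP[OF Xt(1), of "V t" ?y "V t"] by simp
    have eX: "energy q r = B (X t) (V t) (V t)" using energy_connects[OF c(1) t] by simp
    have split: "\<phi>' t = (B (Y t) (V t) (V t) - B (X t) (V t) (V t) - P (X t) ?y (V t) (V t))
       + 2 * (B (Y t) (V t) ?u - B (X t) (V t) ?u) + B (Y t) ?u ?u"
      unfolding \<phi>'_def el eY unfolding eX by (simp add: field_simps)
    have 1: "\<bar>B (Y t) (V t) (V t) - B (X t) (V t) (V t) - P (X t) ?y (V t) (V t)\<bar> \<le> 256 * K * ?n\<^sup>2"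
    proof -
      have "K * (norm ?y)\<^sup>2 * (norm (V t))\<^sup>2 \<le> K * (2 * ?n)\<^sup>2 * 8\<^sup>2"
        using y V K(1) by (intro mult_mono power_mono) auto
      then show ?thesis using B_taylor[OF Xt, of "V t"] by (simp add: power_mult_distrib)
    qed
    have 2: "\<bar>B (Y t) (V t) ?u - B (X t) (V t) ?u\<bar> \<le> 64 * \<kappa> * ?n\<^sup>2"
    proof -
      have "2 * \<kappa> * norm ?y * (norm (V t) * norm ?u) \<le> 2 * \<kappa> * (2 * ?n) * (8 * (2 * ?n))"
        using y V kappa_nonneg by (intro mult_mono) auto
      from order_trans[OF B_lipschitz[OF Xt(2,1)] this] show ?thesis by (simp add: power2_eq_square)
    qed
    have 3: "\<bar>B (Y t) ?u ?u\<bar> \<le> 8 * ?n\<^sup>2"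
    proof -
      have "2 * (norm ?u * norm ?u) \<le> 2 * ((2 * ?n) * (2 * ?n))" using y by (intro mult_left_mono mult_mono) auto
      from order_trans[OF B_bound[OF Xt(2)] this] show ?thesis by (simp add: power2_eq_square)
    qed
    have "\<bar>\<phi>' t\<bar> \<le> 256 * K * ?n\<^sup>2 + 2 * (64 * \<kappa> * ?n\<^sup>2) + 8 * ?n\<^sup>2"
    proof -
      have "\<bar>a + 2 * b + e\<bar> \<le> x + 2 * y + z" if "\<bar>a\<bar> \<le> x" "\<bar>b\<bar> \<le> y" "\<bar>e\<bar> \<le> z" for a b e x y z :: real
        using that by linarith
      from this[OF 1 2 3] show ?thesis unfolding split .
    qed
    then show "norm (\<phi>' t - 0) \<le> (256 * K + 128 * \<kappa> + 8) * ?n\<^sup>2" by (simp add: algebra_simps)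
  qed auto
  moreover have "\<phi> 1 = energy q r' - energy q r - 2 * B r (final_velocity q r) (r' - r)" "\<phi> 0 = 0"
    unfolding \<phi>_def connectsD(3,4)[OF c(1)] connectsD(3,4)[OF c(2)] velocity_eq(2)[OF c(1)]
    by (simp_all add: bilinear_rzero[OF bilinB])
  ultimately show ?thesis by simp
qed

lemma energy_has_derivative:
  assumes q: "q \<in> C" and r: "r \<in> C"
  shows "((\<lambda>r. energy q r) has_derivative (\<lambda>u. 2 * B r (final_velocity q r) u)) (at r)"
  unfolding has_derivative_at_alt
proof (intro conjI allI impI)
  have "linear (B r (final_velocity q r))" using bilinB[of r] by (simp add: bilinear_def)
  then show "bounded_linear (\<lambda>u. 2 * B r (final_velocity q r) u)"
    by (intro bounded_linear_const_mult) (simp add: linear_conv_bounded_linear)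
  fix e :: real assume e: "0 < e"
  let ?M = "256 * K + 128 * \<kappa> + 8"
  have M: "0 < ?M" using K(1) kappa_nonneg by linarith
  obtain d where d: "0 < d" "ball r d \<subseteq> C" using r open_ball open_contains_ball by blast
  show "\<exists>d>0. \<forall>y. norm (y - r) < d \<longrightarrow>
      norm (energy q y - energy q r - 2 * B r (final_velocity q r) (y - r)) \<le> e * norm (y - r)"
  proof (intro exI[of _ "min d (e / ?M)"] conjI allI impI)
    show "0 < min d (e / ?M)" using d e M by simp
    fix y assume y: "norm (y - r) < min d (e / ?M)"
    then have "y \<in> C" using d(2) by (auto simp: dist_norm norm_minus_commute subset_iff)
    from energy_first_variation[OF q r this]
    have "norm (energy q y - energy q r - 2 * B r (final_velocity q r) (y - r)) \<le> ?M * norm (y - r) * norm (y - r)"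
      by (simp add: power2_eq_square mult.assoc)
    also have "\<dots> \<le> e * norm (y - r)"
    proof (rule mult_right_mono)
      have "norm (y - r) < e / ?M" using y by simp
      then show "?M * norm (y - r) \<le> e" unfolding pos_less_divide_eq[OF M] by (simp only: mult.commute)
    qed simp
    finally show "norm (energy q y - energy q r - 2 * B r (final_velocity q r) (y - r)) \<le> e * norm (y - r)" .
  qed
qed

section \<open>Strong convexity of the energy\<close>

text \<open>Expanding both arguments around \<open>d\<close> leaves three error terms, each at most a multiple of \<open>\<kappa> * (norm d)\<^sup>2\<close>.\<close>

lemma B_perturbed:
  assumes z: "z \<in> W" and u: "norm (u - d) \<le> 3000 * \<kappa> * norm d" and v: "norm (v - d) \<le> 3000 * \<kappa> * norm d"
  shows "\<bar>B z u v - (norm d)\<^sup>2\<bar> \<le> 12200 * \<kappa> * (norm d)\<^sup>2"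
proof -
  let ?n = "norm d" and ?e = "u - d" and ?f = "v - d"
  have small: "3000 * \<kappa> * ?n \<le> 3/100 * ?n" using kappa by (intro mult_right_mono) auto
  have "B z u v = B z (d + ?e) (d + ?f)" by simp
  also have "\<dots> = B z d d + B z d ?f + B z ?e d + B z ?e ?f"
    unfolding bilinear_ladd[OF bilinB] bilinear_radd[OF bilinB] by simp
  finally have s: "B z u v = B z d d + B z d ?f + B z ?e d + B z ?e ?f" .
  have 1: "\<bar>B z d d - ?n\<^sup>2\<bar> \<le> 4 * (\<kappa> * ?n\<^sup>2)"
    using B_near[OF z, of d d] by (simp add: power2_norm_eq_inner[symmetric] power2_eq_square ac_simps)
  have 2: "\<bar>B z d ?f\<bar> \<le> 6000 * (\<kappa> * ?n\<^sup>2)"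
  proof -
    have "2 * (?n * norm ?f) \<le> 2 * (?n * (3000 * \<kappa> * ?n))" using v by (intro mult_left_mono) auto
    from order_trans[OF B_bound[OF z] this] show ?thesis by (simp add: power2_eq_square ac_simps)
  qed
  have 3: "\<bar>B z ?e d\<bar> \<le> 6000 * (\<kappa> * ?n\<^sup>2)"
  proof -
    have "2 * (norm ?e * ?n) \<le> 2 * ((3000 * \<kappa> * ?n) * ?n)" using u by (intro mult_left_mono mult_right_mono) auto
    from order_trans[OF B_bound[OF z] this] show ?thesis by (simp add: power2_eq_square ac_simps)
  qed
  have 4: "\<bar>B z ?e ?f\<bar> \<le> 180 * (\<kappa> * ?n\<^sup>2)"
  proof -
    have "2 * (norm ?e * norm ?f) \<le> 2 * ((3000 * \<kappa> * ?n) * (3/100 * ?n))"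
      using u order_trans[OF v small] kappa_nonneg by (intro mult_left_mono mult_mono) auto
    from order_trans[OF B_bound[OF z] this] show ?thesis by (simp add: power2_eq_square ac_simps)
  qed
  have "\<bar>B z u v - ?n\<^sup>2\<bar> \<le> 12184 * (\<kappa> * ?n\<^sup>2)" unfolding s using 1 2 3 4 by linarith
  also have "\<dots> \<le> 12200 * (\<kappa> * ?n\<^sup>2)" using kappa_nonneg by (intro mult_right_mono) auto
  finally show ?thesis by simp
qed

text \<open>The differential at \<open>r\<close> is \<open>2 * B r w\<close> with the final velocity \<open>w\<close>, and \<open>w\<close> differs from \<open>r - q\<close> by a map
with small Lipschitz constant in \<open>r\<close>. So the increment of \<open>w\<close> is almost \<open>q2 - q1\<close>, while the change of \<open>B\<close>
acts on the bounded vector \<open>w\<close> and is small.\<close>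

lemma differential_estimate_straight:
  assumes q: "q \<in> C" "q1 \<in> C" "q2 \<in> C"
  shows "\<bar>2 * B q2 (final_velocity q q2) (q2 - q1) - 2 * B q1 (final_velocity q q1) (q2 - q1) - 2 * (norm (q2 - q1))\<^sup>2\<bar>
     \<le> 100000 * \<kappa> * (norm (q2 - q1))\<^sup>2"
proof -
  let ?d = "q2 - q1" and ?w1 = "final_velocity q q1" and ?w2 = "final_velocity q q2"
  have 1: "\<bar>B q2 (?w2 - ?w1) ?d - (norm ?d)\<^sup>2\<bar> \<le> 12200 * (\<kappa> * (norm ?d)\<^sup>2)"
    using B_perturbed[OF C_sub[OF q(3)] velocity_difference(2)[OF q(1,3,2)], of ?d] kappa_nonneg by (simp add: mult.assoc)
  have 2: "\<bar>B q2 ?w1 ?d - B q1 ?w1 ?d\<bar> \<le> 16 * (\<kappa> * (norm ?d)\<^sup>2)"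
  proof -
    have "norm ?w1 \<le> 8" using final_velocity_bound[OF q(1,2)] delta by simp
    then have "2 * \<kappa> * norm ?d * (norm ?w1 * norm ?d) \<le> 2 * \<kappa> * norm ?d * (8 * norm ?d)"
      using kappa_nonneg by (intro mult_left_mono mult_right_mono) auto
    from order_trans[OF B_lipschitz[OF C_sub[OF q(3)] C_sub[OF q(2)]] this] show ?thesis by (simp add: power2_eq_square)
  qed
  have s: "B q2 (?w2 - ?w1) ?d = B q2 ?w2 ?d - B q2 ?w1 ?d" by (rule bilinear_lsub[OF bilinB])
  have "0 \<le> \<kappa> * (norm ?d)\<^sup>2" using kappa_nonneg by simp
  with 1 2 s show ?thesis unfolding mult.assoc by linarith
qed

text \<open>Compared with the straight case, the test vector \<open>U\<close> changes along the geodesic as well. Its being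
nearly equal to \<open>z2 - z1\<close> would only give a change of first order in the distance; integrating the
geodesic equation gives the required second order.\<close>

lemma differential_estimate_geodesic:
  assumes q: "q \<in> C" and c: "connects z1 z2 Z U"
  shows "\<bar>2 * B z2 (final_velocity q z2) (U 1) - 2 * B z1 (final_velocity q z1) (U 0) - 2 * energy z1 z2\<bar>
     \<le> 100000 * \<kappa> * energy z1 z2"
proof -
  note z = connectsD(5,6)[OF c]
  let ?d = "z2 - z1" and ?w1 = "final_velocity q z1" and ?w2 = "final_velocity q z2"
  let ?k = "\<kappa> * (norm ?d)\<^sup>2"
  have U: "norm (U t - ?d) \<le> 3000 * \<kappa> * norm ?d" if "t \<in> {0..1}" for t
    by (rule connects_near_straight[OF c that])
  have "3000 * \<kappa> * norm ?d \<le> 3/100 * norm ?d" using kappa by (intro mult_right_mono) auto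
  then have Ub: "norm (U t) \<le> 103/100 * norm ?d" if "t \<in> {0..1}" for t
    using U[OF that] norm_triangle_sub[of "U t" ?d] by simp
  have 1: "\<bar>B z2 (?w2 - ?w1) (U 1) - (norm ?d)\<^sup>2\<bar> \<le> 12200 * ?k"
    using B_perturbed[OF C_sub[OF z(2)] velocity_difference(2)[OF q z(2,1)] U[of 1]] by (simp add: mult.assoc)
  have w1: "norm ?w1 \<le> 8" using final_velocity_bound[OF q z(1)] delta by simp
  have 2: "\<bar>B z2 ?w1 (U 1) - B z1 ?w1 (U 1)\<bar> \<le> 17 * ?k"
  proof -
    have "2 * \<kappa> * norm ?d * (norm ?w1 * norm (U 1)) \<le> 2 * \<kappa> * norm ?d * (8 * (103/100 * norm ?d))"
      using kappa_nonneg w1 Ub[of 1] by (intro mult_left_mono mult_mono) auto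
    also have "\<dots> = 1648/100 * ?k" by (simp add: power2_eq_square)
    also have "\<dots> \<le> 17 * ?k" using kappa_nonneg by (intro mult_right_mono) auto
    finally show ?thesis using B_lipschitz[OF C_sub[OF z(2)] C_sub[OF z(1)], of ?w1 "U 1"] by simp
  qed
  have "norm (U 1 - U 0 - (1 - 0) *\<^sub>R 0) \<le> 4 * ?k * \<bar>1 - 0\<bar>"
  proof (rule vector_mean_value[of "{0..1}" U "\<lambda>t. N (Z t) (U t)"])
    fix t :: real assume t: "t \<in> {0..1}"
    show "(U has_vector_derivative N (Z t) (U t)) (at t within {0..1})"
      by (rule geodD(2)[OF connectsD(1)[OF c] t])
    have "norm (N (Z t) (U t)) \<le> 3 * \<kappa> * (norm (U t))\<^sup>2" by (rule N_bound_C[OF connectsD(7)[OF c t]])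
    also have "\<dots> \<le> 3 * \<kappa> * (103/100 * norm ?d)\<^sup>2"
      using kappa_nonneg Ub[OF t] by (intro mult_left_mono power_mono) auto
    also have "\<dots> = 31827/10000 * ?k" by (simp add: power_mult_distrib power2_eq_square)
    also have "\<dots> \<le> 4 * ?k" using kappa_nonneg by (intro mult_right_mono) auto
    finally show "norm (N (Z t) (U t) - 0) \<le> 4 * ?k" by simp
  qed auto
  then have U10: "norm (U 1 - U 0) \<le> 4 * ?k" by simp
  have 3: "\<bar>B z1 ?w1 (U 1 - U 0)\<bar> \<le> 64 * ?k"
  proof -
    have "2 * (norm ?w1 * norm (U 1 - U 0)) \<le> 2 * (8 * (4 * ?k))"
      using w1 U10 kappa_nonneg by (intro mult_left_mono mult_mono) auto
    from order_trans[OF B_bound[OF C_sub[OF z(1)]] this] show ?thesis by simp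
  qed
  have 4: "\<bar>energy z1 z2 - (norm ?d)\<^sup>2\<bar> \<le> 12200 * ?k"
    using B_perturbed[OF C_sub[OF z(1)] U[of 0] U[of 0]] by (simp add: energy_def velocity_eq[OF c] mult.assoc)
  have s: "B z2 (?w2 - ?w1) (U 1) = B z2 ?w2 (U 1) - B z2 ?w1 (U 1)" 
    "B z1 ?w1 (U 1 - U 0) = B z1 ?w1 (U 1) - B z1 ?w1 (U 0)"
    by (simp_all add: bilinear_lsub[OF bilinB] bilinear_rsub[OF bilinB])
  have k0: "0 \<le> ?k" using kappa_nonneg by simp
  have "?k \<le> 1/100000 * (norm ?d)\<^sup>2" using kappa by (intro mult_right_mono) auto
  with 4 have "(norm ?d)\<^sup>2 \<le> 2 * energy z1 z2" by linarith
  then have "\<kappa> * (norm ?d)\<^sup>2 \<le> \<kappa> * (2 * energy z1 z2)" using kappa_nonneg by (rule mult_left_mono)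
  then have "50000 * ?k \<le> 100000 * \<kappa> * energy z1 z2" by simp
  moreover have "\<bar>2 * B z2 ?w2 (U 1) - 2 * B z1 ?w1 (U 0) - 2 * energy z1 z2\<bar> \<le> 50000 * ?k"
    using 1 2 3 4 s k0 by linarith
  ultimately show ?thesis by (rule order_trans[rotated])
qed

lemma energy_convex_straight:
  assumes q: "q \<in> C" "q1 \<in> C" "q2 \<in> C" and e: "100000 * \<kappa> \<le> e" and al: "\<alpha> \<in> {0..1}"
  shows "energy q ((1 - \<alpha>) *\<^sub>R q1 + \<alpha> *\<^sub>R q2) \<le> (1 - \<alpha>) * energy q q1 + \<alpha> * energy q q2
     - (1 - e / 2) * \<alpha> * (1 - \<alpha>) * (norm (q2 - q1))\<^sup>2"
proof -
  let ?d = "q2 - q1"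
  let ?z = "\<lambda>t. q1 + t *\<^sub>R ?d"
  have zC: "?z t \<in> C" if "t \<in> {0..1}" for t
    using convexD[OF convex_ball q(2,3), of "1 - t" t] that by (auto simp: algebra_simps)
  define f' where "f' t = 2 * B (?z t) (final_velocity q (?z t)) ?d" for t
  have "energy q (?z \<alpha>) \<le> (1 - \<alpha>) * energy q (?z 0) + \<alpha> * energy q (?z 1)
     - ((2 - e) * (norm ?d)\<^sup>2) / 2 * \<alpha> * (1 - \<alpha>)"
  proof (rule strongly_convex_of_derivative[OF _ _ al])
    fix t :: real assume t: "t \<in> {0..1}"
    have "(?z has_vector_derivative ?d) (at t within {0..1})"
      by (auto intro!: derivative_eq_intros)
    from vector_derivative_diff_chain_within[OF this has_derivative_at_withinI[OF energy_has_derivative[OF q(1) zC[OF t]]]]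
    show "((\<lambda>t. energy q (?z t)) has_vector_derivative f' t) (at t within {0..1})"
      by (simp add: f'_def o_def)
  next
    fix s t :: real assume st: "0 \<le> s" "s < t" "t \<le> 1"
    let ?D = "?z t - ?z s"
    have D: "?D = (t - s) *\<^sub>R ?d" by (simp add: algebra_simps)
    have "(2 - 100000 * \<kappa>) * (norm ?D)\<^sup>2 \<le>
       2 * B (?z t) (final_velocity q (?z t)) ?D - 2 * B (?z s) (final_velocity q (?z s)) ?D"
      using abs_le_D2[OF differential_estimate_straight[OF q(1) zC[of s] zC[of t]]] st by (simp add: left_diff_distrib)
    also have "\<dots> = (t - s) * (f' t - f' s)"
      unfolding D bilinear_rmul[OF bilinB] f'_def by (simp add: algebra_simps)
    finally have "(2 - 100000 * \<kappa>) * (norm ?D)\<^sup>2 \<le> (t - s) * (f' t - f' s)" .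
    moreover have "(2 - e) * (norm ?D)\<^sup>2 \<le> (2 - 100000 * \<kappa>) * (norm ?D)\<^sup>2"
      using e by (intro mult_right_mono) auto
    moreover have "(norm ?D)\<^sup>2 = (t - s) * ((t - s) * (norm ?d)\<^sup>2)"
      unfolding D by (simp add: power2_eq_square)
    ultimately have "(t - s) * ((2 - e) * (norm ?d)\<^sup>2 * (t - s)) \<le> (t - s) * (f' t - f' s)"
      by (simp add: ac_simps)
    then show "(2 - e) * (norm ?d)\<^sup>2 * (t - s) \<le> f' t - f' s"
      by (rule mult_left_le_imp_le) (use st in simp)
  qed
  moreover have "?z \<alpha> = (1 - \<alpha>) *\<^sub>R q1 + \<alpha> *\<^sub>R q2" by (simp add: algebra_simps)
  moreover have "((2 - e) * (norm ?d)\<^sup>2) / 2 * \<alpha> * (1 - \<alpha>) = (1 - e / 2) * \<alpha> * (1 - \<alpha>) * (norm ?d)\<^sup>2"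
    proof -
    define k where "k = 1 - e / 2"
    then have ek: "2 - e = 2 * k" by simp
    show ?thesis unfolding ek k_def[symmetric] by simp
  qed
  moreover have "?z 0 = q1" "?z 1 = q2" by simp_all
  ultimately show ?thesis by (simp only:)
qed

lemma energy_convex_geodesic:
  assumes q: "q \<in> C" and c: "connects z1 z2 Z U" and e: "100000 * \<kappa> \<le> e" and al: "\<alpha> \<in> {0..1}"
  shows "energy q (Z \<alpha>) \<le> (1 - \<alpha>) * energy q z1 + \<alpha> * energy q z2
     - (1 - e / 2) * \<alpha> * (1 - \<alpha>) * energy z1 z2"
proof -
  define f' where "f' t = 2 * B (Z t) (final_velocity q (Z t)) (U t)" for t
  note ZC = connectsD(7)[OF c]
  have "energy q (Z \<alpha>) \<le> (1 - \<alpha>) * energy q (Z 0) + \<alpha> * energy q (Z 1)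
     - ((2 - e) * energy z1 z2) / 2 * \<alpha> * (1 - \<alpha>)"
  proof (rule strongly_convex_of_derivative[OF _ _ al])
    fix t :: real assume t: "t \<in> {0..1}"
    from vector_derivative_diff_chain_within[OF geodD(1)[OF connectsD(1)[OF c] t]
        has_derivative_at_withinI[OF energy_has_derivative[OF q(1) ZC[OF t]]]]
    show "((\<lambda>t. energy q (Z t)) has_vector_derivative f' t) (at t within {0..1})"
      by (simp add: f'_def o_def)
  next
    fix s t :: real assume st: "0 \<le> s" "s < t" "t \<le> 1"
    then have st': "s \<in> {0..1}" "t \<in> {0..1}" by auto
    let ?E = "energy (Z s) (Z t)"
    have E0: "0 \<le> ?E" by (rule energy_nonneg[OF ZC[OF st'(1)] ZC[OF st'(2)]])
    have sg: "connects (Z s) (Z t) (\<lambda>u. Z (s + u * (t - s))) (\<lambda>u. (t - s) *\<^sub>R U (s + u * (t - s)))"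
      by (rule geod_segment[OF connectsD(1,2)[OF c] _ st']) simp
    have "(2 - 100000 * \<kappa>) * ?E \<le> 2 * B (Z t) (final_velocity q (Z t)) ((t - s) *\<^sub>R U t)
       - 2 * B (Z s) (final_velocity q (Z s)) ((t - s) *\<^sub>R U s)"
      using abs_le_D2[OF differential_estimate_geodesic[OF q sg]] by (simp add: left_diff_distrib)
    also have "\<dots> = (t - s) * (f' t - f' s)"
      unfolding bilinear_rmul[OF bilinB] f'_def by (simp add: algebra_simps)
    finally have "(2 - 100000 * \<kappa>) * ?E \<le> (t - s) * (f' t - f' s)" .
    moreover have "(2 - e) * ?E \<le> (2 - 100000 * \<kappa>) * ?E"
      using e E0 by (intro mult_right_mono) auto
    moreover have "?E = (t - s) * ((t - s) * energy z1 z2)"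
      using energy_segment[OF c st'] by (simp add: power2_eq_square)
    ultimately have "(t - s) * ((2 - e) * energy z1 z2 * (t - s)) \<le> (t - s) * (f' t - f' s)"
      by (simp add: ac_simps)
    then show "(2 - e) * energy z1 z2 * (t - s) \<le> f' t - f' s"
      by (rule mult_left_le_imp_le) (use st in simp)
  qed
  moreover have "((2 - e) * energy z1 z2) / 2 * \<alpha> * (1 - \<alpha>) = (1 - e / 2) * \<alpha> * (1 - \<alpha>) * energy z1 z2"
    proof -
    define k where "k = 1 - e / 2"
    then have ek: "2 - e = 2 * k" by simp
    show ?thesis unfolding ek k_def[symmetric] by simp
  qed
  ultimately show ?thesis by (simp only: connectsD(3,4)[OF c])
qed

end

section \<open>Locally Lipschitz functions and second derivatives\<close>

lemma loc_lipschitz_finite_family: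
  assumes "finite I" and S: "open S" "x \<in> S" and f: "\<And>i. i \<in> I \<Longrightarrow> loc_lipschitz_on S (f i)"
  obtains u L where "u > 0" "0 \<le> L" "cball x u \<subseteq> S" "\<And>i. i \<in> I \<Longrightarrow> L-lipschitz_on (cball x u) (f i)"
proof -
  have "\<exists>u L. u > 0 \<and> 0 \<le> L \<and> cball x u \<subseteq> S \<and> (\<forall>i\<in>I. L-lipschitz_on (cball x u) (f i))"
    using assms(1) f
  proof (induction I)
    case empty
    obtain u where "u > 0" "cball x u \<subseteq> S" using S open_contains_cball by blast
    then show ?case by (intro exI[of _ u]) auto
  next
    case (insert i I)
    then obtain u L where u: "u > 0" "0 \<le> L" "cball x u \<subseteq> S" "\<forall>i\<in>I. L-lipschitz_on (cball x u) (f i)"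
      by auto
    obtain u' L' where u': "u' > 0" "L'-lipschitz_on (cball x u' \<inter> S) (f i)"
      using insert.prems[of i] S(2) unfolding loc_lipschitz_on_def by auto
    let ?u = "min u u'" and ?L = "max L L'"
    have sub: "cball x ?u \<subseteq> cball x u" "cball x ?u \<subseteq> cball x u' \<inter> S" using u(3) by auto
    have "?L-lipschitz_on (cball x ?u) (f j)" if j: "j \<in> insert i I" for j
    proof (cases "j = i")
      case True
      show ?thesis unfolding True
        by (rule lipschitz_on_le[OF lipschitz_on_subset[OF u'(2) sub(2)]]) simp
    next
      case False
      then have "L-lipschitz_on (cball x u) (f j)" using j u(4) by blast
      from lipschitz_on_le[OF lipschitz_on_subset[OF this sub(1)]] show ?thesis by simp
    qed
    moreover have "0 < ?u" "0 \<le> ?L" using u(1,2) u'(1) by auto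
    moreover have "cball x ?u \<subseteq> S" using sub(2) by blast
    ultimately show ?case by blast
  qed
  then show thesis using that by blast
qed

text \<open>By induction the partial derivatives are locally Lipschitz, hence locally bounded, which bounds the
full derivative near each point.\<close>

lemma Ck1_imp_loc_lipschitz:
  fixes f :: "'a::euclidean_space \<Rightarrow> 'b::real_normed_vector"
  assumes "open S" "Ck1_on k S f" shows "loc_lipschitz_on S f"
  using assms(2)
proof (induction k arbitrary: f)
  case (Suc k)
  have df: "(f has_derivative frechet_derivative f (at y)) (at y)" if "y \<in> S" for y
    using Suc.prems that by (auto simp: frechet_derivative_works[symmetric])
  show ?case unfolding loc_lipschitz_on_def
  proof
    fix x assume x: "x \<in> S"
    have "loc_lipschitz_on S (\<lambda>y. frechet_derivative f (at y) i)" for i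
      using Suc.prems by (intro Suc.IH) auto
    then obtain u L where u: "u > 0" "0 \<le> L" "cball x u \<subseteq> S"
      "\<And>i. i \<in> Basis \<Longrightarrow> L-lipschitz_on (cball x u) (\<lambda>y. frechet_derivative f (at y) i)"
      using loc_lipschitz_finite_family[OF finite_Basis assms(1) x] by metis
    define M where "M = (\<Sum>i\<in>Basis. norm (frechet_derivative f (at x) i) + L * u)"
    have M0: "0 \<le> M" using u by (auto simp: M_def intro!: sum_nonneg)
    have "M-lipschitz_on (cball x u) f"
    proof (rule lipschitz_onI)
      fix y z assume yz: "y \<in> cball x u" "z \<in> cball x u"
      have "norm (f y - f z) \<le> M * norm (y - z)"
      proof (rule differentiable_bound[OF convex_cball _ _ yz])
        fix w assume w: "w \<in> cball x u"
        then show "(f has_derivative frechet_derivative f (at w)) (at w within cball x u)"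
          by (intro has_derivative_at_withinI[OF df] subsetD[OF u(3)])
        show "onorm (frechet_derivative f (at w)) \<le> M"
        proof (rule onorm_le)
          fix v :: 'a
          have lin: "linear (frechet_derivative f (at w))"
            by (rule has_derivative_linear[OF df[OF subsetD[OF u(3) w]]])
          have "frechet_derivative f (at w) v = frechet_derivative f (at w) (\<Sum>i\<in>Basis. (v \<bullet> i) *\<^sub>R i)"
            by (simp add: euclidean_representation)
          also have "\<dots> = (\<Sum>i\<in>Basis. (v \<bullet> i) *\<^sub>R frechet_derivative f (at w) i)"
            by (simp add: linear_sum[OF lin] linear_cmul[OF lin])
          also have "norm \<dots> \<le> (\<Sum>i\<in>Basis. norm v * (norm (frechet_derivative f (at x) i) + L * u))"
          proof (rule sum_norm_le)
            fix i :: 'a assume i: "i \<in> Basis"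
            have "dist (frechet_derivative f (at w) i) (frechet_derivative f (at x) i) \<le> L * dist w x"
              using u w by (intro lipschitz_onD[OF u(4)[OF i]]) auto
            also have "\<dots> \<le> L * u" using u w by (intro mult_left_mono) (auto simp: dist_commute)
            finally have "norm (frechet_derivative f (at w) i) \<le> norm (frechet_derivative f (at x) i) + L * u"
              using norm_triangle_sub[of "frechet_derivative f (at w) i" "frechet_derivative f (at x) i"]
              by (simp add: dist_norm)
            then show "norm ((v \<bullet> i) *\<^sub>R frechet_derivative f (at w) i) \<le> norm v * (norm (frechet_derivative f (at x) i) + L * u)"
              using Basis_le_norm[OF i, of v] by (simp add: mult_mono)
          qed
          finally show "norm (frechet_derivative f (at w) v) \<le> M * norm v"
            by (simp add: M_def sum_distrib_left mult.commute)
        qed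
      qed
      then show "dist (f y) (f z) \<le> M * dist y z" by (simp add: dist_norm)
    qed (rule M0)
    then have "M-lipschitz_on (cball x u \<inter> S) f" by (rule lipschitz_on_subset) auto
    with u(1) show "\<exists>u>0. \<exists>L. L-lipschitz_on (cball x u \<inter> S) f" by blast
  qed
qed simp

text \<open>The second difference is an increment of \<open>s \<mapsto> f (x + s u + t v) - f (x + s u)\<close>, whose derivative is
\<open>A (t v)\<close> up to \<open>o(t)\<close>.\<close>

lemma second_difference_estimate:
  fixes f :: "'a::real_normed_vector \<Rightarrow> 'b::real_normed_vector"
  assumes S: "open S" "x \<in> S" and f: "\<And>y. y \<in> S \<Longrightarrow> (f has_derivative f' y) (at y)"
    and A: "((\<lambda>y. f' y u) has_derivative A) (at x)" and e: "0 < e"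
  shows "\<exists>d>0. \<forall>t. 0 < t \<and> t < d \<longrightarrow>
     norm (f (x + t *\<^sub>R u + t *\<^sub>R v) - f (x + t *\<^sub>R u) - f (x + t *\<^sub>R v) + f x - (t * t) *\<^sub>R A v) \<le> e * (t * t)"
proof -
  define m where "m = 2 * (norm u + norm v) + 1"
  have m: "0 < m" by (simp add: m_def add_nonneg_pos)
  obtain d1 where d1: "0 < d1" "ball x d1 \<subseteq> S" using S open_contains_ball by blast
  have lin: "linear A" using A has_derivative_linear by blast
  have "\<forall>e>0. \<exists>d>0. \<forall>y. norm (y - x) < d \<longrightarrow> norm (f' y u - f' x u - A (y - x)) \<le> e * norm (y - x)"
    using A unfolding has_derivative_at_alt by blast
  moreover have "0 < e / m" using e m by simp
  ultimately obtain d2 where d2: "0 < d2"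
    "\<And>y. norm (y - x) < d2 \<Longrightarrow> norm (f' y u - f' x u - A (y - x)) \<le> e / m * norm (y - x)" by blast
  \<comment> \<open>Keeps all arguments in the range where the expansion of \<open>f' _ u\<close> at \<open>x\<close> holds.\<close>
  define d where "d = min d1 d2 / m"
  have d: "0 < d" using d1 d2 m by (simp add: d_def)
  show ?thesis
  proof (intro exI[of _ d] conjI allI impI d)
    fix t :: real assume t: "0 < t \<and> t < d"
    then have tm: "t * m < min d1 d2" using m by (simp add: d_def pos_less_divide_eq)
    have near: "norm (s *\<^sub>R u + r *\<^sub>R v) \<le> t * (norm u + norm v)" if "s \<in> {0..t}" "r \<in> {0..t}" for s r
    proof -
      have "norm (s *\<^sub>R u + r *\<^sub>R v) \<le> s * norm u + r * norm v"
        using that by (intro order_trans[OF norm_triangle_ineq]) auto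
      also have "\<dots> \<le> t * norm u + t * norm v" using that by (intro add_mono mult_right_mono) auto
      finally show ?thesis by (simp add: distrib_left)
    qed
    have nt: "t * (norm u + norm v) \<le> t * m" using t by (intro mult_left_mono) (auto simp: m_def)
    define F where "F s = f (x + s *\<^sub>R u + t *\<^sub>R v) - f (x + s *\<^sub>R u)" for s
    define F' where "F' s = f' (x + s *\<^sub>R u + t *\<^sub>R v) u - f' (x + s *\<^sub>R u) u" for s
    have "norm (F t - F 0 - (t - 0) *\<^sub>R A (t *\<^sub>R v)) \<le> (e * t) * \<bar>t - 0\<bar>"
    proof (rule vector_mean_value[of "{0..t}" F F'])
      fix s assume s: "s \<in> {0..t}"
      have t0: "t \<in> {0..t}" "0 \<in> {0..t}" using t by auto
      have in1: "norm (s *\<^sub>R u + t *\<^sub>R v) < min d1 d2"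
        using near[OF s t0(1)] nt tm by linarith
      have in2: "norm (s *\<^sub>R u) < min d1 d2"
        using near[OF s t0(2)] nt tm unfolding scaleR_zero_left add_0_right by linarith
      have S1: "x + s *\<^sub>R u + t *\<^sub>R v \<in> S" "x + s *\<^sub>R u \<in> S"
        using in1 in2 d1(2) by (auto simp: subset_iff dist_norm norm_minus_commute algebra_simps)
      have c: "((\<lambda>s. x + s *\<^sub>R u + w) has_vector_derivative u) (at s within {0..t})" for w
        by (auto intro!: derivative_eq_intros)
      have "((\<lambda>s. f (x + s *\<^sub>R u + t *\<^sub>R v)) has_vector_derivative f' (x + s *\<^sub>R u + t *\<^sub>R v) u) (at s within {0..t})"
        using vector_derivative_diff_chain_within[OF c has_derivative_at_withinI[OF f[OF S1(1)]]] by (simp add: o_def)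
      moreover have "((\<lambda>s. f (x + s *\<^sub>R u)) has_vector_derivative f' (x + s *\<^sub>R u) u) (at s within {0..t})"
        using vector_derivative_diff_chain_within[OF c[of 0], of f "f' (x + s *\<^sub>R u)"] has_derivative_at_withinI[OF f[OF S1(2)]]
        by (simp add: o_def)
      ultimately show "(F has_vector_derivative F' s) (at s within {0..t})"
        unfolding F_def F'_def by (rule has_vector_derivative_diff)
      let ?r = "\<lambda>h. f' (x + h) u - f' x u - A h"
      have r: "norm (?r h) \<le> e / m * norm h" if "norm h < min d1 d2" for h
        using d2(2)[of "x + h"] that by simp
      have "F' s - A (t *\<^sub>R v) = ?r (s *\<^sub>R u + t *\<^sub>R v) - ?r (s *\<^sub>R u)"
        unfolding F'_def linear_add[OF lin] by (simp add: add.assoc)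
      then have "norm (F' s - A (t *\<^sub>R v)) \<le> norm (?r (s *\<^sub>R u + t *\<^sub>R v)) + norm (?r (s *\<^sub>R u))"
        by (metis norm_triangle_ineq4)
      also have "\<dots> \<le> e / m * norm (s *\<^sub>R u + t *\<^sub>R v) + e / m * norm (s *\<^sub>R u)"
        by (intro add_mono r in1 in2)
      also have "\<dots> \<le> e / m * (t * (norm u + norm v)) + e / m * (t * (norm u + norm v))"
        using near[OF s t0(1)] near[OF s t0(2)] e m by (intro add_mono mult_left_mono) simp_all
      also have "\<dots> = e / m * (t * (2 * (norm u + norm v)))" by (simp add: algebra_simps)
      also have "\<dots> \<le> e / m * (t * m)" using e m t by (intro mult_left_mono) (auto simp: m_def)
      also have "\<dots> = e * t" using m by simp
      finally show "norm (F' s - A (t *\<^sub>R v)) \<le> e * t" .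
    qed (use t in auto)
    moreover have "F t - F 0 - (t - 0) *\<^sub>R A (t *\<^sub>R v) =
      f (x + t *\<^sub>R u + t *\<^sub>R v) - f (x + t *\<^sub>R u) - f (x + t *\<^sub>R v) + f x - (t * t) *\<^sub>R A v"
      by (simp add: F_def linear_cmul[OF lin])
    ultimately show "norm (f (x + t *\<^sub>R u + t *\<^sub>R v) - f (x + t *\<^sub>R u) - f (x + t *\<^sub>R v) + f x - (t * t) *\<^sub>R A v) \<le> e * (t * t)"
      using t by simp
  qed
qed

text \<open>The second difference quotient is symmetric in \<open>u\<close> and \<open>v\<close>, and both iterated derivatives are its limit.\<close>

lemma second_derivative_symmetric:
  fixes f :: "'a::real_normed_vector \<Rightarrow> 'b::real_normed_vector"
  assumes S: "open S" "x \<in> S" and f: "\<And>y. y \<in> S \<Longrightarrow> (f has_derivative f' y) (at y)"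
    and A: "((\<lambda>y. f' y u) has_derivative A) (at x)" and A': "((\<lambda>y. f' y v) has_derivative A') (at x)"
  shows "A v = A' u"
proof -
  have "norm (A v - A' u) \<le> 0 + e" if e: "0 < e" for e
  proof -
    have e2: "0 < e/2" using e by simp
    obtain d where d: "0 < d" "\<And>t. 0 < t \<and> t < d \<Longrightarrow>
      norm (f (x + t *\<^sub>R u + t *\<^sub>R v) - f (x + t *\<^sub>R u) - f (x + t *\<^sub>R v) + f x - (t * t) *\<^sub>R A v) \<le> e/2 * (t * t)"
      using second_difference_estimate[OF S f A e2] by blast
    obtain d' where d': "0 < d'" "\<And>t. 0 < t \<and> t < d' \<Longrightarrow>
      norm (f (x + t *\<^sub>R v + t *\<^sub>R u) - f (x + t *\<^sub>R v) - f (x + t *\<^sub>R u) + f x - (t * t) *\<^sub>R A' u) \<le> e/2 * (t * t)"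
      using second_difference_estimate[OF S f A' e2] by blast
    define t where "t = min d d' / 2"
    have t: "0 < t" "t < d" "t < d'" using d(1) d'(1) by (auto simp: t_def min_def)
    let ?\<Delta> = "f (x + t *\<^sub>R u + t *\<^sub>R v) - f (x + t *\<^sub>R u) - f (x + t *\<^sub>R v) + f x"
    have 1: "norm (?\<Delta> - (t * t) *\<^sub>R A v) \<le> e/2 * (t * t)" using d(2) t by blast
    have 2: "norm (?\<Delta> - (t * t) *\<^sub>R A' u) \<le> e/2 * (t * t)"
      using d'(2)[of t] t by (simp add: algebra_simps)
    have "(t * t) *\<^sub>R (A v - A' u) = (?\<Delta> - (t * t) *\<^sub>R A' u) - (?\<Delta> - (t * t) *\<^sub>R A v)"
      by (simp add: algebra_simps)
    then have "norm ((t * t) *\<^sub>R (A v - A' u)) \<le> e/2 * (t * t) + e/2 * (t * t)"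
      using order_trans[OF norm_triangle_ineq4 add_mono[OF 2 1]] by simp
    then have "norm (A v - A' u) * (t * t) \<le> e * (t * t)" using t by (simp add: abs_mult mult.commute)
    moreover have "0 < t * t" using t by simp
    ultimately show ?thesis by (simp only: mult_le_cancel_right_pos add_0)
  qed
  then have "norm (A v - A' u) \<le> 0" by (rule field_le_epsilon)
  then show ?thesis by simp
qed

section \<open>Metric and geodesic equation in a chart\<close>

definition metric_form :: "('a, 'n::finite) metric \<Rightarrow> ('a, 'n) chart \<Rightarrow> real^'n \<Rightarrow> real^'n \<Rightarrow> real^'n \<Rightarrow> real" where
  "metric_form g c z v w = v \<bullet> (g c (cinv c z) *v w)"

text \<open>Written through partial derivatives instead of as a derivative of \<open>metric_form\<close>, so that it is bilinear
in the last two arguments also at points where the metric is not differentiable.\<close>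

definition metric_form_deriv :: "('a, 'n::finite) metric \<Rightarrow> ('a, 'n) chart \<Rightarrow> real^'n \<Rightarrow> real^'n \<Rightarrow> real^'n \<Rightarrow> real^'n \<Rightarrow> real" where
  "metric_form_deriv g c z u v w =
     (\<Sum>\<nu>\<in>UNIV. \<Sum>\<alpha>\<in>UNIV. \<Sum>\<beta>\<in>UNIV. u $ \<nu> * v $ \<alpha> * w $ \<beta> * dmetric g c (cinv c z) \<nu> \<alpha> \<beta>)"

definition geodesic_accel :: "('a, 'n::finite) metric \<Rightarrow> ('a, 'n) chart \<Rightarrow> real^'n \<Rightarrow> real^'n \<Rightarrow> real^'n" where
  "geodesic_accel g c z v =
     (\<chi> \<mu>. - (\<Sum>\<alpha>\<in>UNIV. \<Sum>\<beta>\<in>UNIV. christoffel g c (cinv c z) \<mu> \<alpha> \<beta> * v $ \<alpha> * v $ \<beta>))"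

lemma metric_form_sum:
  "metric_form g c z v w = (\<Sum>\<alpha>\<in>UNIV. \<Sum>\<beta>\<in>UNIV. v $ \<alpha> * w $ \<beta> * g c (cinv c z) $ \<alpha> $ \<beta>)"
  by (simp add: metric_form_def inner_vec_def matrix_vector_mult_def sum_distrib_left ac_simps)

lemma bilinear_metric_form: "bilinear (metric_form g c z)"
  unfolding bilinear_def metric_form_def
  by (auto intro!: linearI simp: inner_add_left inner_add_right matrix_vector_right_distrib matrix_vector_mult_scaleR)

lemma bilinear_metric_form_deriv: "bilinear (metric_form_deriv g c z u)"
  unfolding bilinear_def metric_form_deriv_def
  by (auto intro!: linearI simp: algebra_simps sum.distrib sum_distrib_left)

lemma linear_component_expansion:
  fixes f :: "real^'n::finite \<Rightarrow> 'b::real_vector"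
  assumes "linear f" shows "f u = (\<Sum>\<nu>\<in>UNIV. u $ \<nu> *\<^sub>R f (axis \<nu> 1))"
proof -
  have "f u = f (\<Sum>\<nu>\<in>UNIV. u $ \<nu> *\<^sub>R axis \<nu> 1)"
    using basis_expansion[of u] by (simp add: scalar_mult_eq_scaleR)
  then show ?thesis by (simp add: linear_sum[OF assms] linear_cmul[OF assms])
qed

lemma matrix_inv_of_definite:
  fixes M :: "real^'n^'n"
  assumes "\<And>v. v \<noteq> 0 \<Longrightarrow> v \<bullet> (M *v v) > 0"
  shows "M ** matrix_inv M = mat 1"
proof -
  have "\<exists>B. B ** M = mat 1"
    unfolding matrix_left_invertible_ker using assms by (metis inner_zero_right less_irrefl)
  then obtain B where "B ** M = mat 1" by blast
  then have "M ** B = mat 1 \<and> B ** M = mat 1" using matrix_left_right_inverse by blast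
  then show ?thesis unfolding matrix_inv_def by (rule someI2) blast
qed

locale riemannian =
  fixes A :: "('a::t2_space, 'n::finite) chart set" and g :: "('a, 'n) metric"
  assumes manifold: "C21_manifold A" and metric: "C11_riemannian_metric A g"
begin

abbreviation "coords c \<equiv> snd c ` fst c"

lemma chart_props:
  assumes "c \<in> A"
  shows "open (fst c)" "open (coords c)" "continuous_on (fst c) (snd c)" "continuous_on (coords c) (cinv c)"
    "\<And>z. z \<in> coords c \<Longrightarrow> cinv c z \<in> fst c" "\<And>z. z \<in> coords c \<Longrightarrow> snd c (cinv c z) = z"
    "\<And>q. q \<in> fst c \<Longrightarrow> cinv c (snd c q) = q"
proof -
  have "is_chart c" using manifold assms unfolding C21_manifold_def C21_structure_def by blast
  then have h: "open (fst c)" "open (coords c)" "homeomorphism (fst c) (coords c) (snd c) (cinv c)"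
    unfolding is_chart_def by blast+
  show "open (fst c)" "open (coords c)" "continuous_on (fst c) (snd c)" "continuous_on (coords c) (cinv c)"
    "\<And>z. z \<in> coords c \<Longrightarrow> cinv c z \<in> fst c" "\<And>z. z \<in> coords c \<Longrightarrow> snd c (cinv c z) = z"
    "\<And>q. q \<in> fst c \<Longrightarrow> cinv c (snd c q) = q"
    using h unfolding homeomorphism_def by blast+
qed

lemma metric_props:
  assumes "c \<in> A" "q \<in> fst c"
  shows "transpose (g c q) = g c q" "\<And>v. v \<noteq> 0 \<Longrightarrow> v \<bullet> (g c q *v v) > 0"
  using metric assms unfolding C11_riemannian_metric_def by blast+

lemma metric_form_symmetric:
  assumes "c \<in> A" "z \<in> coords c" shows "metric_form g c z v w = metric_form g c z w v"
proof -
  have "v \<bullet> (g c (cinv c z) *v w) = (transpose (g c (cinv c z)) *v v) \<bullet> w"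
    by (simp add: dot_lmul_matrix)
  then show ?thesis
    using metric_props(1)[OF assms(1) chart_props(5)[OF assms]] by (simp add: metric_form_def inner_commute)
qed

lemma metric_form_pos: "c \<in> A \<Longrightarrow> z \<in> coords c \<Longrightarrow> v \<noteq> 0 \<Longrightarrow> 0 < metric_form g c z v v"
  unfolding metric_form_def by (intro metric_props(2) chart_props(5))

text \<open>Vectors are identified by their scalar products, which allows working with the Euler-Lagrange form throughout.\<close>

lemma metric_form_cancel:
  assumes "c \<in> A" "z \<in> coords c" "\<And>u. metric_form g c z u a = metric_form g c z u b"
  shows "a = b"
proof (rule ccontr)
  assume "a \<noteq> b"
  then have "0 < metric_form g c z (a - b) (a - b)" using metric_form_pos assms by simp
  then show False using assms(3)[of "a - b"] by (simp add: bilinear_rsub[OF bilinear_metric_form])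
qed

lemma metric_component_derivative:
  assumes c: "c \<in> A" and z: "z \<in> coords c"
  shows "((\<lambda>z. g c (cinv c z) $ \<alpha> $ \<beta>) has_derivative
     (\<lambda>u. \<Sum>\<nu>\<in>UNIV. u $ \<nu> * dmetric g c (cinv c z) \<nu> \<alpha> \<beta>)) (at z)"
proof -
  let ?f = "\<lambda>z. g c (cinv c z) $ \<alpha> $ \<beta>"
  have "Ck1_on 1 (coords c) ?f" using metric c unfolding C11_riemannian_metric_def by blast
  then have "?f differentiable (at z)" using z unfolding One_nat_def Ck1_on.simps by blast
  then have d: "(?f has_derivative frechet_derivative ?f (at z)) (at z)"
    by (simp add: frechet_derivative_works)
  have "frechet_derivative ?f (at z) u = (\<Sum>\<nu>\<in>UNIV. u $ \<nu> * dmetric g c (cinv c z) \<nu> \<alpha> \<beta>)" for u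
    using linear_component_expansion[OF has_derivative_linear[OF d], of u]
    by (simp add: dmetric_def chart_props(6)[OF c z])
  then have "frechet_derivative ?f (at z) = (\<lambda>u. \<Sum>\<nu>\<in>UNIV. u $ \<nu> * dmetric g c (cinv c z) \<nu> \<alpha> \<beta>)" by blast
  with d show ?thesis by simp
qed

lemma metric_form_has_derivative:
  assumes c: "c \<in> A" and z: "z \<in> coords c"
  shows "((\<lambda>z. metric_form g c z v w) has_derivative (\<lambda>u. metric_form_deriv g c z u v w)) (at z)"
proof -
  have "((\<lambda>z. metric_form g c z v w) has_derivative
     (\<lambda>u. \<Sum>\<alpha>\<in>UNIV. \<Sum>\<beta>\<in>UNIV. v $ \<alpha> * w $ \<beta> * (\<Sum>\<nu>\<in>UNIV. u $ \<nu> * dmetric g c (cinv c z) \<nu> \<alpha> \<beta>))) (at z)"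
    unfolding metric_form_sum
    by (intro has_derivative_sum has_derivative_mult_right metric_component_derivative[OF c z])
  moreover have "(\<Sum>\<alpha>\<in>UNIV. \<Sum>\<beta>\<in>UNIV. v $ \<alpha> * w $ \<beta> * (\<Sum>\<nu>\<in>UNIV. u $ \<nu> * dmetric g c (cinv c z) \<nu> \<alpha> \<beta>))
     = metric_form_deriv g c z u v w" for u
  proof -
    let ?f = "\<lambda>\<nu> \<alpha> \<beta>. u $ \<nu> * v $ \<alpha> * w $ \<beta> * dmetric g c (cinv c z) \<nu> \<alpha> \<beta>"
    have "metric_form_deriv g c z u v w = (\<Sum>\<alpha>\<in>UNIV. \<Sum>\<nu>\<in>UNIV. \<Sum>\<beta>\<in>UNIV. ?f \<nu> \<alpha> \<beta>)"
      unfolding metric_form_deriv_def by (rule sum.swap)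
    also have "\<dots> = (\<Sum>\<alpha>\<in>UNIV. \<Sum>\<beta>\<in>UNIV. \<Sum>\<nu>\<in>UNIV. ?f \<nu> \<alpha> \<beta>)"
      by (intro sum.cong refl sum.swap)
    finally show ?thesis by (simp add: sum_distrib_left ac_simps)
  qed
  ultimately show ?thesis by simp
qed

text \<open>The geodesic equation in Euler-Lagrange form: contracted with the metric, the Christoffel
  symbols are replaced by first derivatives of the metric.\<close>

lemma geodesic_accel_euler_lagrange:
  assumes c: "c \<in> A" and z: "z \<in> coords c"
  shows "metric_form g c z u (geodesic_accel g c z v)
    = metric_form_deriv g c z u v v / 2 - metric_form_deriv g c z v u v"
proof -
  let ?G = "g c (cinv c z)" and ?T = "dmetric g c (cinv c z)"
  let ?b = "\<lambda>\<alpha> \<nu> \<beta>. (1/2) * (?T \<alpha> \<nu> \<beta> + ?T \<beta> \<nu> \<alpha> - ?T \<nu> \<alpha> \<beta>) * v $ \<alpha> * v $ \<beta>"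
  define F :: "real^'n" where "F = (\<chi> \<nu>. \<Sum>\<alpha>\<in>UNIV. \<Sum>\<beta>\<in>UNIV. ?b \<alpha> \<nu> \<beta>)"
  have inv: "?G ** matrix_inv ?G = mat 1"
    by (rule matrix_inv_of_definite) (rule metric_props(2)[OF c chart_props(5)[OF c z]])
  have "geodesic_accel g c z v = - (matrix_inv ?G *v F)"
  proof -
    have "(\<Sum>\<alpha>\<in>UNIV. \<Sum>\<beta>\<in>UNIV. christoffel g c (cinv c z) \<mu> \<alpha> \<beta> * v $ \<alpha> * v $ \<beta>)
      = (\<Sum>\<nu>\<in>UNIV. matrix_inv ?G $ \<mu> $ \<nu> * F $ \<nu>)" for \<mu>
    proof -
      let ?h = "\<lambda>\<alpha> \<beta> \<nu>. matrix_inv ?G $ \<mu> $ \<nu> * ?b \<alpha> \<nu> \<beta>"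
      have "(\<Sum>\<alpha>\<in>UNIV. \<Sum>\<beta>\<in>UNIV. christoffel g c (cinv c z) \<mu> \<alpha> \<beta> * v $ \<alpha> * v $ \<beta>)
        = (\<Sum>\<alpha>\<in>UNIV. \<Sum>\<beta>\<in>UNIV. \<Sum>\<nu>\<in>UNIV. ?h \<alpha> \<beta> \<nu>)"
        unfolding christoffel_def sum_distrib_right by (intro sum.cong refl) simp
      also have "\<dots> = (\<Sum>\<alpha>\<in>UNIV. \<Sum>\<nu>\<in>UNIV. \<Sum>\<beta>\<in>UNIV. ?h \<alpha> \<beta> \<nu>)"
        by (intro sum.cong refl sum.swap)
      also have "\<dots> = (\<Sum>\<nu>\<in>UNIV. \<Sum>\<alpha>\<in>UNIV. \<Sum>\<beta>\<in>UNIV. ?h \<alpha> \<beta> \<nu>)" by (rule sum.swap)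
      also have "\<dots> = (\<Sum>\<nu>\<in>UNIV. matrix_inv ?G $ \<mu> $ \<nu> * F $ \<nu>)"
        by (simp add: F_def sum_distrib_left)
      finally show ?thesis .
    qed
    then show ?thesis by (simp add: geodesic_accel_def vec_eq_iff matrix_vector_mult_def)
  qed
  then have "?G *v geodesic_accel g c z v = - ((?G ** matrix_inv ?G) *v F)"
    by (simp add: matrix_vector_mul_assoc[symmetric] linear_neg[OF matrix_vector_mul_linear])
  then have "metric_form g c z u (geodesic_accel g c z v) = - (u \<bullet> F)"
    by (simp add: metric_form_def inv)
  also have "u \<bullet> F = metric_form_deriv g c z v u v - metric_form_deriv g c z u v v / 2"
  proof -
    let ?t = "\<lambda>\<alpha> \<nu> \<beta>. v $ \<alpha> * u $ \<nu> * v $ \<beta> * ?T \<alpha> \<nu> \<beta>"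
    have "u \<bullet> F = (\<Sum>\<nu>\<in>UNIV. \<Sum>\<alpha>\<in>UNIV. \<Sum>\<beta>\<in>UNIV. u $ \<nu> * ?b \<alpha> \<nu> \<beta>)"
      by (simp add: inner_vec_def F_def sum_distrib_left)
    also have "\<dots> = (\<Sum>\<nu>\<in>UNIV. \<Sum>\<alpha>\<in>UNIV. \<Sum>\<beta>\<in>UNIV.
         (1/2) * ?t \<alpha> \<nu> \<beta> + (1/2) * ?t \<beta> \<nu> \<alpha> - (1/2) * (u $ \<nu> * v $ \<alpha> * v $ \<beta> * ?T \<nu> \<alpha> \<beta>))"
      by (intro sum.cong refl) (simp add: algebra_simps)
    also have "\<dots> = (1/2) * (\<Sum>\<nu>\<in>UNIV. \<Sum>\<alpha>\<in>UNIV. \<Sum>\<beta>\<in>UNIV. ?t \<alpha> \<nu> \<beta>)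
       + (1/2) * (\<Sum>\<nu>\<in>UNIV. \<Sum>\<alpha>\<in>UNIV. \<Sum>\<beta>\<in>UNIV. ?t \<beta> \<nu> \<alpha>) - (1/2) * metric_form_deriv g c z u v v"
      by (simp only: sum.distrib sum_subtractf sum_distrib_left metric_form_deriv_def)
    also have "(\<Sum>\<nu>\<in>UNIV. \<Sum>\<alpha>\<in>UNIV. \<Sum>\<beta>\<in>UNIV. ?t \<beta> \<nu> \<alpha>) = (\<Sum>\<nu>\<in>UNIV. \<Sum>\<alpha>\<in>UNIV. \<Sum>\<beta>\<in>UNIV. ?t \<alpha> \<nu> \<beta>)"
      by (intro sum.cong refl sum.swap)
    also have "(\<Sum>\<nu>\<in>UNIV. \<Sum>\<alpha>\<in>UNIV. \<Sum>\<beta>\<in>UNIV. ?t \<alpha> \<nu> \<beta>) = metric_form_deriv g c z v u v"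
      unfolding metric_form_deriv_def by (rule sum.swap)
    finally show ?thesis by simp
  qed
  finally show ?thesis by simp
qed

section \<open>Change of chart\<close>

abbreviation "overlap c c' \<equiv> snd c ` (fst c \<inter> fst c')"
abbreviation "jac c c' z \<equiv> frechet_derivative (transition c c') (at z)"
abbreviation "hess c c' z v \<equiv> frechet_derivative (\<lambda>z. jac c c' z v) (at z)"

lemma overlap_props:
  assumes c: "c \<in> A" and c': "c' \<in> A"
  shows "open (overlap c c')" "overlap c c' \<subseteq> coords c"
    "\<And>z. z \<in> overlap c c' \<Longrightarrow> cinv c z \<in> fst c \<inter> fst c'"
    "\<And>z. z \<in> overlap c c' \<Longrightarrow> cinv c' (transition c c' z) = cinv c z"
    "\<And>z. z \<in> overlap c c' \<Longrightarrow> transition c c' z \<in> coords c'"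
proof -
  note p = chart_props[OF c] and p' = chart_props[OF c']
  have e: "overlap c c' = coords c \<inter> cinv c -` fst c'"
    using p(5-7) by (auto simp: image_iff)
  show "open (overlap c c')" unfolding e by (rule continuous_open_preimage[OF p(4,2) p'(1)])
  show "overlap c c' \<subseteq> coords c" by blast
  show i: "cinv c z \<in> fst c \<inter> fst c'" if "z \<in> overlap c c'" for z
    using that p(7) by auto
  show "cinv c' (transition c c' z) = cinv c z" if "z \<in> overlap c c'" for z
    using i[OF that] p'(7) by (simp add: transition_def)
  show "transition c c' z \<in> coords c'" if "z \<in> overlap c c'" for z
    using i[OF that] by (simp add: transition_def)
qed

lemma transition_Ck1:
  assumes "c \<in> A" "c' \<in> A" shows "Ck1_on (Suc (Suc 0)) (overlap c c') (transition c c')"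
  using manifold assms unfolding C21_manifold_def C21_structure_def C21_compatible_def numeral_2_eq_2 by blast

lemma transition_derivative:
  assumes "c \<in> A" "c' \<in> A" "z \<in> overlap c c'"
  shows "(transition c c' has_derivative jac c c' z) (at z)"
  using transition_Ck1[OF assms(1,2)] assms(3) by (auto simp: frechet_derivative_works)

lemma jac_derivative:
  assumes "c \<in> A" "c' \<in> A" "z \<in> overlap c c'"
  shows "((\<lambda>z. jac c c' z v) has_derivative hess c c' z v) (at z)"
  using transition_Ck1[OF assms(1,2)] assms(3) by (auto simp: frechet_derivative_works)

lemma hess_symmetric:
  assumes "c \<in> A" "c' \<in> A" "z \<in> overlap c c'"
  shows "hess c c' z u v = hess c c' z v u"
  by (rule second_derivative_symmetric[OF overlap_props(1)[OF assms(1,2)] assms(3) transition_derivative[OF assms(1,2)]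
      jac_derivative[OF assms] jac_derivative[OF assms]])

lemma metric_form_transform:
  assumes c: "c \<in> A" "c' \<in> A" and z: "z \<in> overlap c c'"
  shows "metric_form g c z v w = metric_form g c' (transition c c' z) (jac c c' z v) (jac c c' z w)"
proof -
  let ?q = "cinv c z"
  let ?J = "matrix (jac c c' z)"
  have q: "?q \<in> fst c \<inter> fst c'" "snd c ?q = z"
    using overlap_props(2,3)[OF c] chart_props(6)[OF c(1)] z by auto
  have "let J = matrix (frechet_derivative (transition c c') (at (snd c ?q)))
        in g c ?q = transpose J ** g c' ?q ** J"
    using metric c q(1) unfolding C11_riemannian_metric_def by blast
  then have t: "g c ?q = transpose ?J ** g c' ?q ** ?J" unfolding Let_def q(2) .
  have J: "?J *v u = jac c c' z u" for u
    using matrix_works[of "jac c c' z"] has_derivative_linear[OF transition_derivative[OF c z]] 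
    by (simp add: linear_matrix_vector_mul_eq)
  have "metric_form g c z v w = v \<bullet> (transpose ?J *v (g c' ?q *v (?J *v w)))"
    unfolding metric_form_def t by (simp only: matrix_vector_mul_assoc matrix_mul_assoc)
  also have "\<dots> = (?J *v v) \<bullet> (g c' ?q *v (?J *v w))"
    by (metis dot_lmul_matrix inner_commute transpose_matrix_vector)
  finally show ?thesis unfolding J by (simp add: metric_form_def overlap_props(4)[OF c z])
qed

lemma jac_surj:
  assumes c: "c \<in> A" "c' \<in> A" and z: "z \<in> overlap c c'"
  shows "surj (jac c c' z)"
proof -
  have lin: "linear (jac c c' z)" by (rule has_derivative_linear[OF transition_derivative[OF c z]])
  have "v = 0" if "jac c c' z v = 0" for v
  proof (rule ccontr)
    assume "v \<noteq> 0"
    then have "0 < metric_form g c z v v"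
      using metric_form_pos[OF c(1)] overlap_props(2)[OF c] z by blast
    then show False unfolding metric_form_transform[OF c z] that
      by (simp add: bilinear_lzero[OF bilinear_metric_form])
  qed
  then have "inj (jac c c' z)" using linear_injective_0[OF lin] by blast
  then show ?thesis by (rule linear_injective_imp_surjective[OF lin]) simp
qed

text \<open>The derivative, along a straight line in one chart, of the transformation law of the metric.\<close>

lemma metric_form_deriv_transform:
  assumes c: "c \<in> A" "c' \<in> A" and z: "z \<in> overlap c c'"
  shows "metric_form_deriv g c z y v w =
     metric_form_deriv g c' (transition c c' z) (jac c c' z y) (jac c c' z v) (jac c c' z w)
     + metric_form g c' (transition c c' z) (hess c c' z v y) (jac c c' z w)
     + metric_form g c' (transition c c' z) (jac c c' z v) (hess c c' z w y)"
    (is "_ = ?R")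
proof -
  let ?l = "\<lambda>s::real. z + s *\<^sub>R y"
  have l: "(?l has_vector_derivative y) (at 0)" by (auto intro!: derivative_eq_intros)
  have ch: "((\<lambda>s. F (?l s)) has_vector_derivative F' y) (at 0)" if "(F has_derivative F') (at z)"
    for F :: "real^'n \<Rightarrow> 'b::real_normed_vector" and F'
    using vector_derivative_diff_chain_within[OF l, of F F'] has_derivative_at_withinI[OF that] by (simp add: o_def)
  have zc: "z \<in> coords c" using overlap_props(2)[OF c] z by blast
  have 1: "((\<lambda>s. metric_form g c (?l s) v w) has_vector_derivative metric_form_deriv g c z y v w) (at 0)"
    by (rule ch[OF metric_form_has_derivative[OF c(1) zc]])
  have d: "((\<lambda>z. metric_form g c' z a b) has_derivative (\<lambda>u. metric_form_deriv g c' (transition c c' z) u a b))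
     (at (transition c c' (z + 0 *\<^sub>R y)))" for a b
    using metric_form_has_derivative[OF c(2) overlap_props(5)[OF c z]] by simp
  have "((\<lambda>s. metric_form g c' (transition c c' (?l s)) (jac c c' (?l s) v) (jac c c' (?l s) w)) has_vector_derivative
     ?R) (at 0)"
    using bilinear_field_derivative_along_curve[where B = "metric_form g c'" and P = "metric_form_deriv g c' (transition c c' z)"
        and X = "\<lambda>s. transition c c' (?l s)" and t = 0 and S = UNIV, OF bilinear_metric_form bilinear_metric_form_deriv d
        ch[OF transition_derivative[OF c z]] ch[OF jac_derivative[OF c z, of v]] ch[OF jac_derivative[OF c z, of w]]]
    by simp
  moreover have "open (?l -` overlap c c')" "0 \<in> ?l -` overlap c c'"
    using overlap_props(1)[OF c] z by (auto intro!: open_vimage continuous_intros)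
  ultimately have "((\<lambda>s. metric_form g c (?l s) v w) has_vector_derivative
     ?R) (at 0)"
    by (rule has_vector_derivative_transform_within_open) (simp add: metric_form_transform[OF c])
  from vector_derivative_unique_at[OF 1 this] show ?thesis .
qed

text \<open>Differentiating the transformation law of the metric expresses the Euler-Lagrange equation of one chart
in the other one. The second derivatives of the transition map enter through \<open>hess c c' z u v\<close> and
\<open>hess c c' z v u\<close> with opposite signs and cancel by symmetry; only \<open>hess c c' z v v\<close> survives, and this
is the extra term in the acceleration of a transformed curve.\<close>

lemma geodesic_accel_transform:
  assumes c: "c \<in> A" "c' \<in> A" and z: "z \<in> overlap c c'"
  shows "geodesic_accel g c' (transition c c' z) (jac c c' z v) = jac c c' z (geodesic_accel g c z v) + hess c c' z v v"
proof (rule metric_form_cancel[OF c(2) overlap_props(5)[OF c z]])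
  fix u'
  obtain u where u: "u' = jac c c' z u" using jac_surj[OF c z] by (meson surjD)
  have zc: "z \<in> coords c" using overlap_props(2)[OF c] z by blast
  let ?M = "metric_form g c' (transition c c' z)" and ?P = "metric_form_deriv g c' (transition c c' z)"
  let ?J = "jac c c' z" and ?H = "hess c c' z"
  have sym: "?M a b = ?M b a" for a b by (rule metric_form_symmetric[OF c(2) overlap_props(5)[OF c z]])
  have "?M (?J u) (?J (geodesic_accel g c z v)) = metric_form_deriv g c z u v v / 2 - metric_form_deriv g c z v u v"
    using geodesic_accel_euler_lagrange[OF c(1) zc] by (simp add: metric_form_transform[OF c z])
  also have "\<dots> = (?P (?J u) (?J v) (?J v) + ?M (?H v u) (?J v) + ?M (?J v) (?H v u)) / 2
     - (?P (?J v) (?J u) (?J v) + ?M (?H u v) (?J v) + ?M (?J u) (?H v v))"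
    by (simp add: metric_form_deriv_transform[OF c z])
  also have "\<dots> = ?P (?J u) (?J v) (?J v) / 2 - ?P (?J v) (?J u) (?J v) - ?M (?J u) (?H v v)"
  proof -
    have "(p + m + m) / 2 - (p' + m + h) = p / 2 - p' - h" for p p' m h :: real by (simp add: field_simps)
    then show ?thesis unfolding hess_symmetric[OF c z, of v u] sym[of "?J v" "?H u v"] .
  qed
  also have "\<dots> = ?M (?J u) (geodesic_accel g c' (transition c c' z) (?J v)) - ?M (?J u) (?H v v)"
    using geodesic_accel_euler_lagrange[OF c(2) overlap_props(5)[OF c z], of "?J u" "?J v"] by simp
  finally show "?M u' (geodesic_accel g c' (transition c c' z) (?J v)) = ?M u' (?J (geodesic_accel g c z v) + ?H v v)"
    by (simp add: u bilinear_radd[OF bilinear_metric_form])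
qed

text \<open>The Jacobian is expanded in components because \<open>jac\<close> is known to be linear only on the overlap, which
the curve may leave away from \<open>t\<close>.\<close>

lemma geodesic_equation_transform:
  assumes c: "c \<in> A" "c' \<in> A" and z: "X t \<in> overlap c c'"
    and X: "(X has_vector_derivative V t) (at t within S)"
    and V: "(V has_vector_derivative geodesic_accel g c (X t) (V t)) (at t within S)"
    and t: "t \<in> S"
  shows "((\<lambda>s. transition c c' (X s)) has_vector_derivative jac c c' (X t) (V t)) (at t within S)"
    "((\<lambda>s. jac c c' (X s) (V s)) has_vector_derivative
       geodesic_accel g c' (transition c c' (X t)) (jac c c' (X t) (V t))) (at t within S)"
proof -
  let ?N = "geodesic_accel g c (X t) (V t)"
  have ch: "((\<lambda>s. F (X s)) has_vector_derivative F' (V t)) (at t within S)" if "(F has_derivative F') (at (X t))"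
    for F :: "real^'n \<Rightarrow> 'b::real_normed_vector" and F'
    using vector_derivative_diff_chain_within[OF X has_derivative_at_withinI[OF that]] by (simp add: o_def)
  show "((\<lambda>s. transition c c' (X s)) has_vector_derivative jac c c' (X t) (V t)) (at t within S)"
    by (rule ch[OF transition_derivative[OF c z]])
  have comp: "((\<lambda>s. V s $ i) has_vector_derivative ?N $ i) (at t within S)" for i
    using bounded_linear.has_vector_derivative[OF bounded_linear_vec_nth V] .
  have expand: "jac c c' y v = (\<Sum>i\<in>UNIV. v $ i *\<^sub>R jac c c' y (axis i 1))" if "y \<in> overlap c c'" for y v
    by (rule linear_component_expansion[OF has_derivative_linear[OF transition_derivative[OF c that]]])
  have "((\<lambda>s. \<Sum>i\<in>UNIV. V s $ i *\<^sub>R jac c c' (X s) (axis i 1)) has_vector_derivative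
     (\<Sum>i\<in>UNIV. V t $ i *\<^sub>R hess c c' (X t) (axis i 1) (V t) + ?N $ i *\<^sub>R jac c c' (X t) (axis i 1))) (at t within S)"
    by (rule has_vector_derivative_sum) (rule has_vector_derivative_scaleR[OF
        comp[folded has_real_derivative_iff_has_vector_derivative] ch[OF jac_derivative[OF c z]]])
  moreover have "(\<Sum>i\<in>UNIV. V t $ i *\<^sub>R hess c c' (X t) (axis i 1) (V t)) = hess c c' (X t) (V t) (V t)"
    using linear_component_expansion[OF has_derivative_linear[OF jac_derivative[OF c z]], of "V t" "V t"]
    by (simp only: hess_symmetric[OF c z, of "axis _ 1" "V t"])
  ultimately have d: "((\<lambda>s. \<Sum>i\<in>UNIV. V s $ i *\<^sub>R jac c c' (X s) (axis i 1)) has_vector_derivative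
     geodesic_accel g c' (transition c c' (X t)) (jac c c' (X t) (V t))) (at t within S)"
    by (simp add: sum.distrib expand[OF z, symmetric] geodesic_accel_transform[OF c z] add.commute)
  have "continuous (at t within S) X" by (rule has_vector_derivative_continuous[OF X])
  then have "\<forall>\<^sub>F s in at t within S. X s \<in> overlap c c'"
    using overlap_props(1)[OF c] z unfolding continuous_within by (rule topological_tendstoD)
  then have "\<forall>\<^sub>F s in at t within S. (\<Sum>i\<in>UNIV. V s $ i *\<^sub>R jac c c' (X s) (axis i 1)) = jac c c' (X s) (V s)"
    by eventually_elim (simp add: expand[symmetric])
  note d' = has_derivative_transform_eventually[OF d[unfolded has_vector_derivative_def] this expand[OF z, symmetric] t]
  show "((\<lambda>s. jac c c' (X s) (V s)) has_vector_derivative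
       geodesic_accel g c' (transition c c' (X t)) (jac c c' (X t) (V t))) (at t within S)"
    unfolding has_vector_derivative_def by (rule d')
qed

end

section \<open>Uniqueness of normal domains\<close>

lemma loc_lipschitz_on_compose:
  assumes f: "loc_lipschitz_on S f" and e: "loc_lipschitz_on T e" and sub: "f ` S \<subseteq> T"
  shows "loc_lipschitz_on S (\<lambda>x. e (f x))"
  unfolding loc_lipschitz_on_def
proof
  fix x assume x: "x \<in> S"
  obtain u L where u: "u > 0" "L-lipschitz_on (cball x u \<inter> S) f"
    using f x unfolding loc_lipschitz_on_def by blast
  obtain u' L' where u': "u' > 0" "L'-lipschitz_on (cball (f x) u' \<inter> T) e"
    using e x sub unfolding loc_lipschitz_on_def by blast
  have L: "0 \<le> L" using u(2) lipschitz_on_nonneg by blast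
  define d where "d = min u (u' / (L + 1))"
  have d: "0 < d" using u(1) u'(1) L by (simp add: d_def)
  have fl: "L-lipschitz_on (cball x d \<inter> S) f"
    by (rule lipschitz_on_subset[OF u(2)]) (auto simp: d_def)
  have "f ` (cball x d \<inter> S) \<subseteq> cball (f x) u' \<inter> T"
  proof
    fix z assume "z \<in> f ` (cball x d \<inter> S)"
    then obtain y where y: "y \<in> cball x d" "y \<in> S" "z = f y" by auto
    have "dist (f x) (f y) \<le> L * dist x y"
      using y x d by (intro lipschitz_onD[OF fl]) auto
    also have "\<dots> \<le> (L + 1) * (u' / (L + 1))"
      using y(1) L by (intro mult_mono) (auto simp: d_def)
    also have "\<dots> = u'" using L by simp
    finally show "z \<in> cball (f x) u' \<inter> T" using y sub by auto
  qed
  then have "(L' * L)-lipschitz_on (cball x d \<inter> S) (\<lambda>x. e (f x))"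
    using lipschitz_on_compose2[OF fl lipschitz_on_subset[OF u'(2)]] by simp
  with d show "\<exists>u>0. \<exists>L. L-lipschitz_on (cball x u \<inter> S) (\<lambda>x. e (f x))" by blast
qed

lemma loc_lipschitz_on_subset:
  assumes "loc_lipschitz_on T f" "S \<subseteq> T" shows "loc_lipschitz_on S f"
  unfolding loc_lipschitz_on_def
proof
  fix x assume "x \<in> S"
  then obtain u L where "u > 0" "L-lipschitz_on (cball x u \<inter> T) f"
    using assms unfolding loc_lipschitz_on_def by blast
  moreover have "cball x u \<inter> S \<subseteq> cball x u \<inter> T" using assms(2) by blast
  ultimately show "\<exists>u>0. \<exists>L. L-lipschitz_on (cball x u \<inter> S) f" using lipschitz_on_subset by blast
qed

lemma lipschitz_imp_loc_lipschitz: "L-lipschitz_on S f \<Longrightarrow> loc_lipschitz_on S f"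
  unfolding loc_lipschitz_on_def using lipschitz_on_subset[of L S f] by (metis inf_le2 zero_less_one)

lemma loc_lipschitz_on_cong:
  assumes "loc_lipschitz_on S f" "\<And>x. x \<in> S \<Longrightarrow> g x = f x" shows "loc_lipschitz_on S g"
  using assms unfolding loc_lipschitz_on_def lipschitz_on_def by (metis Int_iff)

text \<open>The points of a ray that lie in both domains form a nonempty open and closed set, since the
  image of the ray can be lifted through the second homeomorphism.\<close>

lemma normal_domain_subset:
  assumes S: "normal_domain A g c q N S" and S': "normal_domain A g c q N S'"
  shows "S \<subseteq> S'"
proof
  fix v assume v: "v \<in> S"
  let ?e = "exp_map A g c q"
  obtain h where h: "homeomorphism S N ?e h" and o: "open S" and star: "\<And>w s. w \<in> S \<Longrightarrow> s \<in> {0..1} \<Longrightarrow> s *\<^sub>R w \<in> S"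
    using S unfolding normal_domain_def by blast
  obtain h' where h': "homeomorphism S' N ?e h'" and o': "open S'" and star': "\<And>w s. w \<in> S' \<Longrightarrow> s \<in> {0..1} \<Longrightarrow> s *\<^sub>R w \<in> S'"
    using S' unfolding normal_domain_def by blast
  note H = h[unfolded homeomorphism_def] and H' = h'[unfolded homeomorphism_def]
  have zero: "0 \<in> S" using star[OF v, of 0] by simp
  have zero': "0 \<in> S'"
  proof -
    have "?e v \<in> N" using H v by blast
    then have "h' (?e v) \<in> S'" using H' by blast
    from star'[OF this, of 0] show ?thesis by simp
  qed
  define u where "u s = h' (?e (s *\<^sub>R v))" for s :: real
  have cont: "continuous_on {0..1} u"
    unfolding u_def
  proof (rule continuous_on_compose2[of N h'])
    show "continuous_on N h'" using H' by blast
    show "continuous_on {0..1} (\<lambda>s. ?e (s *\<^sub>R v))"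
      by (rule continuous_on_compose2[of S ?e]) (use H star v in \<open>auto intro!: continuous_intros\<close>)
    show "(\<lambda>s. ?e (s *\<^sub>R v)) ` {0..1} \<subseteq> N" using H star[OF v] by blast
  qed
  define E where "E = {s\<in>{0..1}. u s = s *\<^sub>R v}"
  have uS': "u s \<in> S'" "?e (u s) = ?e (s *\<^sub>R v)" if "s \<in> {0..1}" for s
  proof -
    have "?e (s *\<^sub>R v) \<in> N" using H star[OF v that] by blast
    then show "u s \<in> S'" "?e (u s) = ?e (s *\<^sub>R v)" unfolding u_def using H' by blast+
  qed
  have "closedin (top_of_set {0..1}) E"
  proof -
    have "closedin (top_of_set {0..1}) ({0..1} \<inter> (\<lambda>s. u s - s *\<^sub>R v) -` {0})"
      by (rule continuous_closedin_preimage) (auto intro!: continuous_intros cont)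
    moreover have "{0..1} \<inter> (\<lambda>s. u s - s *\<^sub>R v) -` {0} = E" by (auto simp: E_def)
    ultimately show ?thesis by simp
  qed
  moreover have "openin (top_of_set {0..1}) E"
  proof -
    have "E = {0..1} \<inter> u -` S"
    proof (intro equalityI subsetI)
      fix s assume "s \<in> E" then show "s \<in> {0..1} \<inter> u -` S" using star[OF v] by (auto simp: E_def)
    next
      fix s assume s: "s \<in> {0..1} \<inter> u -` S"
      then have "h (?e (u s)) = u s" "h (?e (s *\<^sub>R v)) = s *\<^sub>R v" using H star[OF v] by auto
      moreover have "?e (u s) = ?e (s *\<^sub>R v)" using uS'(2) s by blast
      ultimately have "u s = s *\<^sub>R v" by metis
      with s show "s \<in> E" by (simp add: E_def)
    qed
    then show ?thesis using continuous_openin_preimage[OF cont, of UNIV S] o by simp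
  qed
  moreover have "0 \<in> E" using H' zero' by (simp add: E_def u_def)
  ultimately have "E = {0..1}"
    using connected_clopen[of "{0..1::real}"] connected_Icc[of 0 "1::real"] by blast
  then have "1 \<in> E" by simp
  then show "v \<in> S'" using uS'(1)[of 1] by (simp add: E_def)
qed

lemma normal_domain_unique:
  "normal_domain A g c q N S \<Longrightarrow> normal_domain A g c q N S' \<Longrightarrow> S = S'"
  using normal_domain_subset by (metis subset_antisym)

section \<open>The exponential map on a coordinate ball\<close>

locale normal_ball = riemannian A g + small_metric x0 \<delta> K \<kappa> "metric_form g c" "metric_form_deriv g c" "geodesic_accel g c"
  for A :: "('a::t2_space, 'n::finite) chart set" and g c x0 \<delta> K \<kappa> +
  assumes chart: "c \<in> A" and ball_sub: "ball x0 (2*\<delta>) \<subseteq> snd c ` fst c"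
begin

lemma in_coords: "z \<in> W \<Longrightarrow> z \<in> coords c" using ball_sub by blast

lemma cinv_props:
  assumes "z \<in> W" shows "cinv c z \<in> fst c" "snd c (cinv c z) = z"
  using chart_props(5,6)[OF chart in_coords[OF assms]] .

lemma cinv_C: "z \<in> C \<Longrightarrow> cinv c z \<in> fst c" "z \<in> C \<Longrightarrow> snd c (cinv c z) = z"
  using cinv_props C_sub by blast+

lemma cinv_image: "Z \<subseteq> C \<Longrightarrow> cinv c ` Z = {m \<in> fst c. snd c m \<in> Z}"
  using cinv_C chart_props(7)[OF chart] by (auto simp: image_iff) (metis)+

lemma open_cinv_image:
  assumes "Z \<subseteq> C" "open Z" shows "open (cinv c ` Z)"
proof -
  have "cinv c ` Z = fst c \<inter> snd c -` Z" using cinv_image[OF assms(1)] by auto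
  then show ?thesis using continuous_open_preimage[OF chart_props(3,1)[OF chart] assms(2)] by simp
qed

lemma geodesic_solution_imp_geod:
  assumes sol: "geodesic_solution A g J \<gamma>" and I: "I \<subseteq> J" and \<gamma>: "\<gamma> ` I \<subseteq> fst c"
  shows "geod I (\<lambda>t. snd c (\<gamma> t)) (velocity c J \<gamma>)"
  unfolding geod_def
proof (intro ballI conjI)
  fix t assume t: "t \<in> I"
  have gt: "\<gamma> t \<in> fst c" and tJ: "t \<in> J" using t \<gamma> I by auto
  have d: "((\<lambda>s. snd c (\<gamma> s)) has_vector_derivative velocity c J \<gamma> t) (at t within J)"
    "(velocity c J \<gamma> has_vector_derivative geodesic_accel g c (snd c (\<gamma> t)) (velocity c J \<gamma> t)) (at t within J)"
    using sol chart gt tJ unfolding geodesic_solution_def geodesic_accel_def chart_props(7)[OF chart gt] by blast+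
  show "((\<lambda>s. snd c (\<gamma> s)) has_vector_derivative velocity c J \<gamma> t) (at t within I)"
    "(velocity c J \<gamma> has_vector_derivative geodesic_accel g c (snd c (\<gamma> t)) (velocity c J \<gamma> t)) (at t within I)"
    using d has_vector_derivative_within_subset I by blast+
qed

lemma at_within_unit_interval: "t \<in> {0..1} \<Longrightarrow> at t within {0..1::real} \<noteq> bot"
  by (simp add: trivial_limit_within)

text \<open>A solution of the geodesic equation in the one chart \<open>c\<close> is a solution in every chart, also where
the image of the curve is only partially covered by that chart.\<close>

lemma geod_imp_geodesic_solution:
  assumes g: "geod {0..1} X V" and XW: "X ` {0..1} \<subseteq> W"
  shows "geodesic_solution A g {0..1} (\<lambda>t. cinv c (X t))"
    "\<And>t. t \<in> {0..1} \<Longrightarrow> velocity c {0..1} (\<lambda>t. cinv c (X t)) t = V t"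
proof -
  let ?\<gamma> = "\<lambda>t. cinv c (X t)"
  have XtW: "X t \<in> W" if "t \<in> {0..1}" for t using XW that by blast
  have cont: "continuous_on {0..1} ?\<gamma>"
    by (rule continuous_on_compose2[OF chart_props(4)[OF chart] geod_continuous(1)[OF g]]) (use XtW in_coords in blast)
  show vel: "velocity c {0..1} ?\<gamma> t = V t" if t: "t \<in> {0..1}" for t
    unfolding velocity_def
  proof (rule vector_derivative_within[OF at_within_unit_interval[OF t]])
    show "((\<lambda>s. snd c (?\<gamma> s)) has_vector_derivative V t) (at t within {0..1})"
      unfolding has_vector_derivative_def
      by (rule has_derivative_transform[OF t _ geodD(1)[OF g t, unfolded has_vector_derivative_def]])
         (use cinv_props XtW in auto)
  qed
  have main: "((\<lambda>s. snd c' (?\<gamma> s)) has_vector_derivative velocity c' {0..1} ?\<gamma> t) (at t within {0..1}) \<and>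
    (velocity c' {0..1} ?\<gamma> has_vector_derivative
           (\<chi> \<mu>. - (\<Sum>\<alpha>\<in>UNIV. \<Sum>\<beta>\<in>UNIV. christoffel g c' (?\<gamma> t) \<mu> \<alpha> \<beta> *
                      velocity c' {0..1} ?\<gamma> t $ \<alpha> * velocity c' {0..1} ?\<gamma> t $ \<beta>))) (at t within {0..1})"
    if c': "c' \<in> A" and t: "t \<in> {0..1}" and gt: "?\<gamma> t \<in> fst c'" for c' t
  proof -
    have ov: "X s \<in> overlap c c'" if "s \<in> {0..1}" "?\<gamma> s \<in> fst c'" for s
      using cinv_props[OF XtW[OF that(1)]] that(2) by (metis IntI imageI)
    have d: "((\<lambda>s. snd c' (?\<gamma> s)) has_vector_derivative jac c c' (X s) (V s)) (at s within {0..1})"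
      "((\<lambda>s. jac c c' (X s) (V s)) has_vector_derivative
       geodesic_accel g c' (transition c c' (X s)) (jac c c' (X s) (V s))) (at s within {0..1})"
      if s: "s \<in> {0..1}" "?\<gamma> s \<in> fst c'" for s
      using geodesic_equation_transform[where S = "{0..1}" and X = X and V = V, OF chart c' ov[OF s] geodD[OF g s(1)] s(1)] 
      by (simp_all add: transition_def)
    have v: "velocity c' {0..1} ?\<gamma> s = jac c c' (X s) (V s)" if s: "s \<in> {0..1}" "?\<gamma> s \<in> fst c'" for s
      unfolding velocity_def by (rule vector_derivative_within[OF at_within_unit_interval[OF s(1)] d(1)[OF s]])
    have "(?\<gamma> \<longlongrightarrow> ?\<gamma> t) (at t within {0..1})" using cont t by (simp add: continuous_on_def)
    from topological_tendstoD[OF this chart_props(1)[OF c'] gt]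
    have "\<forall>\<^sub>F s in at t within {0..1}. jac c c' (X s) (V s) = velocity c' {0..1} ?\<gamma> s"
      using v by (auto simp: eventually_at_topological)
    from has_derivative_transform_eventually[OF d(2)[OF t gt, unfolded has_vector_derivative_def] this v[OF t gt, symmetric] t]
    have "(velocity c' {0..1} ?\<gamma> has_vector_derivative
       geodesic_accel g c' (transition c c' (X t)) (velocity c' {0..1} ?\<gamma> t)) (at t within {0..1})"
      unfolding has_vector_derivative_def v[OF t gt] .
    moreover have "cinv c' (transition c c' (X t)) = ?\<gamma> t"
      by (rule overlap_props(4)[OF chart c' ov[OF t gt]])
    ultimately show ?thesis using d(1)[OF t gt] unfolding v[OF t gt, symmetric] geodesic_accel_def by simp
  qed
  have "interior {0..1::real} \<noteq> {}" by simp
  then show "geodesic_solution A g {0..1} ?\<gamma>"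
    unfolding geodesic_solution_def using cont main is_interval_cc by blast
qed

text \<open>Another solution with the same initial velocity agrees with the given one as long as it stays
  in the coordinate ball, hence also at the first time at which it would leave it.\<close>

lemma geodesic_from_unique:
  assumes con: "connects q r X V" and \<gamma>: "geodesic_from A g c (cinv c q) (V 0) \<gamma>" and t: "t \<in> {0..1}"
  shows "\<gamma> t = cinv c (X t)"
proof -
  note X = connectsD[OF con]
  have sol: "geodesic_solution A g {0..1} \<gamma>" and \<gamma>0: "\<gamma> 0 = cinv c q" and v0: "velocity c {0..1} \<gamma> 0 = V 0"
    using \<gamma> unfolding geodesic_from_def by auto
  have cont: "continuous_on {0..1} \<gamma>" using sol unfolding geodesic_solution_def by blast
  let ?M = "cinv c ` C"
  have M: "?M = {m \<in> fst c. snd c m \<in> C}" by (rule cinv_image) simp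
  have contX: "continuous_on {0..1} (\<lambda>t. cinv c (X t))"
    by (rule continuous_on_compose2[OF chart_props(4)[OF chart] geod_continuous(1)[OF X(1)]])
       (use X(2) C_sub in_coords in blast)
  have agree: "\<gamma> s = cinv c (X s)" if s: "s \<in> {0..1}" and sM: "\<gamma> ` {0..s} \<subseteq> ?M" for s
  proof -
    have sub: "{0..s} \<subseteq> {0..1}" using s by auto
    have g1: "geod {0..s} (\<lambda>t. snd c (\<gamma> t)) (velocity c {0..1} \<gamma>)"
      by (rule geodesic_solution_imp_geod[OF sol sub]) (use sM M in blast)
    have C1: "(\<lambda>t. snd c (\<gamma> t)) ` {0..s} \<subseteq> C" using sM M by blast
    have in0s: "0 \<in> {0..s}" "s \<in> {0..s}" using s by auto
    have s1: "\<gamma> s \<in> fst c" using sM M in0s by blast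
    have q0: "snd c (\<gamma> 0) = X 0" using cinv_C(2)[OF X(5)] X(3) by (simp add: \<gamma>0)
    note c1 = geod_segment[OF g1 C1 convex_real_interval(5) in0s]
    have in01: "0 \<in> {0..1::real}" by simp
    note c2 = geod_segment[OF X(1,2) convex_real_interval(5) in01 s]
    have "snd c (\<gamma> s) = X s"
      by (rule connects_unique_initial_velocity[OF c1[unfolded q0] c2]) (simp add: v0)
    then show ?thesis using chart_props(7)[OF chart s1] by metis
  qed
  \<comment> \<open>The times outside the ball; the first one would be \<open>Inf E\<close>.\<close>
  define E where "E = {t\<in>{0..1}. \<gamma> t \<notin> ?M}"
  have "E = {}"
  proof (rule ccontr)
    assume ne: "E \<noteq> {}"
    have "closed ({0..1} \<inter> \<gamma> -` (- ?M))"
      by (rule continuous_closed_preimage[OF cont closed_atLeastAtMost]) (simp add: closed_Compl open_cinv_image)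
    moreover have "{0..1} \<inter> \<gamma> -` (- ?M) = E" by (auto simp: E_def)
    ultimately have clE: "closed E" by simp
    have bdd: "bdd_below E" by (rule bdd_belowI[of _ 0]) (auto simp: E_def)
    define T where "T = Inf E"
    have TE: "T \<in> E" unfolding T_def by (rule closed_contains_Inf[OF ne bdd clE])
    have below: "t \<notin> E" if "t < T" for t using that cInf_lower[OF _ bdd] unfolding T_def by (meson not_le)
    have "\<gamma> 0 \<in> ?M" using X(5) by (simp add: \<gamma>0)
    then have T: "0 < T" "T \<le> 1" "T \<in> {0..1}" using TE by (auto simp: E_def order.order_iff_strict)
    have ag: "\<gamma> s = cinv c (X s)" if "s \<in> {0..<T}" for s
      by (rule agree) (use that below T in \<open>auto simp: E_def image_subset_iff\<close>)
    have sub: "{0..<T} \<subseteq> {0..1}" using T by auto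
    have "at T within {0..<T} \<noteq> bot" using T(1) by (simp add: trivial_limit_within)
    moreover have l1: "(\<gamma> \<longlongrightarrow> \<gamma> T) (at T within {0..<T})"
      using cont T(3) sub tendsto_within_subset unfolding continuous_on_def by blast
    moreover have l2: "((\<lambda>s. cinv c (X s)) \<longlongrightarrow> cinv c (X T)) (at T within {0..<T})"
      using contX T(3) sub tendsto_within_subset unfolding continuous_on_def by blast
    moreover have "((\<lambda>s. cinv c (X s)) \<longlongrightarrow> \<gamma> T) (at T within {0..<T})"
      by (rule Lim_transform_eventually[OF l1]) (use ag in \<open>auto simp: eventually_at_filter\<close>)
    ultimately have "\<gamma> T = cinv c (X T)" using tendsto_unique by blast
    then have "\<gamma> T \<in> ?M" using X(7)[OF T(3)] by blast
    then show False using TE by (simp add: E_def)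
  qed
  then show ?thesis using t by (intro agree) (auto simp: E_def image_subset_iff)
qed

lemma connects_geodesic_from:
  assumes con: "connects q r X V"
  shows "geodesic_from A g c (cinv c q) (V 0) (\<lambda>t. cinv c (X t))"
proof -
  have "X ` {0..1} \<subseteq> W" using connectsD(2)[OF con] C_sub by blast
  from geod_imp_geodesic_solution[OF connectsD(1)[OF con] this] connectsD(3)[OF con]
  show ?thesis unfolding geodesic_from_def by simp
qed

text \<open>Uniqueness of solutions turns the definite description of the exponential map into the end point of the geodesic at hand.\<close>

lemma exp_map_init_velocity:
  assumes "q \<in> C" "r \<in> C"
  shows "init_velocity q r \<in> exp_dom A g c (cinv c q)" "exp_map A g c (cinv c q) (init_velocity q r) = cinv c r"
proof -
  obtain X V where con: "connects q r X V" using connects_exists[OF assms] by blast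
  note f = connects_geodesic_from[OF con]
  show "init_velocity q r \<in> exp_dom A g c (cinv c q)"
    unfolding exp_dom_def velocity_eq(1)[OF con] using f by blast
  have "\<gamma> 1 = cinv c r" if "geodesic_from A g c (cinv c q) (V 0) \<gamma>" for \<gamma>
    using geodesic_from_unique[OF con that, of 1] connectsD(4)[OF con] by simp
  then show "exp_map A g c (cinv c q) (init_velocity q r) = cinv c r"
    unfolding exp_map_def velocity_eq(1)[OF con] using f connectsD(4)[OF con] by (intro the_equality) blast+
qed

text \<open>Coordinate balls and balls of the Riemannian distance are both of this kind, so what follows about
normal neighbourhoods covers them simultaneously.\<close>

definition geod_convex :: "(real^'n) set \<Rightarrow> bool" where
  "geod_convex Z \<longleftrightarrow> Z \<subseteq> C \<and> open Z \<and>
     (\<forall>z1\<in>Z. \<forall>z2\<in>Z. \<forall>X V. connects z1 z2 X V \<longrightarrow> X ` {0..1} \<subseteq> Z)"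

text \<open>The star-shaped set consists of the initial velocities of the geodesics from \<open>q\<close> to the points of \<open>Z\<close>.
It is open by invariance of domain, and star-shaped because initial pieces of geodesics stay in \<open>Z\<close>. The
bi-Lipschitz estimate for initial velocities makes the exponential map a homeomorphism with the
required regularity.\<close>

lemma normal_domain_geod_convex:
  assumes Z: "geod_convex Z" and q: "q \<in> Z"
  shows "normal_domain A g c (cinv c q) (cinv c ` Z) (init_velocity q ` Z)"
proof -
  let ?i = "init_velocity q" and ?e = "exp_map A g c (cinv c q)"
  let ?S = "?i ` Z" and ?N = "cinv c ` Z"
  have ZC: "\<And>z. z \<in> Z \<Longrightarrow> z \<in> C" and oZ: "open Z"
    and convex: "\<And>z1 z2 X V. z1 \<in> Z \<Longrightarrow> z2 \<in> Z \<Longrightarrow> connects z1 z2 X V \<Longrightarrow> X ` {0..1} \<subseteq> Z"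
    using Z unfolding geod_convex_def by blast+
  have qC: "q \<in> C" by (rule ZC[OF q])
  have lip: "2-lipschitz_on Z ?i"
    by (rule lipschitz_onI) (use velocity_difference(3)[OF qC] ZC in \<open>auto simp: dist_norm\<close>)
  have inv: "dist r r' \<le> 2 * dist (?i r) (?i r')" if "r \<in> Z" "r' \<in> Z" for r r'
    using velocity_difference(4)[OF qC ZC[OF that(1)] ZC[OF that(2)]] by (simp add: dist_norm)
  have inj: "inj_on ?i Z" by (rule inj_onI) (use inv in fastforce)
  define e where "e = inv_into Z ?i"
  have e: "e (?i r) = r" if "r \<in> Z" for r unfolding e_def by (rule inv_into_f_f[OF inj that])
  have elip: "2-lipschitz_on ?S e"
    by (rule lipschitz_onI) (use inv e in auto)
  have ex: "?e (?i r) = cinv c r" if "r \<in> Z" for r by (rule exp_map_init_velocity(2)[OF qC ZC[OF that]])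
  have ee: "?e v = cinv c (e v)" "e v \<in> Z" if "v \<in> ?S" for v using that ex e by auto
  have "open ?S" by (rule invariance_of_domain[OF lipschitz_on_continuous_on[OF lip] oZ inj])
  moreover have "s *\<^sub>R v \<in> ?S" if v: "v \<in> ?S" and s: "s \<in> {0..1}" for v s
  proof -
    obtain r where r: "r \<in> Z" "v = ?i r" using v by blast
    obtain X V where con: "connects q r X V" using connects_exists[OF qC ZC[OF r(1)]] by blast
    have "0 \<in> {0..1::real}" by simp
    from geod_segment[OF connectsD(1,2)[OF con] convex_real_interval(5) this s]
    have "?i (X s) = s *\<^sub>R V 0" using connectsD(3)[OF con] velocity_eq(1) by fastforce
    moreover have "X s \<in> Z" using convex[OF q r(1) con] s by blast
    ultimately show ?thesis unfolding r(2) velocity_eq(1)[OF con] by (metis image_eqI)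
  qed
  moreover have "?S \<subseteq> exp_dom A g c (cinv c q)" using exp_map_init_velocity(1)[OF qC] ZC by blast
  moreover have "homeomorphism ?S ?N ?e (\<lambda>m. ?i (snd c m))"
  proof (rule homeomorphismI)
    have "continuous_on ?S (\<lambda>v. cinv c (e v))"
      by (rule continuous_on_compose2[OF chart_props(4)[OF chart] lipschitz_on_continuous_on[OF elip]])
         (use ee(2) ZC C_sub in_coords in blast)
    then show "continuous_on ?S ?e" by (rule continuous_on_eq) (simp add: ee(1))
    have sndN: "snd c m \<in> Z" "m \<in> fst c" if "m \<in> ?N" for m using that cinv_C ZC by auto
    have "continuous_on ?N (snd c)"
      by (rule continuous_on_subset[OF chart_props(3)[OF chart]]) (use sndN in blast)
    then show "continuous_on ?N (\<lambda>m. ?i (snd c m))"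
      by (rule continuous_on_compose2[OF lipschitz_on_continuous_on[OF lip]]) (use sndN in blast)
    show "?e ` ?S \<subseteq> ?N" using ex by auto
    show "(\<lambda>m. ?i (snd c m)) ` ?N \<subseteq> ?S" using sndN by blast
    show "?i (snd c (?e v)) = v" if "v \<in> ?S" for v using that ex ZC cinv_C(2) by auto
    show "?e (?i (snd c m)) = m" if "m \<in> ?N" for m using that ex ZC cinv_C(2) by auto
  qed
  moreover have "loc_lipschitz_on {v\<in>?S. ?e v \<in> fst c'} (\<lambda>v. snd c' (?e v))"
    "loc_lipschitz_on (snd c' ` (?N \<inter> fst c')) (\<lambda>z. ?i (snd c (cinv c' z)))" if c': "c' \<in> A" for c'
  proof -
    have t: "loc_lipschitz_on (overlap c c') (transition c c')"
      by (rule Ck1_imp_loc_lipschitz[OF overlap_props(1)[OF chart c'] transition_Ck1[OF chart c']])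
    have t': "loc_lipschitz_on (overlap c' c) (transition c' c)"
      by (rule Ck1_imp_loc_lipschitz[OF overlap_props(1)[OF c' chart] transition_Ck1[OF c' chart]])
    let ?D = "{v\<in>?S. ?e v \<in> fst c'}"
    have "loc_lipschitz_on ?D e"
      by (rule lipschitz_imp_loc_lipschitz[OF lipschitz_on_subset[OF elip]]) blast
    moreover have "e ` ?D \<subseteq> overlap c c'"
    proof
      fix z assume "z \<in> e ` ?D"
      then obtain v where v: "v \<in> ?S" "?e v \<in> fst c'" "z = e v" by blast
      have "e v \<in> C" using ee(2)[OF v(1)] ZC by blast
      then show "z \<in> overlap c c'" using cinv_C ee(1)[OF v(1)] v(2,3) by (metis IntI imageI)
    qed
    ultimately have "loc_lipschitz_on ?D (\<lambda>v. transition c c' (e v))" by (rule loc_lipschitz_on_compose[OF _ t])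
    then show "loc_lipschitz_on ?D (\<lambda>v. snd c' (?e v))"
      by (rule loc_lipschitz_on_cong) (simp add: transition_def ee(1))
    let ?D' = "snd c' ` (?N \<inter> fst c')"
    have Nc: "?N \<subseteq> fst c" using cinv_C(1) ZC by blast
    have "loc_lipschitz_on ?D' (transition c' c)"
      by (rule loc_lipschitz_on_subset[OF t']) (use Nc in blast)
    moreover have "transition c' c ` ?D' \<subseteq> Z"
      using chart_props(7)[OF c'] cinv_C(2) ZC by (auto simp: transition_def)
    ultimately have "loc_lipschitz_on ?D' (\<lambda>z. ?i (transition c' c z))"
      by (rule loc_lipschitz_on_compose[OF _ lipschitz_imp_loc_lipschitz[OF lip]])
    then show "loc_lipschitz_on ?D' (\<lambda>z. ?i (snd c (cinv c' z)))" by (simp add: transition_def)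
  qed
  ultimately show ?thesis unfolding normal_domain_def by blast
qed

lemma convex_normal_geod_convex:
  assumes Z: "geod_convex Z" shows "convex_normal A g (cinv c ` Z)"
proof -
  have ZC: "Z \<subseteq> C" "open Z" using Z unfolding geod_convex_def by auto
  show ?thesis unfolding convex_normal_def normal_nbhd_def
    using open_cinv_image[OF ZC] normal_domain_geod_convex[OF Z] chart cinv_C(1) ZC(1) by blast
qed

text \<open>By uniqueness of the star-shaped set, the inverse exponential map and hence the squared distance do not
depend on the geodesically convex set with respect to which they are formed.\<close>

lemma sqdist_on_eq_energy:
  assumes Z: "geod_convex Z" and q: "q \<in> Z" and r: "r \<in> Z"
  shows "sqdist_on A g c (cinv c ` Z) (cinv c q) (cinv c r) = energy q r"
proof -
  note nd = normal_domain_geod_convex[OF Z q]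
  have C: "q \<in> C" "r \<in> C" using Z q r unfolding geod_convex_def by auto
  have some: "(SOME S. normal_domain A g c (cinv c q) (cinv c ` Z) S) = init_velocity q ` Z"
    by (rule some_equality[where P = "normal_domain A g c (cinv c q) (cinv c ` Z)", OF nd]) (rule normal_domain_unique[OF _ nd])
  obtain h where "homeomorphism (init_velocity q ` Z) (cinv c ` Z) (exp_map A g c (cinv c q)) h"
    using nd unfolding normal_domain_def by blast
  then have inj: "inj_on (exp_map A g c (cinv c q)) (init_velocity q ` Z)"
    unfolding homeomorphism_def by (intro inj_on_inverseI[of _ h]) blast
  have "exp_inv A g c (cinv c q) (cinv c ` Z) (cinv c r) = init_velocity q r"
    using inv_into_f_f[OF inj imageI[OF r]] unfolding exp_inv_def some exp_map_init_velocity(2)[OF C] .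
  then show ?thesis by (simp add: sqdist_on_def energy_def metric_form_def Let_def)
qed

text \<open>The closure lies in the ball where geodesic segments exist and are unique, so only the position of
their interior points remains to be checked.\<close>

lemma strictly_convex_normal_geod_convex:
  assumes Z: "geod_convex Z" and cl: "closure (cinv c ` Z) \<subseteq> cinv c ` C"
    and int: "\<And>z1 z2 X V t. connects z1 z2 X V \<Longrightarrow> z1 \<noteq> z2 \<Longrightarrow> cinv c z1 \<in> closure (cinv c ` Z) \<Longrightarrow>
        cinv c z2 \<in> closure (cinv c ` Z) \<Longrightarrow> 0 < t \<Longrightarrow> t < 1 \<Longrightarrow> X t \<in> Z"
  shows "strictly_convex_normal A g (cinv c ` Z)"
  unfolding strictly_convex_normal_def Let_def
proof (intro conjI ballI impI allI)
  show "convex_normal A g (cinv c ` Z)" by (rule convex_normal_geod_convex[OF Z])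
  fix m1 m2 assume m: "m1 \<in> closure (cinv c ` Z)" "m2 \<in> closure (cinv c ` Z)" "m1 \<noteq> m2"
  obtain z1 z2 where z: "z1 \<in> C" "z2 \<in> C" "m1 = cinv c z1" "m2 = cinv c z2" using m(1,2) cl by blast
  obtain X V where con: "connects z1 z2 X V" using connects_exists[OF z(1,2)] by blast
  let ?\<gamma> = "\<lambda>t. cinv c (X t)"
  have XZ: "X t \<in> Z" if "t \<in> {0<..<1}" for t
    by (rule int[OF con]) (use m z that in auto)
  show "\<exists>\<gamma>. is_geodesic A g {0..1} \<gamma> \<and> \<gamma> 0 = m1 \<and> \<gamma> 1 = m2 \<and> \<gamma> ` {0<..<1} \<subseteq> cinv c ` Z"
  proof (intro exI[of _ ?\<gamma>] conjI)
    have ends: "?\<gamma> 0 = m1" "?\<gamma> 1 = m2" using connectsD(3,4)[OF con] z(3,4) by simp_all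
    then show "?\<gamma> 0 = m1" "?\<gamma> 1 = m2" by simp_all
    have "\<not> ?\<gamma> constant_on {0..1}" using ends m(3) unfolding constant_on_def by force
    then show "is_geodesic A g {0..1} ?\<gamma>"
      using connects_geodesic_from[OF con] unfolding is_geodesic_def geodesic_from_def by blast
    show "?\<gamma> ` {0<..<1} \<subseteq> cinv c ` Z" using XZ by blast
  qed
  fix \<gamma> \<gamma>' t
  assume P: "(is_geodesic A g {0..1} \<gamma> \<and> \<gamma> 0 = m1 \<and> \<gamma> 1 = m2 \<and> \<gamma> ` {0<..<1} \<subseteq> cinv c ` Z) \<and>
     is_geodesic A g {0..1} \<gamma>' \<and> \<gamma>' 0 = m1 \<and> \<gamma>' 1 = m2 \<and> \<gamma>' ` {0<..<1} \<subseteq> cinv c ` Z" and t: "t \<in> {0..1::real}"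
  have ZC: "Z \<subseteq> C" using Z unfolding geod_convex_def by blast
  have all: "\<beta> t = cinv c (X t)"
    if b: "is_geodesic A g {0..1} \<beta>" "\<beta> 0 = m1" "\<beta> 1 = m2" "\<beta> ` {0<..<1} \<subseteq> cinv c ` Z" for \<beta>
  proof -
    have inC: "\<beta> s \<in> cinv c ` C" if s: "s \<in> {0..1}" for s
    proof -
      consider "s = 0" | "s = 1" | "s \<in> {0<..<1}" using s by fastforce
      then show ?thesis
      proof cases
        case 3
        then have "\<beta> s \<in> cinv c ` Z" using b(4) by blast
        then show ?thesis using ZC by blast
      qed (use b(2,3) z in auto)
    qed
    have inF': "\<beta> s \<in> fst c" "snd c (\<beta> s) \<in> C" if s: "s \<in> {0..1}" for s
    proof -
      obtain z where "z \<in> C" "\<beta> s = cinv c z" using inC[OF s] by blast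
      then show "\<beta> s \<in> fst c" "snd c (\<beta> s) \<in> C" using cinv_C by metis+
    qed
    then have inF: "\<beta> ` {0..1} \<subseteq> fst c" by blast
    have sol: "geodesic_solution A g {0..1} \<beta>" using b(1) unfolding is_geodesic_def by blast
    have "geod {0..1} (\<lambda>t. snd c (\<beta> t)) (velocity c {0..1} \<beta>)"
      by (rule geodesic_solution_imp_geod[OF sol subset_refl inF])
    moreover have "(\<lambda>t. snd c (\<beta> t)) ` {0..1} \<subseteq> C" using inF'(2) by blast
    ultimately have "connects z1 z2 (\<lambda>t. snd c (\<beta> t)) (velocity c {0..1} \<beta>)"
      using b(2,3) z cinv_C(2) unfolding connects_def by simp
    from connects_unique(1)[OF this con t] have "snd c (\<beta> t) = X t" .
    then show ?thesis using chart_props(7)[OF chart inF'(1)[OF t]] by simp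
  qed
  show "\<gamma> t = \<gamma>' t" using all[of \<gamma>] all[of \<gamma>'] P by simp
qed

end

section \<open>Coordinate balls with a nearly flat metric\<close>

context riemannian begin

lemma dmetric_symmetric:
  assumes c: "c \<in> A" and z: "z \<in> coords c"
  shows "dmetric g c (cinv c z) \<nu> \<alpha> \<beta> = dmetric g c (cinv c z) \<nu> \<beta> \<alpha>"
proof -
  have s: "g c (cinv c y) $ \<alpha> $ \<beta> = g c (cinv c y) $ \<beta> $ \<alpha>" if "y \<in> coords c" for y
  proof -
    have "transpose (g c (cinv c y)) $ \<beta> $ \<alpha> = g c (cinv c y) $ \<alpha> $ \<beta>" by (simp add: transpose_def)
    then show ?thesis using metric_props(1)[OF c chart_props(5)[OF c that]] by simp
  qed
  have "((\<lambda>y. g c (cinv c y) $ \<beta> $ \<alpha>) has_derivative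
     (\<lambda>u. \<Sum>\<nu>\<in>UNIV. u $ \<nu> * dmetric g c (cinv c z) \<nu> \<alpha> \<beta>)) (at z)"
    by (rule has_derivative_transform_within_open[OF metric_component_derivative[OF c z] chart_props(2)[OF c] z s])
  from has_derivative_unique[OF this metric_component_derivative[OF c z]]
  have "(\<Sum>i\<in>UNIV. axis \<nu> 1 $ i * dmetric g c (cinv c z) i \<alpha> \<beta>)
     = (\<Sum>i\<in>UNIV. axis \<nu> 1 $ i * dmetric g c (cinv c z) i \<beta> \<alpha>)" by meson
  then show ?thesis by (simp add: axis_def if_distrib[of "\<lambda>x. x * _"] cong: if_cong)
qed

text \<open>Solving the definition of the Christoffel symbols of the first kind for the derivatives of the metric.\<close>

lemma dmetric_zero:
  assumes c: "c \<in> A" and p: "p \<in> fst c" and gp: "g c p = mat 1"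
    and Gam: "\<And>\<mu> \<alpha> \<beta>. christoffel g c p \<mu> \<alpha> \<beta> = 0"
  shows "dmetric g c p \<nu> \<alpha> \<beta> = 0"
proof -
  let ?T = "dmetric g c p"
  have inv: "matrix_inv (mat 1 :: real^'n^'n) = mat 1"
    using matrix_inv_of_definite[of "mat 1 :: real^'n^'n"] by (simp add: matrix_mul_lid)
  have G: "?T \<alpha> \<mu> \<beta> + ?T \<beta> \<mu> \<alpha> - ?T \<mu> \<alpha> \<beta> = 0" for \<mu> \<alpha> \<beta>
  proof -
    have "christoffel g c p \<mu> \<alpha> \<beta> = (\<Sum>\<nu>\<in>UNIV. if \<nu> = \<mu> then (1/2) * (?T \<alpha> \<nu> \<beta> + ?T \<beta> \<nu> \<alpha> - ?T \<nu> \<alpha> \<beta>) else 0)"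
      unfolding christoffel_def gp inv by (intro sum.cong refl) (simp add: mat_def)
    then show ?thesis using Gam[of \<mu> \<alpha> \<beta>] by simp
  qed
  have s: "?T \<nu> \<alpha> \<beta> = ?T \<nu> \<beta> \<alpha>" for \<nu> \<alpha> \<beta>
    using dmetric_symmetric[OF c, of "snd c p"] p chart_props(7)[OF c p] by simp
  show ?thesis using G[where \<mu> = \<alpha> and \<alpha> = \<nu> and \<beta> = \<beta>] G[where \<mu> = \<beta> and \<alpha> = \<alpha> and \<beta> = \<nu>]
      s[of \<nu> \<alpha> \<beta>] s[of \<alpha> \<beta> \<nu>] by linarith
qed

lemma metric_form_deriv_lipschitz:
  assumes L: "\<And>\<nu> \<alpha> \<beta>. \<bar>dmetric g c (cinv c z) \<nu> \<alpha> \<beta> - dmetric g c (cinv c z') \<nu> \<alpha> \<beta>\<bar> \<le> l"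
  shows "\<bar>metric_form_deriv g c z u v w - metric_form_deriv g c z' u v w\<bar>
     \<le> (real CARD('n))^3 * l * (norm u * norm v * norm w)"
proof -
  let ?d = "\<lambda>\<nu> \<alpha> \<beta>. dmetric g c (cinv c z) \<nu> \<alpha> \<beta> - dmetric g c (cinv c z') \<nu> \<alpha> \<beta>"
  let ?m = "norm u * norm v * norm w * l"
  have t: "\<bar>u $ \<nu> * v $ \<alpha> * w $ \<beta> * ?d \<nu> \<alpha> \<beta>\<bar> \<le> ?m" for \<nu> \<alpha> \<beta>
    unfolding abs_mult by (intro mult_mono component_le_norm_cart L) auto
  have "metric_form_deriv g c z u v w - metric_form_deriv g c z' u v w
    = (\<Sum>\<nu>\<in>UNIV. \<Sum>\<alpha>\<in>UNIV. \<Sum>\<beta>\<in>UNIV. u $ \<nu> * v $ \<alpha> * w $ \<beta> * ?d \<nu> \<alpha> \<beta>)"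
    by (simp add: metric_form_deriv_def right_diff_distrib sum_subtractf)
  also have "\<bar>\<dots>\<bar> \<le> (\<Sum>\<nu>\<in>(UNIV::'n set). \<Sum>\<alpha>\<in>(UNIV::'n set). \<Sum>\<beta>\<in>(UNIV::'n set). ?m)"
    by (intro order_trans[OF sum_abs] sum_mono t)
  also have "\<dots> = (real CARD('n))^3 * l * (norm u * norm v * norm w)"
    by (simp add: power3_eq_cube)
  finally show ?thesis .
qed

text \<open>On a small closed ball all partial derivatives of the metric have a common Lipschitz constant, and
the radius is shrunk until the product with it is below \<open>\<kappa>\<close>.\<close>

lemma normal_ball_exists:
  assumes c: "c \<in> A" and p: "p \<in> fst c" and gp: "g c p = mat 1"
    and Gam: "\<And>\<mu> \<alpha> \<beta>. christoffel g c p \<mu> \<alpha> \<beta> = 0" and kap: "0 < \<kappa>" "\<kappa> \<le> 1 / 100000"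
  obtains \<delta> K where "normal_ball A g c (snd c p) \<delta> K \<kappa>"
proof -
  let ?x0 = "snd c p" and ?S = "coords c"
  have x0: "?x0 \<in> ?S" and p': "cinv c ?x0 = p" using p chart_props(7)[OF c p] by auto
  let ?f = "\<lambda>(\<nu>, \<alpha>, \<beta>) z. dmetric g c (cinv c z) \<nu> \<alpha> \<beta>"
  have lip: "loc_lipschitz_on ?S (?f i)" for i
  proof -
    obtain \<nu> \<alpha> \<beta> where i: "i = (\<nu>, \<alpha>, \<beta>)" by (cases i)
    have "Ck1_on 1 ?S (\<lambda>z. g c (cinv c z) $ \<alpha> $ \<beta>)"
      using metric c unfolding C11_riemannian_metric_def by blast
    then have "loc_lipschitz_on ?S (\<lambda>z. frechet_derivative (\<lambda>z. g c (cinv c z) $ \<alpha> $ \<beta>) (at z) (axis \<nu> 1))"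
      unfolding One_nat_def Ck1_on.simps by blast
    then show ?thesis unfolding i
      by (rule loc_lipschitz_on_cong) (simp add: dmetric_def chart_props(6)[OF c])
  qed
  have "\<exists>u L. u > 0 \<and> 0 \<le> L \<and> cball ?x0 u \<subseteq> ?S \<and> (\<forall>i. L-lipschitz_on (cball ?x0 u) (?f i))"
    by (rule loc_lipschitz_finite_family[where f = ?f, OF finite_class.finite_UNIV chart_props(2)[OF c] x0 lip]) (rule exI conjI | assumption | blast)+
  then obtain u L where u: "u > 0" "0 \<le> L" "cball ?x0 u \<subseteq> ?S" "\<forall>i. L-lipschitz_on (cball ?x0 u) (?f i)"
    by blast
  define K where "K = (real CARD('n))^3 * L"
  define \<delta> where "\<delta> = min 1 (min (u / 2) (\<kappa> / (K + 1)))"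
  have K0: "0 \<le> K" using u(2) by (simp add: K_def)
  have d0: "0 < \<delta>" "\<delta> \<le> 1" using u(1) kap K0 by (auto simp: \<delta>_def)
  have "K * \<delta> \<le> (K + 1) * (\<kappa> / (K + 1))" using K0 d0 by (intro mult_mono) (auto simp: \<delta>_def)
  then have Kd: "K * \<delta> \<le> \<kappa>" using K0 by simp
  have "2 * \<delta> \<le> u" by (simp add: \<delta>_def)
  then have W: "z \<in> cball ?x0 u" "z \<in> ?S" if "z \<in> ball ?x0 (2 * \<delta>)" for z
    using that u(3) by (auto simp: subset_iff)
  have P0: "metric_form_deriv g c ?x0 a v w = 0" for a v w
    by (simp add: metric_form_deriv_def p' dmetric_zero[OF c p gp Gam])
  have "small_metric ?x0 \<delta> K \<kappa> (metric_form g c) (metric_form_deriv g c) (geodesic_accel g c)"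
  proof
    show "0 < \<delta>" "\<delta> \<le> 1" "0 \<le> K" "K * \<delta> \<le> \<kappa>" "\<kappa> \<le> 1 / 100000" by fact+
    fix z v w z' a
    show "bilinear (metric_form g c z)" "bilinear (metric_form_deriv g c z a)"
      by (rule bilinear_metric_form bilinear_metric_form_deriv)+
    show "metric_form g c ?x0 v w = v \<bullet> w" by (simp add: metric_form_def p' gp)
    show "metric_form_deriv g c ?x0 a v w = 0" by (rule P0)
    assume z: "z \<in> ball ?x0 (2 * \<delta>)"
    note zS = W(2)[OF z]
    show "metric_form g c z v w = metric_form g c z w v" by (rule metric_form_symmetric[OF c zS])
    show "((\<lambda>z. metric_form g c z v w) has_derivative (\<lambda>u. metric_form_deriv g c z u v w)) (at z)"
      by (rule metric_form_has_derivative[OF c zS])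
    show "metric_form g c z a (geodesic_accel g c z v) = metric_form_deriv g c z a v v / 2 - metric_form_deriv g c z v a v"
      by (rule geodesic_accel_euler_lagrange[OF c zS])
    assume z': "z' \<in> ball ?x0 (2 * \<delta>)"
    have "\<bar>dmetric g c (cinv c z) \<nu> \<alpha> \<beta> - dmetric g c (cinv c z') \<nu> \<alpha> \<beta>\<bar> \<le> L * norm (z - z')" for \<nu> \<alpha> \<beta>
      using lipschitz_onD[OF spec[OF u(4), of "(\<nu>, \<alpha>, \<beta>)"] W(1)[OF z] W(1)[OF z']] by (simp add: dist_norm)
    from metric_form_deriv_lipschitz[OF this]
    show "\<bar>metric_form_deriv g c z a v w - metric_form_deriv g c z' a v w\<bar> \<le> K * norm (z - z') * (norm a * norm v * norm w)"
      by (simp add: K_def mult.assoc)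
  qed
  moreover have "ball ?x0 (2 * \<delta>) \<subseteq> ?S" using W(2) by blast
  ultimately have "normal_ball A g c ?x0 \<delta> K \<kappa>"
    using c riemannian_axioms unfolding normal_ball_def normal_ball_axioms_def by blast
  then show thesis by (rule that)
qed

end

context normal_ball begin

text \<open>The distance of a geodesic to the centre is largest at an end point.\<close>

lemma geod_convex_ball: "d \<le> \<delta> \<Longrightarrow> geod_convex (ball x0 d)"
  unfolding geod_convex_def
proof (intro conjI ballI allI impI)
  assume d: "d \<le> \<delta>"
  then show "ball x0 d \<subseteq> C" by auto
  fix z1 z2 X V assume z: "z1 \<in> ball x0 d" "z2 \<in> ball x0 d" and con: "connects z1 z2 X V"
  have XW: "X ` {0..1} \<subseteq> W" using connectsD(2)[OF con] C_sub by blast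
  show "X ` {0..1} \<subseteq> ball x0 d"
  proof
    fix y assume "y \<in> X ` {0..1}"
    then obtain t where t: "t \<in> {0..1}" "y = X t" by blast
    show "y \<in> ball x0 d"
      using geod_center_distance[OF connectsD(1)[OF con] XW t(1)] z connectsD(3,4)[OF con] t(2)
      by (auto simp: dist_norm norm_minus_commute)
  qed
qed simp

lemma coord_ball_eq:
  assumes "p \<in> fst c" "snd c p = x0" "d \<le> \<delta>" shows "coord_ball c p d = cinv c ` ball x0 d"
proof -
  have "ball x0 d \<subseteq> C" using assms(3) by auto
  then show ?thesis using cinv_image by (auto simp: coord_ball_def assms(2) dist_commute)
qed

section \<open>Squared distance and small balls\<close>

lemma sqdist_on_point:
  assumes Z: "geod_convex Z" and m: "m \<in> cinv c ` Z" "m' \<in> cinv c ` Z"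
  shows "sqdist_on A g c (cinv c ` Z) m m' = energy (snd c m) (snd c m')"
    "(dist_on A g c (cinv c ` Z) m m')\<^sup>2 = energy (snd c m) (snd c m')"
    "snd c m \<in> Z" "snd c m' \<in> Z" "cinv c (snd c m) = m" "cinv c (snd c m') = m'"
proof -
  obtain z z' where z: "z \<in> Z" "m = cinv c z" "z' \<in> Z" "m' = cinv c z'" using m by blast
  have C: "z \<in> C" "z' \<in> C" using Z z unfolding geod_convex_def by blast+
  have x: "snd c m = z" "snd c m' = z'" using z cinv_C(2)[OF C(1)] cinv_C(2)[OF C(2)] by simp_all
  show *: "sqdist_on A g c (cinv c ` Z) m m' = energy (snd c m) (snd c m')"
    unfolding x unfolding z(2,4) by (rule sqdist_on_eq_energy[OF Z z(1,3)])
  show "(dist_on A g c (cinv c ` Z) m m')\<^sup>2 = energy (snd c m) (snd c m')"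
    unfolding dist_on_def * unfolding x by (rule real_sqrt_pow2[OF energy_nonneg[OF C]])
  show "snd c m \<in> Z" "snd c m' \<in> Z" "cinv c (snd c m) = m" "cinv c (snd c m') = m'"
    unfolding x using z by simp_all
qed

lemma sqdist_on_derivative:
  assumes Z: "geod_convex Z" and m: "q \<in> cinv c ` Z" "m \<in> cinv c ` Z"
  shows "((\<lambda>z. sqdist_on A g c (cinv c ` Z) q (cinv c z)) has_derivative
     (\<lambda>u. 2 * metric_form g c (snd c m) (final_velocity (snd c q) (snd c m)) u)) (at (snd c m))"
proof -
  note s = sqdist_on_point[OF Z m]
  have ZC: "Z \<subseteq> C" "open Z" using Z unfolding geod_convex_def by auto
  show ?thesis
  proof (rule has_derivative_transform_within_open[OF energy_has_derivative[OF subsetD[OF ZC(1) s(3)] subsetD[OF ZC(1) s(4)]] ZC(2) s(4)])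
    fix z assume z: "z \<in> Z"
    show "energy (snd c q) z = sqdist_on A g c (cinv c ` Z) q (cinv c z)"
      using sqdist_on_point(1)[OF Z m(1) imageI[OF z]] cinv_C(2)[OF subsetD[OF ZC(1) z]] by simp
  qed
qed

lemma sqdist_on_differential:
  assumes "geod_convex Z" "q \<in> cinv c ` Z" "m \<in> cinv c ` Z"
  shows "differentiable_in c (sqdist_on A g c (cinv c ` Z) q) m"
    "differential c (sqdist_on A g c (cinv c ` Z) q) m
      = (\<lambda>u. 2 * metric_form g c (snd c m) (final_velocity (snd c q) (snd c m)) u)"
  using sqdist_on_derivative[OF assms] frechet_derivative_at[OF sqdist_on_derivative[OF assms]]
  unfolding differentiable_in_def differential_def differentiable_def by auto

lemma geodesic_segment_connects:
  assumes Z: "geod_convex Z" and geo: "is_geodesic A g J \<gamma>" and \<gamma>: "\<gamma> ` J \<subseteq> cinv c ` Z" and ab: "a \<in> J" "b \<in> J"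
  shows "connects (snd c (\<gamma> a)) (snd c (\<gamma> b)) (\<lambda>t. snd c (\<gamma> (a + t * (b - a))))
      (\<lambda>t. (b - a) *\<^sub>R velocity c J \<gamma> (a + t * (b - a)))"
    "energy (snd c (\<gamma> a)) (snd c (\<gamma> b)) =
       (b - a)\<^sup>2 * metric_form g c (snd c (\<gamma> a)) (velocity c J \<gamma> a) (velocity c J \<gamma> a)"
proof -
  have sol: "geodesic_solution A g J \<gamma>" using geo unfolding is_geodesic_def by blast
  have J: "convex J" using sol is_interval_convex unfolding geodesic_solution_def by blast
  have ZC: "Z \<subseteq> C" using Z unfolding geod_convex_def by blast
  have in1: "\<gamma> t \<in> fst c" "snd c (\<gamma> t) \<in> C" if t: "t \<in> J" for t
  proof -
    obtain z where z: "z \<in> C" "\<gamma> t = cinv c z" using \<gamma> t ZC by blast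
    then show "\<gamma> t \<in> fst c" "snd c (\<gamma> t) \<in> C" using cinv_C by metis+
  qed
  then have g: "geod J (\<lambda>t. snd c (\<gamma> t)) (velocity c J \<gamma>)"
    by (intro geodesic_solution_imp_geod[OF sol subset_refl]) blast
  have "(\<lambda>t. snd c (\<gamma> t)) ` J \<subseteq> C" using in1(2) by blast
  from geod_segment[OF g this J ab] energy_along_geod[OF g this J ab]
  show "connects (snd c (\<gamma> a)) (snd c (\<gamma> b)) (\<lambda>t. snd c (\<gamma> (a + t * (b - a))))
      (\<lambda>t. (b - a) *\<^sub>R velocity c J \<gamma> (a + t * (b - a)))"
    "energy (snd c (\<gamma> a)) (snd c (\<gamma> b)) =
       (b - a)\<^sup>2 * metric_form g c (snd c (\<gamma> a)) (velocity c J \<gamma> a) (velocity c J \<gamma> a)" by blast+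
qed

text \<open>The piece between \<open>a\<close> and \<open>b\<close>, rescaled to the unit interval, has velocity multiplied by \<open>b - a\<close>, which
is also its length; dividing the estimate for the rescaled piece by \<open>b - a\<close> gives the claim.\<close>

lemma differential_along_geodesic:
  assumes Z: "geod_convex Z" and q: "q \<in> cinv c ` Z" and geo: "is_geodesic A g J \<gamma>"
    and arc: "arc_length_parametrized A g J \<gamma>" and \<gamma>: "\<gamma> ` J \<subseteq> cinv c ` Z"
    and ab: "a \<in> J" "b \<in> J" "a < b" and e: "100000 * \<kappa> \<le> e"
  shows "\<bar>differential c (sqdist_on A g c (cinv c ` Z) q) (\<gamma> b) (velocity c J \<gamma> b)
     - differential c (sqdist_on A g c (cinv c ` Z) q) (\<gamma> a) (velocity c J \<gamma> a)
     - 2 * dist_on A g c (cinv c ` Z) (\<gamma> a) (\<gamma> b)\<bar> \<le> e * dist_on A g c (cinv c ` Z) (\<gamma> a) (\<gamma> b)"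
proof -
  note con = geodesic_segment_connects[OF Z geo \<gamma> ab(1,2)]
  have m: "\<gamma> a \<in> cinv c ` Z" "\<gamma> b \<in> cinv c ` Z" using \<gamma> ab by auto
  have ZC: "Z \<subseteq> C" using Z unfolding geod_convex_def by blast
  have ga: "\<gamma> a \<in> fst c" using cinv_C(1)[OF subsetD[OF ZC sqdist_on_point(3)[OF Z m]]] sqdist_on_point(5)[OF Z m] by simp
  let ?va = "velocity c J \<gamma> a" and ?vb = "velocity c J \<gamma> b" and ?E = "energy (snd c (\<gamma> a)) (snd c (\<gamma> b))"
  have "metric_form g c (snd c (\<gamma> a)) ?va ?va = 1"
    using arc chart ga ab(1) unfolding arc_length_parametrized_def metric_form_def chart_props(7)[OF chart ga] by blast
  then have E: "?E = (b - a)\<^sup>2" using con(2) by simp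
  have D: "dist_on A g c (cinv c ` Z) (\<gamma> a) (\<gamma> b) = b - a"
    unfolding dist_on_def sqdist_on_point(1)[OF Z m] E using ab(3) by simp
  let ?da = "2 * metric_form g c (snd c (\<gamma> a)) (final_velocity (snd c q) (snd c (\<gamma> a))) ?va"
  let ?db = "2 * metric_form g c (snd c (\<gamma> b)) (final_velocity (snd c q) (snd c (\<gamma> b))) ?vb"
  have qC: "snd c q \<in> C" using sqdist_on_point(3)[OF Z q m(1)] ZC by blast
  have "\<bar>2 * metric_form g c (snd c (\<gamma> b)) (final_velocity (snd c q) (snd c (\<gamma> b))) ((b - a) *\<^sub>R ?vb)
     - 2 * metric_form g c (snd c (\<gamma> a)) (final_velocity (snd c q) (snd c (\<gamma> a))) ((b - a) *\<^sub>R ?va) - 2 * ?E\<bar>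
     \<le> 100000 * \<kappa> * ?E"
    using differential_estimate_geodesic[OF qC con(1)] by simp
  also have "\<dots> \<le> e * ?E" using e E by (intro mult_right_mono) auto
  finally have "\<bar>(b - a) * (?db - ?da - 2 * (b - a))\<bar> \<le> (b - a) * (e * (b - a))"
    unfolding bilinear_rmul[OF bilinear_metric_form] E by (simp add: algebra_simps power2_eq_square)
  then have "\<bar>?db - ?da - 2 * (b - a)\<bar> \<le> e * (b - a)"
    unfolding abs_mult using ab(3) by simp
  then show ?thesis unfolding D sqdist_on_differential(2)[OF Z q m(1)] sqdist_on_differential(2)[OF Z q m(2)] .
qed

text \<open>The sublevel sets of the energy are geodesically convex by strong convexity along geodesics,
  which also keeps the interior of a geodesic between boundary points strictly inside.\<close>

lemma energy_sublevel_strictly_convex: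
  assumes d: "0 < d" "d \<le> \<delta>" and r: "0 < r" "r \<le> d / 6"
  defines "Z \<equiv> {z \<in> ball x0 d. energy x0 z < r\<^sup>2}"
  shows "closure (cinv c ` Z) \<subseteq> cinv c ` ball x0 d" "strictly_convex_normal A g (cinv c ` Z)"
proof -
  have x0C: "x0 \<in> C" using delta by simp
  have bC: "ball x0 d \<subseteq> C" using d by auto
  have cont: "continuous_on C (energy x0)"
    using energy_has_derivative[OF x0C] has_derivative_continuous by (metis continuous_at_imp_continuous_on)
  have k1: "100000 * \<kappa> \<le> 1" using kappa by simp
  have conv: "X ` {0..1} \<subseteq> ball x0 d" if "connects z1 z2 X V" "z1 \<in> ball x0 d" "z2 \<in> ball x0 d" for z1 z2 X V
    using geod_convex_ball[OF d(2)] that unfolding geod_convex_def by blast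
  have gcZ: "geod_convex Z"
    unfolding geod_convex_def
  proof (intro conjI ballI allI impI)
    show "Z \<subseteq> C" using bC by (auto simp: Z_def)
    have "open (ball x0 d \<inter> energy x0 -` {..<r\<^sup>2})"
      by (rule continuous_open_preimage[OF continuous_on_subset[OF cont bC]]) auto
    moreover have "ball x0 d \<inter> energy x0 -` {..<r\<^sup>2} = Z" by (auto simp: Z_def)
    ultimately show "open Z" by simp
    fix z1 z2 X V assume z: "z1 \<in> Z" "z2 \<in> Z" and con: "connects z1 z2 X V"
    show "X ` {0..1} \<subseteq> Z"
    proof
      fix y assume "y \<in> X ` {0..1}"
      then obtain t where t: "t \<in> {0..1}" "y = X t" by blast
      have "0 \<le> (1 - 1 / 2) * t * (1 - t) * energy z1 z2"
        using t energy_nonneg[OF connectsD(5,6)[OF con]] by simp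
      then have "energy x0 (X t) \<le> (1 - t) * energy x0 z1 + t * energy x0 z2"
        using energy_convex_geodesic[OF x0C con k1 t(1)] by linarith
      also have "\<dots> < r\<^sup>2"
      proof (cases "t = 0")
        case False
        then have "t * energy x0 z2 < t * r\<^sup>2" using t z(2) by (auto simp: Z_def)
        moreover have "(1 - t) * energy x0 z1 \<le> (1 - t) * r\<^sup>2" using t z(1) by (intro mult_left_mono) (auto simp: Z_def)
        ultimately have "(1 - t) * energy x0 z1 + t * energy x0 z2 < (1 - t) * r\<^sup>2 + t * r\<^sup>2" by linarith
        then show ?thesis by (simp add: algebra_simps)
      qed (use z in \<open>auto simp: Z_def\<close>)
      finally have "energy x0 y < r\<^sup>2" using t(2) by simp
      moreover have "y \<in> ball x0 d" using conv[OF con] z t unfolding Z_def by blast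
      ultimately show "y \<in> Z" by (simp add: Z_def)
    qed
  qed
  \<comment> \<open>A compact set containing \<open>Z\<close>; its image is closed in the Hausdorff space.\<close>
  define Q where "Q = {z \<in> cball x0 (d / 2). energy x0 z \<le> r\<^sup>2}"
  have cbC: "cball x0 (d / 2) \<subseteq> ball x0 d" using d by auto
  have QC: "Q \<subseteq> ball x0 d" using cbC by (auto simp: Q_def)
  have "compact Q"
  proof -
    have "closed (cball x0 (d / 2) \<inter> energy x0 -` {..r\<^sup>2})"
      by (rule continuous_closed_preimage[OF continuous_on_subset[OF cont]]) (use cbC bC in auto)
    moreover have "cball x0 (d / 2) \<inter> energy x0 -` {..r\<^sup>2} = Q" by (auto simp: Q_def)
    ultimately have "closed Q" by simp
    moreover have "bounded Q" by (rule bounded_subset[OF bounded_cball, of _ x0 "d / 2"]) (auto simp: Q_def)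
    ultimately show ?thesis using compact_eq_bounded_closed by blast
  qed
  moreover have "continuous_on Q (cinv c)"
    by (rule continuous_on_subset[OF chart_props(4)[OF chart]]) (use QC bC C_sub in_coords in blast)
  ultimately have "closed (cinv c ` Q)" using compact_continuous_image compact_imp_closed by blast
  moreover have ZQ: "Z \<subseteq> Q"
  proof
    fix z assume z: "z \<in> Z"
    then have zC: "z \<in> C" using bC by (auto simp: Z_def)
    have "(norm (z - x0))\<^sup>2 \<le> 8 * energy x0 z" by (rule energy_lower_bound[OF x0C zC])
    also have "\<dots> \<le> 9 * r\<^sup>2"
    proof -
      have "energy x0 z < r\<^sup>2" using z by (simp add: Z_def)
      then show ?thesis using zero_le_power2[of r] by linarith
    qed
    also have "\<dots> = (3 * r)\<^sup>2" by (simp add: power_mult_distrib)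
    finally have "norm (z - x0) \<le> 3 * r" by (rule power2_le_imp_le) (use r in simp)
    then show "z \<in> Q" using z r by (auto simp: Z_def Q_def dist_norm norm_minus_commute)
  qed
  ultimately have cl: "closure (cinv c ` Z) \<subseteq> cinv c ` Q" by (intro closure_minimal) auto
  then show "closure (cinv c ` Z) \<subseteq> cinv c ` ball x0 d" using QC by blast
  have inQ: "z \<in> Q" if z: "z \<in> C" and zc: "cinv c z \<in> closure (cinv c ` Z)" for z
  proof -
    obtain z' where z': "z' \<in> Q" "cinv c z = cinv c z'" using subsetD[OF cl zc] by blast
    then have "z' \<in> C" using QC bC by blast
    from cinv_C(2)[OF this] cinv_C(2)[OF z] z' show ?thesis by simp
  qed
  show "strictly_convex_normal A g (cinv c ` Z)"
  proof (rule strictly_convex_normal_geod_convex[OF gcZ])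
    show "closure (cinv c ` Z) \<subseteq> cinv c ` C" using cl QC bC by blast
    fix z1 z2 X V t
    assume con: "connects z1 z2 X V" and ne: "z1 \<noteq> z2" and c1: "cinv c z1 \<in> closure (cinv c ` Z)"
      and c2: "cinv c z2 \<in> closure (cinv c ` Z)" and t: "0 < t" "t < (1::real)"
    have t01: "t \<in> {0..1}" using t by simp
    have zQ: "z1 \<in> Q" "z2 \<in> Q" using inQ[OF connectsD(5)[OF con] c1] inQ[OF connectsD(6)[OF con] c2] .
    have "0 < (norm (z2 - z1))\<^sup>2" using ne by simp
    then have "0 < energy z1 z2" using energy_lower_bound[OF connectsD(5,6)[OF con]] by linarith
    then have "0 < (1 - 1 / 2) * t * (1 - t) * energy z1 z2" using t by simp
    then have "energy x0 (X t) < (1 - t) * energy x0 z1 + t * energy x0 z2"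
      using energy_convex_geodesic[OF x0C con k1 t01] by linarith
    also have "\<dots> \<le> (1 - t) * r\<^sup>2 + t * r\<^sup>2"
      using t zQ by (intro add_mono mult_left_mono) (auto simp: Q_def)
    also have "\<dots> = r\<^sup>2" by (simp add: algebra_simps)
    finally have "energy x0 (X t) < r\<^sup>2" .
    moreover have "X t \<in> ball x0 d" using conv[OF con] zQ QC t01 by blast
    ultimately show "X t \<in> Z" by (simp add: Z_def)
  qed
qed

end

theorem theorem8:
  fixes A :: "('a::t2_space, 'n::finite) chart set"
    and g :: "('a, 'n) metric"
    and p :: 'a and \<epsilon> :: real
    and U :: "'a set" and x :: "'a \<Rightarrow> real^'n"
  assumes "C21_manifold A"
    and "C11_riemannian_metric A g"
    and "\<epsilon> > 0"
    and "(U, x) \<in> A" and "p \<in> U"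
    and "g (U, x) p = mat 1"
    and "\<And>\<mu> \<alpha> \<beta>. christoffel g (U, x) p \<mu> \<alpha> \<beta> = 0"
  shows "\<exists>\<delta>\<^sub>0>0. \<forall>\<delta>. 0 < \<delta> \<and> \<delta> \<le> \<delta>\<^sub>0 \<longrightarrow>
    (let C = coord_ball (U, x) p \<delta>;
         D2 = sqdist_on A g (U, x) C;
         D = dist_on A g (U, x) C;
         dD2 = (\<lambda>q. differential (U, x) (D2 q))
     in
       C \<subseteq> U \<and> ball (x p) \<delta> \<subseteq> x ` U \<and> convex_normal A g C \<and>
       (\<forall>q\<in>C. \<forall>m\<in>C. differentiable_in (U, x) (D2 q) m) \<and>
       (\<forall>q\<in>C. \<forall>q1\<in>C. \<forall>q2\<in>C.
          \<bar>dD2 q q2 (x q2 - x q1) - dD2 q q1 (x q2 - x q1) - 2 * (norm (x q2 - x q1))\<^sup>2\<bar>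
            \<le> \<epsilon> * (norm (x q2 - x q1))\<^sup>2) \<and>
       (\<forall>q\<in>C. \<forall>J \<gamma>.
          is_geodesic A g J \<gamma> \<and> arc_length_parametrized A g J \<gamma> \<and> \<gamma> ` J \<subseteq> C \<longrightarrow>
          (\<forall>a\<in>J. \<forall>b\<in>J. a < b \<longrightarrow>
             \<bar>dD2 q (\<gamma> b) (velocity (U, x) J \<gamma> b) - dD2 q (\<gamma> a) (velocity (U, x) J \<gamma> a)
                - 2 * D (\<gamma> a) (\<gamma> b)\<bar>
               \<le> \<epsilon> * D (\<gamma> a) (\<gamma> b))) \<and>
       (\<forall>q\<in>C. \<forall>q1\<in>C. \<forall>q2\<in>C. \<forall>\<alpha>\<in>{0..1}.
          (D q (cinv (U, x) ((1 - \<alpha>) *\<^sub>R x q1 + \<alpha> *\<^sub>R x q2)))\<^sup>2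
            \<le> (1 - \<alpha>) * (D q q1)\<^sup>2 + \<alpha> * (D q q2)\<^sup>2
               - (1 - \<epsilon> / 2) * \<alpha> * (1 - \<alpha>) * (norm (x q2 - x q1))\<^sup>2) \<and>
       (\<forall>q\<in>C. \<forall>J \<gamma>.
          is_geodesic A g J \<gamma> \<and> \<gamma> ` J \<subseteq> C \<longrightarrow>
          (\<forall>a\<in>J. \<forall>b\<in>J. \<forall>\<alpha>\<in>{0..1}.
             (D q (\<gamma> ((1 - \<alpha>) * a + \<alpha> * b)))\<^sup>2
               \<le> (1 - \<alpha>) * (D q (\<gamma> a))\<^sup>2 + \<alpha> * (D q (\<gamma> b))\<^sup>2
                  - (1 - \<epsilon> / 2) * \<alpha> * (1 - \<alpha>) * (D (\<gamma> a) (\<gamma> b))\<^sup>2)) \<and>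
       (\<exists>r\<^sub>0>0. \<forall>r. 0 < r \<and> r \<le> r\<^sub>0 \<longrightarrow>
          (let B = {m\<in>C. D p m \<in> {0..<r}}
           in closure B \<subseteq> C \<and> strictly_convex_normal A g B)))"
proof -
  \<comment> \<open>The factor is the one lost in the estimates of the differential of the energy.\<close>
  define \<kappa> where "\<kappa> = min \<epsilon> 1 / 100000"
  have \<kappa>: "0 < \<kappa>" "\<kappa> \<le> 1 / 100000" "100000 * \<kappa> \<le> \<epsilon>" using assms(3) by (auto simp: \<kappa>_def)
  let ?c = "(U, x)"
  interpret R: riemannian A g by unfold_locales (rule assms)+
  have p: "p \<in> fst ?c" using assms(5) by simp
  obtain \<delta>\<^sub>0 K where "normal_ball A g ?c (snd ?c p) \<delta>\<^sub>0 K \<kappa>"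
    by (rule R.normal_ball_exists[OF assms(4) p assms(6,7) \<kappa>(1,2)])
  then interpret N: normal_ball A g "(U, x)" "x p" \<delta>\<^sub>0 K \<kappa> by simp
  show ?thesis
  proof (rule exI[of _ \<delta>\<^sub>0], rule conjI[OF N.delta(1)], intro allI impI, goal_cases)
    case (1 \<delta>)
    note \<delta> = 1
    define Z where "Z = ball (x p) \<delta>"
    define M where "M = cinv ?c ` Z"
    have Z: "N.geod_convex Z" unfolding Z_def using N.geod_convex_ball \<delta> by blast
    have ZC: "Z \<subseteq> N.C" using \<delta> by (auto simp: Z_def)
    have M: "coord_ball ?c p \<delta> = M" unfolding M_def Z_def using N.coord_ball_eq[OF p] \<delta> by simp
    note pt = N.sqdist_on_point[OF Z, folded M_def, simplified snd_conv]
    note df = N.sqdist_on_differential[OF Z, folded M_def, simplified snd_conv]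
    have MU: "M \<subseteq> U" unfolding M[symmetric] coord_ball_def by auto
    have inside: "Z \<subseteq> x ` U" using N.in_coords N.C_sub ZC by fastforce
    have normal: "convex_normal A g M" unfolding M_def by (rule N.convex_normal_geod_convex[OF Z])
    have straight: "\<bar>differential ?c (sqdist_on A g ?c M q) q2 (x q2 - x q1) - differential ?c (sqdist_on A g ?c M q) q1 (x q2 - x q1)
        - 2 * (norm (x q2 - x q1))\<^sup>2\<bar> \<le> \<epsilon> * (norm (x q2 - x q1))\<^sup>2"
      if q: "q \<in> M" "q1 \<in> M" "q2 \<in> M" for q q1 q2
    proof -
      have C: "x q \<in> N.C" "x q1 \<in> N.C" "x q2 \<in> N.C" using pt(3) q ZC by blast+
      have "100000 * \<kappa> * (norm (x q2 - x q1))\<^sup>2 \<le> \<epsilon> * (norm (x q2 - x q1))\<^sup>2"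
        using \<kappa>(3) by (rule mult_right_mono) simp
      with N.differential_estimate_straight[OF C] show ?thesis
        unfolding df(2)[OF q(1,3)] df(2)[OF q(1,2)] by (rule order_trans)
    qed
    have along_geodesic: "\<bar>differential ?c (sqdist_on A g ?c M q) (\<gamma> b) (velocity ?c J \<gamma> b)
         - differential ?c (sqdist_on A g ?c M q) (\<gamma> a) (velocity ?c J \<gamma> a)
         - 2 * dist_on A g ?c M (\<gamma> a) (\<gamma> b)\<bar> \<le> \<epsilon> * dist_on A g ?c M (\<gamma> a) (\<gamma> b)"
      if "q \<in> M" "is_geodesic A g J \<gamma>" "arc_length_parametrized A g J \<gamma>" "\<gamma> ` J \<subseteq> M" "a \<in> J" "b \<in> J" "a < b"
      for q J \<gamma> a b
      using N.differential_along_geodesic[OF Z, folded M_def, OF that \<kappa>(3)] .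
    have convex_straight: "(dist_on A g ?c M q (cinv ?c ((1 - \<alpha>) *\<^sub>R x q1 + \<alpha> *\<^sub>R x q2)))\<^sup>2
        \<le> (1 - \<alpha>) * (dist_on A g ?c M q q1)\<^sup>2 + \<alpha> * (dist_on A g ?c M q q2)\<^sup>2
          - (1 - \<epsilon> / 2) * \<alpha> * (1 - \<alpha>) * (norm (x q2 - x q1))\<^sup>2"
      if q: "q \<in> M" "q1 \<in> M" "q2 \<in> M" and \<alpha>: "\<alpha> \<in> {0..1}" for q q1 q2 \<alpha>
    proof -
      let ?z = "(1 - \<alpha>) *\<^sub>R x q1 + \<alpha> *\<^sub>R x q2"
      have zs: "x q \<in> Z" "x q1 \<in> Z" "x q2 \<in> Z" using pt(3) q by blast+
      then have C: "x q \<in> N.C" "x q1 \<in> N.C" "x q2 \<in> N.C" using ZC by blast+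
      have z: "?z \<in> Z" unfolding Z_def
        by (rule convexD[OF convex_ball]) (use zs \<alpha> in \<open>auto simp: Z_def\<close>)
      then have zM: "cinv ?c ?z \<in> M" "x (cinv ?c ?z) = ?z"
        using N.cinv_C(2)[of ?z] ZC unfolding M_def by auto
      show ?thesis unfolding pt(2)[OF q(1) zM(1)] pt(2)[OF q(1,2)] pt(2)[OF q(1,3)] zM(2)
        by (rule N.energy_convex_straight[OF C \<kappa>(3) \<alpha>])
    qed
    have convex_geodesic: "(dist_on A g ?c M q (\<gamma> ((1 - \<alpha>) * a + \<alpha> * b)))\<^sup>2
        \<le> (1 - \<alpha>) * (dist_on A g ?c M q (\<gamma> a))\<^sup>2 + \<alpha> * (dist_on A g ?c M q (\<gamma> b))\<^sup>2
          - (1 - \<epsilon> / 2) * \<alpha> * (1 - \<alpha>) * (dist_on A g ?c M (\<gamma> a) (\<gamma> b))\<^sup>2"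
      if q: "q \<in> M" and geo: "is_geodesic A g J \<gamma>" and \<gamma>: "\<gamma> ` J \<subseteq> M" and ab: "a \<in> J" "b \<in> J" and \<alpha>: "\<alpha> \<in> {0..1}"
      for q J \<gamma> a b \<alpha>
    proof -
      let ?t = "a + \<alpha> * (b - a)"
      have t: "(1 - \<alpha>) * a + \<alpha> * b = ?t" by (simp add: algebra_simps)
      have "convex J" using geo is_interval_convex unfolding is_geodesic_def geodesic_solution_def by blast
      from convexD[OF this ab, of "1 - \<alpha>" \<alpha>] have tJ: "?t \<in> J" using \<alpha> by (simp add: t)
      have m: "\<gamma> a \<in> M" "\<gamma> b \<in> M" "\<gamma> ?t \<in> M" using \<gamma> ab tJ by blast+
      note con = N.geodesic_segment_connects(1)[OF Z geo \<gamma>[unfolded M_def] ab, simplified snd_conv]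
      have "x q \<in> N.C" using pt(3)[OF q q] ZC by blast
      from N.energy_convex_geodesic[OF this con \<kappa>(3) \<alpha>]
      show ?thesis unfolding t pt(2)[OF q m(3)] pt(2)[OF q m(1)] pt(2)[OF q m(2)] pt(2)[OF m(1,2)] .
    qed
    have small_balls: "closure {m\<in>M. dist_on A g ?c M p m \<in> {0..<r}} \<subseteq> M \<and> strictly_convex_normal A g {m\<in>M. dist_on A g ?c M p m \<in> {0..<r}}"
      if r: "0 < r \<and> r \<le> \<delta> / 6" for r
    proof -
      have pM: "p \<in> M" unfolding M[symmetric] coord_ball_def using p \<delta> by simp
      have iff: "dist_on A g ?c M p m \<in> {0..<r} \<longleftrightarrow> N.energy (x p) (x m) < r\<^sup>2" if m: "m \<in> M" for m
      proof -
        have e0: "0 \<le> N.energy (x p) (x m)" using N.energy_nonneg pt(3,4)[OF pM m] ZC by blast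
        have d: "dist_on A g ?c M p m = sqrt (N.energy (x p) (x m))" unfolding dist_on_def pt(1)[OF pM m] ..
        have "sqrt (N.energy (x p) (x m)) < r \<longleftrightarrow> N.energy (x p) (x m) < r\<^sup>2"
          using r real_sqrt_less_iff[of "N.energy (x p) (x m)" "r\<^sup>2"] by simp
        then show ?thesis unfolding d using e0 by simp
      qed
      have "{m\<in>M. dist_on A g ?c M p m \<in> {0..<r}} = {m\<in>M. N.energy (x p) (x m) < r\<^sup>2}"
        using iff by blast
      also have "\<dots> = cinv ?c ` {z \<in> ball (x p) \<delta>. N.energy (x p) z < r\<^sup>2}" (is "?L = ?R")
      proof (intro equalityI subsetI)
        fix m assume "m \<in> ?L"
        then have "m \<in> M" "N.energy (x p) (x m) < r\<^sup>2" by auto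
        then show "m \<in> ?R" using pt(3,5)[of m m] unfolding Z_def by (metis (mono_tags, lifting) imageI mem_Collect_eq)
      next
        fix m assume "m \<in> ?R"
        then obtain z where z: "z \<in> Z" "N.energy (x p) z < r\<^sup>2" "m = cinv ?c z" unfolding Z_def by blast
        have "x m = z" using N.cinv_C(2)[of z] z ZC by auto
        then show "m \<in> ?L" using z unfolding M_def by auto
      qed
      finally show ?thesis
        using N.energy_sublevel_strictly_convex[of \<delta> r] \<delta> r unfolding M_def Z_def by simp
    qed
    have balls: "\<exists>r\<^sub>0>0. \<forall>r. 0 < r \<and> r \<le> r\<^sub>0 \<longrightarrow>
        closure {m\<in>M. dist_on A g ?c M p m \<in> {0..<r}} \<subseteq> M \<and> strictly_convex_normal A g {m\<in>M. dist_on A g ?c M p m \<in> {0..<r}}"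
      \<comment> \<open>Energy below \<open>r\<^sup>2\<close> forces coordinate distance at most \<open>3 * r\<close>, hence at most half the radius.\<close>
      by (rule exI[of _ "\<delta> / 6"]) (use small_balls \<delta> in auto)
    show ?case
      unfolding Let_def M
    proof (intro conjI ballI allI impI, goal_cases)
      case 1 show ?case by (rule MU)
    next
      case 2 show ?case using inside unfolding Z_def .
    next
      case 3 show ?case by (rule normal)
    next
      case (4 q m) then show ?case by (rule df(1))
    next
      case (5 q q1 q2) then show ?case by (rule straight)
    next
      case (6 q J \<gamma> a b) then show ?case by (intro along_geodesic) blast+
    next
      case (7 q q1 q2 \<alpha>) then show ?case by (rule convex_straight)
    next
      case (8 q J \<gamma> a b \<alpha>) then show ?case by (intro convex_geodesic) blast+
    next
      case 9 show ?case by (rule balls)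
    qed
  qed
qed

end
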